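(* Let $\mu>0$, let $\eta:[0,1]\to[0,1]$ be continuous and strictly decreasing with $\eta(0)=1$, $\eta(1)=0$, and let $J$ be the CDF of a probability distribution on $[0,\infty)$ such that, for some integer $\ell\ge 2$, $m^{(k)}:=\int_0^\infty y^k\,dJ(y)<\infty$ for $k=1,\dots,\ell$. Assume in addition that $J$ has a density $J'(y)>0$ which is bounded away from $0$ on compact subsets of $[0,\infty)$. Then: (i) The traveling wave shape $\phi(\cdot)$ is unique up to a shift $\phi(\cdot-c)$, $c\in\mathbb{R}$. (ii) If a mean-field model $f(x,t)$ is such that the initial mean $\bar f(0)=\int_{\mathbb{R}}x\,d_xf(x,0)$ is well-defined and finite (i.e. $\int_{\mathbb{R}}|x|\,d_xf(x,0)<\infty$), then, as $t\to\infty$, $$f(\cdot+vt,t)\to\phi(\cdot)\ \text{ in } L_1(\mathbb{R}),\qquad\text{and}\qquad f(\cdot+vt,t)\to\phi(\cdot)\ \text{ uniformly on }\mathbb{R},$$ where $\phi$ is the traveling wave shape uniquely centered by the condition $\int_{\mathbb{R}}y\,d\phi(y)=\bar f(0)$.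
   Context: RCLL means right-continuous with left limits. A distribution function is a non-decreasing RCLL function $\gamma:\mathbb{R}\to[0,1]$ with limits $0$ at $-\infty$ and $1$ at $+\infty$. Write $\bar J(y)=1-J(y)$. For a distribution function $\gamma$ and $y\in\mathbb{R}$, set $\bar\eta(y,\gamma)=\eta(\gamma(y))$ if $\gamma$ is continuous at $y$, and otherwise $$\bar\eta(y,\gamma)=\frac{1}{\nu_2-\nu_1}\int_{\nu_1}^{\nu_2}\eta(\nu)\,d\nu,\qquad \nu_1=\gamma(y-),\ \nu_2=\gamma(y).$$ Mean-field model: a function $f(x,t)$, $x\in\mathbb{R}$, $t\ge0$, such that (a) for each $t$, $f(\cdot,t)$ is a distribution function; (b) for each $x$, $f(x,\cdot)$ is non-increasing and $c$-Lipschitz in $t$, with a constant $c$ independent of $x$; (c) for each $x$ and each $t$ at which $\frac{\partial}{\partial t}f(x,t)$ exists, $$\frac{\partial}{\partial t}f(x,t)=-\mu\int_{(-\infty,x]}\bar\eta(y,f(\cdot,t))\,\bar J(x-y)\,d_yf(y,t),$$ where $d_y$ denotes the (Stieltjes) differential in $y$. Let $v=\mu\, m^{(1)}\int_0^1\eta(\nu)\,d\nu$. A traveling wave shape is a distribution function $\phi$ such that $f(x,t)=\phi(x-vt)$ is a mean-field model. *)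

theory Defs
  imports "HOL-Analysis.Analysis"
begin

definition distribution_function :: "(real \<Rightarrow> real) \<Rightarrow> bool" where
  "distribution_function \<gamma> \<longleftrightarrow>
     mono \<gamma> \<and> range \<gamma> \<subseteq> {0..1} \<and>
     (\<forall>x. continuous (at_right x) \<gamma>) \<and> (\<forall>x. \<exists>l. (\<gamma> \<longlongrightarrow> l) (at_left x)) \<and>
     (\<gamma> \<longlongrightarrow> 0) at_bot \<and> (\<gamma> \<longlongrightarrow> 1) at_top"

(* The Stieltjes integral with respect to a distribution function \<gamma> is rendered throughout as
   the Lebesgue integral with respect to interval_measure \<gamma>. *)

definition eta_bar :: "(real \<Rightarrow> real) \<Rightarrow> real \<Rightarrow> (real \<Rightarrow> real) \<Rightarrow> real" where
  "eta_bar \<eta> y \<gamma> =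
     (if isCont \<gamma> y then \<eta> (\<gamma> y)
      else (let \<nu>1 = Lim (at_left y) \<gamma>; \<nu>2 = \<gamma> y
            in 1 / (\<nu>2 - \<nu>1) * integral {\<nu>1..\<nu>2} \<eta>))"

(* Only the values f x t with t \<ge> 0 are relevant.  The derivative "at t within {0..}" is the
   ordinary derivative for t > 0 and the right derivative for t = 0. *)

definition mean_field_model ::
  "real \<Rightarrow> (real \<Rightarrow> real) \<Rightarrow> (real \<Rightarrow> real) \<Rightarrow> (real \<Rightarrow> real \<Rightarrow> real) \<Rightarrow> bool" where
  "mean_field_model \<mu> \<eta> J f \<longleftrightarrow>
     (\<forall>t\<ge>0. distribution_function (\<lambda>x. f x t)) \<and>
     (\<exists>c. \<forall>x. antimono_on {0..} (f x) \<and> c-lipschitz_on {0..} (f x)) \<and>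
     (\<forall>x. \<forall>t\<ge>0. \<forall>D. (f x has_real_derivative D) (at t within {0..}) \<longrightarrow>
        D = - \<mu> * (LINT y:{..x}|interval_measure (\<lambda>y. f y t).
                     eta_bar \<eta> y (\<lambda>z. f z t) * (1 - J (x - y))))"

definition moment :: "(real \<Rightarrow> real) \<Rightarrow> nat \<Rightarrow> real" where
  "moment J k = (LINT y:{0..}|interval_measure J. y ^ k)"

definition speed :: "real \<Rightarrow> (real \<Rightarrow> real) \<Rightarrow> (real \<Rightarrow> real) \<Rightarrow> real" where
  "speed \<mu> \<eta> J = \<mu> * moment J 1 * integral {0..1} \<eta>"

definition traveling_wave_shape ::
  "real \<Rightarrow> (real \<Rightarrow> real) \<Rightarrow> (real \<Rightarrow> real) \<Rightarrow> (real \<Rightarrow> real) \<Rightarrow> bool" where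
  "traveling_wave_shape \<mu> \<eta> J \<phi> \<longleftrightarrow>
     distribution_function \<phi> \<and> mean_field_model \<mu> \<eta> J (\<lambda>x t. \<phi> (x - speed \<mu> \<eta> J * t))"

definition finite_mean :: "(real \<Rightarrow> real) \<Rightarrow> bool" where
  "finite_mean \<gamma> \<longleftrightarrow> integrable (interval_measure \<gamma>) (\<lambda>x. x)"

definition mean :: "(real \<Rightarrow> real) \<Rightarrow> real" where
  "mean \<gamma> = (LINT x|interval_measure \<gamma>. x)"

end

theory Submission
  imports Defs "HOL-Probability.Helly_Selection"
begin

text \<open>
  Let \<open>H\<close> be the primitive of \<open>\<eta>\<close> vanishing at 0; it is strictly increasing, strictly concave and
  1-Lipschitz on the unit interval. The averaging that defines \<open>eta_bar\<close> at jumps is made exactly so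
  that \<open>eta_bar \<eta> y \<gamma> d\<gamma>(y) = d(H(\<gamma>(y)))\<close> (\<open>interval_measure_H\<close>). With Fubini, the evolution
  equation becomes a nonlocal conservation law without Stieltjes integrals,
  \<open>d/dt f(x,t) = - \<mu> * (H(f(x,t)) - E H(f(x - Z,t)))\<close> with \<open>Z\<close> distributed according to \<open>J\<close>
  (\<open>mean_field_model_iff_solution\<close>). Its right-hand side is continuous in \<open>t\<close>, so the equation
  holds at every time, not only where the derivative is assumed to exist.
  
  Three integral identities carry the theorem. Since \<open>\<integral> (G(x) - G(x - z)) dx = z\<close> for a distribution
  function \<open>G\<close>, every solution moves its mean at the constant speed \<open>v\<close>
  (\<open>solution_decrease_integrable\<close>). For two solutions, the \<open>L\<^sub>1\<close> distance decreases, and the loss is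
  the integral of an explicit nonnegative sign defect (\<open>dissipation\<close>). Because the density of
  \<open>J\<close> is positive, the defect at a point \<open>x\<close> where the solutions differ vanishes only if almost everywhere
  to the left of \<open>x\<close> their difference does not have the opposite sign.
  
  Integrating the wave equation once turns it into the fixed-point equation \<open>\<phi> = E (H(\<phi>(x - Y)) / H(1))\<close>,
  where \<open>Y\<close> has density \<open>(1 - J) / m1\<close> (\<open>profile_of_fixpoint\<close>, \<open>fixpoint_of_profile\<close>). If \<open>H / H(1)\<close>
  is replaced by a function that is linear near 0, an exponential is a supersolution and its truncation
  is a subsolution, so the Knaster-Tarski construction gives a fixed point (\<open>linearized_fixpoint\<close>);
  a Helly limit of such fixed points, normalised to take the value 1/2 at 0, is a profile
  (\<open>exists_profile\<close>). Concavity of \<open>H\<close> and finiteness of the second moment of \<open>J\<close> bound the tails of a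
  profile, so profiles have finite mean (\<open>profile_finite_mean\<close>).
  
  For convergence, the total dissipation along a solution is finite, so along a sequence of times the
  defect tends to 0. Comparison with shifted profiles makes the solution, seen from the moving frame,
  tight in \<open>L\<^sub>1\<close> (\<open>tail_between_barriers\<close>), and Helly selection gives an \<open>L\<^sub>1\<close> limit with zero defect
  relative to the profile \<open>\<phi>\<close> of equal mean. Hence the limit minus \<open>\<phi>\<close> has constant sign; its integral
  is 0, so the limit is \<open>\<phi>\<close>, and monotonicity of the distance extends the convergence to all times
  (\<open>convergence_to_profile\<close>). Profiles are Lipschitz, so \<open>L\<^sub>1\<close> convergence of monotone functions is
  uniform. A second profile of the same mean is itself a solution at rest in the moving frame,
  so uniqueness is a special case of convergence.
\<close>

section \<open>Differentiability of monotone Lipschitz functions\<close>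

lemma interval_measure_eqI:
  fixes F :: "real \<Rightarrow> real"
  assumes sets: "sets M = sets borel"
    and mono: "mono F" and cont: "\<And>x. continuous (at_right x) F"
    and Ioc: "\<And>a b. a \<le> b \<Longrightarrow> emeasure M {a<..b} = ennreal (F b - F a)"
  shows "M = interval_measure F"
proof (rule measure_eqI_generator_eq_countable)
  let ?E = "range (\<lambda>(a, b). {a<..b::real})"
  show "Int_stable ?E"
  proof (rule Int_stableI)
    fix A B assume "A \<in> ?E" "B \<in> ?E"
    then obtain a b c d where "A = {a<..b}" "B = {c<..d}"
      by auto
    then have "A \<inter> B = (\<lambda>(a, b). {a<..b}) (max a c, min b d)"
      by auto
    then show "A \<inter> B \<in> ?E"
      by blast
  qed
  show "?E \<subseteq> Pow UNIV" by auto
  have b: "sets borel = sigma_sets UNIV ?E"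
    by (subst borel_sigma_sets_Ioc) simp
  show "sets M = sigma_sets UNIV ?E" "sets (interval_measure F) = sigma_sets UNIV ?E"
    using b by (simp_all only: sets sets_interval_measure)
  show "(\<lambda>(a, b). {a<..b}) ` (\<rat> \<times> \<rat>) \<subseteq> ?E"
    by auto
  show "\<Union> ((\<lambda>(a, b). {a<..b}) ` (\<rat> \<times> \<rat>)) = (UNIV :: real set)"
  proof (intro equalityI subset_UNIV subsetI)
    fix x :: real
    obtain a b where "a \<in> \<rat>" "a < x" "b \<in> \<rat>" "x \<le> b"
      using Rats_no_bot_less[of x] Rats_no_top_le[of x] by auto
    then show "x \<in> \<Union> ((\<lambda>(a, b). {a<..b}) ` (\<rat> \<times> \<rat>))"
      by (intro UnionI[of "{a<..b}"]) auto
  qed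
  show "countable ((\<lambda>(a, b). {a<..b::real}) ` (\<rat> \<times> \<rat>))"
    by (intro countable_image countable_SIGMA countable_rat)
  have *: "emeasure M {a<..b} = emeasure (interval_measure F) {a<..b}" for a b
    using Ioc[of a b] emeasure_interval_measure_Ioc_eq[of F, OF monoD[OF mono] cont, of a b]
    by (cases "a \<le> b") auto
  show "emeasure M X = emeasure (interval_measure F) X" if "X \<in> ?E" for X
    using that * by auto
  show "emeasure M X \<noteq> \<infinity>" if "X \<in> (\<lambda>(a, b). {a<..b}) ` (\<rat> \<times> \<rat>)" for X
    using that * emeasure_interval_measure_Ioc_eq[of F, OF monoD[OF mono] cont] by auto
qed

text \<open>
  The set function on the right is a measure that agrees with the left-hand side on half-open
  intervals.
\<close>
lemma interval_measure_add:
  fixes F G :: "real \<Rightarrow> real"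
  assumes F: "mono F" "\<And>x. continuous (at_right x) F"
    and G: "mono G" "\<And>x. continuous (at_right x) G"
    and A: "A \<in> sets borel"
  shows "emeasure (interval_measure (\<lambda>x. F x + G x)) A
           = emeasure (interval_measure F) A + emeasure (interval_measure G) A"
proof -
  define m where "m = (\<lambda>A. emeasure (interval_measure F) A + emeasure (interval_measure G) A)"
  define M where "M = measure_of UNIV (sets borel) m"
  have sig: "sigma_algebra (UNIV :: real set) (sets borel)"
    by (metis sets.sigma_algebra_axioms space_borel)
  have "countably_additive (sets borel) m"
  proof (rule countably_additiveI)
    fix A :: "nat \<Rightarrow> real set"
    assume "range A \<subseteq> sets borel" "disjoint_family A"
    then show "(\<Sum>i. m (A i)) = m (\<Union> (range A))"
      unfolding m_def by (subst suminf_add[symmetric]) (auto simp: suminf_emeasure)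
  qed
  then have em: "emeasure M A = m A" if "A \<in> sets borel" for A
    unfolding M_def using that sig
    by (intro emeasure_measure_of_sigma) (auto simp: positive_def m_def)
  have sM: "sets M = sets borel"
    unfolding M_def using sets.sigma_sets_eq[of "borel :: real measure"] by (simp add: sets_measure_of)
  have "M = interval_measure (\<lambda>x. F x + G x)"
  proof (rule interval_measure_eqI)
    show "mono (\<lambda>x. F x + G x)"
      using F(1) G(1) by (auto simp: mono_def intro: add_mono)
    show "emeasure M {a<..b} = ennreal (F b + G b - (F a + G a))" if "a \<le> b" for a b
      using that F G
      by (subst em) (auto simp: m_def emeasure_interval_measure_Ioc mono_def ennreal_plus[symmetric] algebra_simps
          simp del: ennreal_plus)
  qed (use sM in \<open>auto intro: continuous_add F G\<close>)
  then show ?thesis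
    using em[OF A] by (simp add: m_def)
qed

text \<open>
  The function \<open>c x - F(x)\<close> is also monotone, so the measure of \<open>F\<close> is one of two nonnegative summands
  of \<open>c\<close> times Lebesgue measure. It is therefore absolutely continuous, and Radon-Nikodym gives \<open>q\<close>.
\<close>
lemma interval_measure_lipschitz_density:
  fixes F :: "real \<Rightarrow> real"
  assumes mono: "mono F" and lip: "c-lipschitz_on UNIV F"
  obtains q where "q \<in> borel_measurable borel"
    "\<And>a b. a \<le> b \<Longrightarrow> (q has_integral F b - F a) {a..b}"
proof -
  have c: "c \<ge> 0" using lip lipschitz_on_nonneg by blast
  have contF: "continuous_on UNIV F"
    using lip lipschitz_on_continuous_on by blast
  then have rF: "continuous (at_right x) F" for x
    by (simp add: continuous_on_eq_continuous_at continuous_at_imp_continuous_at_within)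
  define G where "G = (\<lambda>x. c * x - F x)"
  have monoG: "mono G"
  proof (rule monoI)
    fix x y :: real assume "x \<le> y"
    then show "G x \<le> G y"
      using lipschitz_onD[OF lip, of x y] by (auto simp: G_def dist_real_def algebra_simps)
  qed
  have rG: "continuous (at_right x) G" for x
    unfolding G_def by (intro continuous_intros rF)
  have eq: "density lborel (\<lambda>_. ennreal c) = interval_measure (\<lambda>x. c * x)"
  proof (rule interval_measure_eqI)
    show "emeasure (density lborel (\<lambda>_. ennreal c)) {a<..b} = ennreal (c * b - c * a)" if "a \<le> b" for a b
      using that c by (simp add: emeasure_density_const ennreal_mult[symmetric] right_diff_distrib)
  qed (auto simp: mono_def c mult_left_mono intro!: continuous_intros)
  have le: "emeasure (interval_measure F) A \<le> ennreal c * emeasure lborel A" if "A \<in> sets borel" for A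
  proof -
    have "emeasure (interval_measure F) A \<le> emeasure (interval_measure (\<lambda>x. F x + G x)) A"
      by (subst interval_measure_add) (auto intro: that mono monoG rF rG)
    also have "(\<lambda>x. F x + G x) = (\<lambda>x. c * x)"
      by (auto simp: G_def)
    also have "emeasure (interval_measure (\<lambda>x. c * x)) A = ennreal c * emeasure lborel A"
      using that by (simp add: eq[symmetric] emeasure_density_const)
    finally show ?thesis .
  qed
  have "absolutely_continuous lborel (interval_measure F)"
    unfolding absolutely_continuous_def
  proof
    fix A :: "real set" assume "A \<in> null_sets lborel"
    then show "A \<in> null_sets (interval_measure F)"
      using le[of A] by (auto simp: null_sets_def)
  qed
  then obtain g where g[measurable]: "g \<in> borel_measurable lborel" and dens: "density lborel g = interval_measure F"
    using sigma_finite_measure.Radon_Nikodym[OF lborel.sigma_finite_measure_axioms, of "interval_measure F"] by auto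
  have em: "(\<integral>\<^sup>+x\<in>{a<..b}. g x \<partial>lborel) = ennreal (F b - F a)" if "a \<le> b" for a b
    using that mono rF
    by (subst emeasure_density[symmetric]) (auto simp: dens emeasure_interval_measure_Ioc mono_def)
  define q where "q = (\<lambda>x. enn2real (g x))"
  have qm: "q \<in> borel_measurable borel" unfolding q_def by measurable
  show thesis
  proof (rule that[of q])
    show "q \<in> borel_measurable borel" by (rule qm)
    fix a b :: real assume ab: "a \<le> b"
    have fin: "AE x in lborel. g x * indicator {a<..b} x \<noteq> \<infinity>"
      by (rule nn_integral_PInf_AE) (use em[OF ab] in auto)
    have "(\<integral>\<^sup>+x. ennreal (q x * indicator {a<..b} x) \<partial>lborel) = ennreal (F b - F a)"
      unfolding em[OF ab, symmetric]
      by (rule nn_integral_cong_AE, use fin in eventually_elim)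
         (auto simp: q_def split: split_indicator simp: less_top)
    then have "integrable lborel (\<lambda>x. q x * indicator {a<..b} x)
        \<and> (\<integral>x. q x * indicator {a<..b} x \<partial>lborel) = F b - F a"
      using qm ab mono
      by (subst (asm) nn_integral_eq_integrable) (auto simp: q_def mono_def)
    then have "((\<lambda>x. q x * indicator {a<..b} x) has_integral (F b - F a)) UNIV"
      using has_integral_integral_lborel by metis
    then have "((\<lambda>x. if x \<in> {a..b} then q x else 0) has_integral (F b - F a)) UNIV"
      by (rule has_integral_spike[of "{a}", rotated 2]) (auto split: split_indicator)
    then show "(q has_integral (F b - F a)) {a..b}"
      by (metis has_integral_restrict_UNIV)
  qed
qed

lemma AE_right_derivative_indefinite_integral:
  fixes q :: "real \<Rightarrow> real"
  assumes "\<And>a b. a \<le> b \<Longrightarrow> (q has_integral F b - F a) {a..b}"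
  obtains N where "negligible N"
    "\<And>x. x \<notin> N \<Longrightarrow> ((\<lambda>h. (F (x + h) - F x) / h) \<longlongrightarrow> q x) (at_right 0)"
proof -
  have "q integrable_on cbox a b" for a b
    using assms[of a b] by (cases "a \<le> b") (auto simp: integrable_on_def intro: has_integral_empty)
  from integrable_ccontinuous_explicit[of q, OF this] obtain N where N: "negligible N"
    "\<And>x e. x \<notin> N \<Longrightarrow> 0 < e \<Longrightarrow> \<exists>d>0. \<forall>h. 0 < h \<and> h < d \<longrightarrow>
        norm (integral (cbox x (x + h *\<^sub>R One)) q /\<^sub>R h ^ DIM(real) - q x) < e"
    by blast
  show thesis
  proof (rule that[OF N(1)])
    fix x assume x: "x \<notin> N"
    show "((\<lambda>h. (F (x + h) - F x) / h) \<longlongrightarrow> q x) (at_right 0)"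
      unfolding tendsto_iff eventually_at_right_field
    proof (intro allI impI)
      fix e :: real assume "0 < e"
      from N(2)[OF x this] obtain d where d: "d > 0" "\<And>h. 0 < h \<Longrightarrow> h < d \<Longrightarrow>
        norm (integral (cbox x (x + h *\<^sub>R One)) q /\<^sub>R h ^ DIM(real) - q x) < e"
        by blast
      show "\<exists>b>0. \<forall>y>0. y < b \<longrightarrow> dist ((F (x + y) - F x) / y) (q x) < e"
      proof (intro exI[of _ d] conjI allI impI d(1))
        fix h assume h: "0 < h" "h < d"
        have "integral {x..x+h} q = F (x + h) - F x"
          using h assms[of x "x+h"] by (intro integral_unique) auto
        then show "dist ((F (x + h) - F x) / h) (q x) < e"
          using d(2)[OF h] by (simp add: dist_real_def divide_inverse mult.commute)
      qed
    qed
  qed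
qed

text \<open>
  The right derivative exists almost everywhere by the Lebesgue differentiation theorem for cubes with a
  corner at the given point; the left derivative is the right derivative of the reflected function.
\<close>
lemma AE_derivative_indefinite_integral:
  fixes q :: "real \<Rightarrow> real"
  assumes q: "\<And>a b. a \<le> b \<Longrightarrow> (q has_integral F b - F a) {a..b}"
  obtains N where "negligible N" "\<And>x. x \<notin> N \<Longrightarrow> (F has_real_derivative q x) (at x)"
proof -
  obtain N1 where N1: "negligible N1"
    "\<And>x. x \<notin> N1 \<Longrightarrow> ((\<lambda>h. (F (x + h) - F x) / h) \<longlongrightarrow> q x) (at_right 0)"
    using AE_right_derivative_indefinite_integral[OF q] by blast
  have "((\<lambda>x. q (- x)) has_integral (- F (- b)) - (- F (- a))) {a..b}" if "a \<le> b" for a b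
    using has_integral_reflect_real[of q _ "-a" "-b"] q[of "-b" "-a"] that by auto
  from AE_right_derivative_indefinite_integral[of "\<lambda>x. q (- x)" "\<lambda>x. - F (- x)", OF this]
  obtain N2 where N2: "negligible N2"
    "\<And>x. x \<notin> N2 \<Longrightarrow> ((\<lambda>h. (- F (- (x + h)) - - F (- x)) / h) \<longlongrightarrow> q (- x)) (at_right 0)"
    by blast
  show thesis
  proof (rule that[of "N1 \<union> uminus ` N2"])
    show "negligible (N1 \<union> uminus ` N2)"
      using N1(1) N2(1) by (intro negligible_Un negligible_differentiable_image_negligible)
        (auto intro!: differentiable_on_minus differentiable_on_id[unfolded id_def])
    fix x assume "x \<notin> N1 \<union> uminus ` N2"
    then have x: "x \<notin> N1" "- x \<notin> N2" by (auto, metis imageI minus_minus)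
    have "((\<lambda>h. (F (x + h) - F x) / h) \<longlongrightarrow> q x) (at_left 0)"
    proof -
      have "((\<lambda>h. (F (x - h) - F x) / (- h)) \<longlongrightarrow> q x) (at_right 0)"
        using N2(2)[OF x(2)] by (simp add: minus_divide_left algebra_simps)
      then show ?thesis
        by (subst filterlim_at_left_to_right) simp
    qed
    with N1(2)[OF x(1)] have "((\<lambda>h. (F (x + h) - F x) / h) \<longlongrightarrow> q x) (at 0)"
      by (simp add: filterlim_split_at)
    then show "(F has_real_derivative q x) (at x)"
      by (simp add: DERIV_def)
  qed
qed

text \<open>
  A mean-field model is required to satisfy its equation only where the time derivative exists. A
  Lipschitz function is differentiable almost everywhere and is the integral of its derivative, so if the
  prescribed derivative \<open>G\<close> is continuous, the fundamental theorem of calculus recovers it everywhere.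
\<close>
lemma lipschitz_derivative_everywhere:
  fixes F G :: "real \<Rightarrow> real"
  assumes anti: "antimono_on {0..} F" and lip: "c-lipschitz_on {0..} F"
    and cont: "continuous_on {0..} G"
    and deriv: "\<And>t D. t \<ge> 0 \<Longrightarrow> (F has_real_derivative D) (at t within {0..}) \<Longrightarrow> D = G t"
    and t: "t \<ge> 0"
  shows "(F has_real_derivative G t) (at t within {0..})"
proof -
  \<comment> \<open>Freezing \<open>F\<close> at negative times and changing its sign gives a monotone Lipschitz function on the line.\<close>
  define E where "E = (\<lambda>t. - F (max 0 t))"
  have "mono E"
    using anti by (auto simp: E_def mono_def monotone_on_def)
  moreover have "c-lipschitz_on UNIV E"
  proof (rule lipschitz_onI)
    fix x y :: real
    have "dist (E x) (E y) \<le> c * dist (max 0 x) (max 0 y)"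
      using lipschitz_onD[OF lip, of "max 0 x" "max 0 y"] by (simp add: E_def dist_real_def abs_minus_commute)
    also have "\<dots> \<le> c * dist x y"
      using lipschitz_on_nonneg[OF lip] by (intro mult_left_mono) (auto simp: dist_real_def)
    finally show "dist (E x) (E y) \<le> c * dist x y" .
  qed (use lip lipschitz_on_nonneg in blast)
  ultimately obtain q where q: "q \<in> borel_measurable borel"
    "\<And>a b. a \<le> b \<Longrightarrow> (q has_integral E b - E a) {a..b}"
    using interval_measure_lipschitz_density by blast
  obtain N where N: "negligible N" "\<And>x. x \<notin> N \<Longrightarrow> (E has_real_derivative q x) (at x)"
    using AE_derivative_indefinite_integral[OF q(2)] by blast
  have qG: "q s = - G s" if "s \<notin> N" "s \<ge> 0" for s
  proof -
    have "((\<lambda>t. - E t) has_real_derivative - q s) (at s within {0..})"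
      by (rule DERIV_minus[OF has_field_derivative_at_within[OF N(2)[OF that(1)]]])
    then have "(F has_real_derivative - q s) (at s within {0..})"
      by (rule has_field_derivative_transform_within[where d=1]) (use that(2) in \<open>auto simp: E_def\<close>)
    from deriv[OF that(2) this] show ?thesis by simp
  qed
  have int: "F s = F 0 + integral {0..s} G" if "s \<ge> 0" for s
  proof -
    have "((\<lambda>x. - G x) has_integral E s - E 0) {0..s}"
      by (rule has_integral_spike[OF N(1) _ q(2)[OF that]]) (use qG in auto)
    then have "((\<lambda>x. - (- G x)) has_integral - (E s - E 0)) {0..s}"
      by (rule has_integral_neg)
    then have "(G has_integral - (E s - E 0)) {0..s}"
      by (simp only: minus_minus)
    then show ?thesis using that by (auto simp: E_def dest!: integral_unique)
  qed
  have "((\<lambda>s. F 0 + integral {0..s} G) has_real_derivative G t) (at t within {0..t+1})"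
  proof -
    have "continuous_on {0..t+1} G"
      by (rule continuous_on_subset[OF cont]) auto
    from integral_has_real_derivative[OF this, of t] t
    have "((\<lambda>s. integral {0..s} G) has_real_derivative G t) (at t within {0..t+1})"
      by simp
    from DERIV_add[OF DERIV_const this, of "F 0"] show ?thesis
      by simp
  qed
  then have "(F has_real_derivative G t) (at t within {0..t+1})"
    by (rule has_field_derivative_transform_within[where d=1]) (use t in \<open>simp_all only: int[symmetric] atLeastAtMost_iff, auto\<close>)
  moreover have "at t within {0..t+1} = at t within {0..}"
  proof (rule at_within_nhd)
    show "t \<in> {..<t+1}" by simp
    show "{0..t + 1} \<inter> {..<t + 1} - {t} = {0..} \<inter> {..<t + 1} - {t}"
      by (intro set_eqI) (simp, linarith)
  qed simp
  ultimately show ?thesis by simp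
qed

section \<open>The Stieltjes chain rule for the rate\<close>

lemma distribution_functionD:
  assumes "distribution_function \<gamma>"
  shows "mono \<gamma>" "0 \<le> \<gamma> x" "\<gamma> x \<le> 1" "continuous (at_right x) \<gamma>"
    "(\<gamma> \<longlongrightarrow> 0) at_bot" "(\<gamma> \<longlongrightarrow> 1) at_top" "x \<le> y \<Longrightarrow> \<gamma> x \<le> \<gamma> y"
  using assms by (auto simp: distribution_function_def mono_def image_subset_iff)

lemma real_distribution_distribution_function:
  assumes "distribution_function \<gamma>"
  shows "real_distribution (interval_measure \<gamma>)"
  using distribution_functionD[OF assms]
  by (intro real_distribution_interval_measure) auto

lemma distribution_function_measurable [measurable_dest]:
  "distribution_function \<gamma> \<Longrightarrow> \<gamma> \<in> borel_measurable borel"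
  using distribution_functionD(1) borel_measurable_mono by blast

lemma distribution_function_left_limit:
  assumes "distribution_function \<gamma>"
  shows "(\<gamma> \<longlongrightarrow> Lim (at_left y) \<gamma>) (at_left y)"
    and "a < y \<Longrightarrow> \<gamma> a \<le> Lim (at_left y) \<gamma>" and "Lim (at_left y) \<gamma> \<le> \<gamma> y"
    and "isCont \<gamma> y \<longleftrightarrow> Lim (at_left y) \<gamma> = \<gamma> y"
    and "measure (interval_measure \<gamma>) {..<y} = Lim (at_left y) \<gamma>"
proof -
  note D = distribution_functionD[OF assms]
  obtain l where l: "(\<gamma> \<longlongrightarrow> l) (at_left y)"
    using assms unfolding distribution_function_def by blast
  then have L: "Lim (at_left y) \<gamma> = l"
    by (intro tendsto_Lim) auto
  show lim: "(\<gamma> \<longlongrightarrow> Lim (at_left y) \<gamma>) (at_left y)"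
    using l L by simp
  show "\<gamma> a \<le> Lim (at_left y) \<gamma>" if "a < y"
  proof (rule tendsto_lowerbound[OF lim])
    have "eventually (\<lambda>z. a < z) (at_left y)"
      using that by (rule eventually_at_left_real[THEN eventually_mono]) auto
    then show "eventually (\<lambda>z. \<gamma> a \<le> \<gamma> z) (at_left y)"
      by eventually_elim (auto intro: D(7))
  qed auto
  show "Lim (at_left y) \<gamma> \<le> \<gamma> y"
  proof (rule tendsto_upperbound[OF lim])
    show "eventually (\<lambda>z. \<gamma> z \<le> \<gamma> y) (at_left y)"
      using eventually_at_left_real[of "y - 1" y] by (auto elim!: eventually_mono intro: D(7))
  qed auto
  show "isCont \<gamma> y \<longleftrightarrow> Lim (at_left y) \<gamma> = \<gamma> y"
  proof
    assume "isCont \<gamma> y"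
    then have "(\<gamma> \<longlongrightarrow> \<gamma> y) (at_left y)"
      by (simp add: continuous_within filterlim_at_split)
    then show "Lim (at_left y) \<gamma> = \<gamma> y"
      by (intro tendsto_Lim) auto
  next
    assume "Lim (at_left y) \<gamma> = \<gamma> y"
    then show "isCont \<gamma> y"
      using lim D(4)[of y] by (simp add: continuous_within filterlim_at_split)
  qed
  interpret real_distribution "interval_measure \<gamma>"
    by (rule real_distribution_distribution_function[OF assms])
  have "cdf (interval_measure \<gamma>) = \<gamma>"
    using D by (intro cdf_interval_measure) auto
  with cdf_at_left[of y] have "(\<gamma> \<longlongrightarrow> measure (interval_measure \<gamma>) {..<y}) (at_left y)"
    by simp
  then show "measure (interval_measure \<gamma>) {..<y} = Lim (at_left y) \<gamma>"
    by (metis tendsto_Lim trivial_limit_at_left_real)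
qed

locale decreasing_rate =
  fixes \<eta> :: "real \<Rightarrow> real"
  assumes cont: "continuous_on {0..1} \<eta>"
    and anti: "\<And>u v. 0 \<le> u \<Longrightarrow> u \<le> v \<Longrightarrow> v \<le> 1 \<Longrightarrow> \<eta> v \<le> \<eta> u"
    and at0: "\<eta> 0 = 1" and at1: "\<eta> 1 = 0"
begin

definition H :: "real \<Rightarrow> real" where "H u = integral {0..u} \<eta>"

lemma eta_bounds: "0 \<le> u \<Longrightarrow> u \<le> 1 \<Longrightarrow> 0 \<le> \<eta> u \<and> \<eta> u \<le> 1"
  using anti[of u 1] anti[of 0 u] at0 at1 by auto

lemma eta_integrable: "0 \<le> u \<Longrightarrow> v \<le> 1 \<Longrightarrow> \<eta> integrable_on {u..v}"
  by (rule integrable_continuous_real) (rule continuous_on_subset[OF cont], auto)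

lemma H_diff: "0 \<le> u \<Longrightarrow> u \<le> v \<Longrightarrow> v \<le> 1 \<Longrightarrow> H v - H u = integral {u..v} \<eta>"
  unfolding H_def using Henstock_Kurzweil_Integration.integral_combine[where f=\<eta> and a=0 and c=u and b=v] eta_integrable[of 0 v] by auto

lemma H_diff_bounds:
  assumes "0 \<le> u" "u \<le> v" "v \<le> 1"
  shows "\<eta> v * (v - u) \<le> H v - H u" "H v - H u \<le> \<eta> u * (v - u)"
proof -
  have "integral {u..v} (\<lambda>_. \<eta> v) \<le> integral {u..v} \<eta>"
    using assms by (intro integral_le eta_integrable) (auto intro: anti)
  then show "\<eta> v * (v - u) \<le> H v - H u"
    using assms by (simp add: H_diff mult.commute)
  have "integral {u..v} \<eta> \<le> integral {u..v} (\<lambda>_. \<eta> u)"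
    using assms by (intro integral_le eta_integrable) (auto intro: anti)
  then show "H v - H u \<le> \<eta> u * (v - u)"
    using assms by (simp add: H_diff mult.commute)
qed

lemma H_0 [simp]: "H 0 = 0"
  by (simp add: H_def)

lemma H_mono: "0 \<le> u \<Longrightarrow> u \<le> v \<Longrightarrow> v \<le> 1 \<Longrightarrow> H u \<le> H v"
  using H_diff_bounds(1)[of u v] eta_bounds[of v] mult_nonneg_nonneg[of "\<eta> v" "v - u"] by linarith

lemma H_lipschitz: "0 \<le> u \<Longrightarrow> u \<le> v \<Longrightarrow> v \<le> 1 \<Longrightarrow> H v - H u \<le> v - u"
  using H_diff_bounds(2)[of u v] eta_bounds[of u] mult_right_mono[of "\<eta> u" 1 "v - u"] by auto

lemma H_bounds: "0 \<le> u \<Longrightarrow> u \<le> 1 \<Longrightarrow> 0 \<le> H u \<and> H u \<le> u"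
  using H_mono[of 0 u] H_lipschitz[of 0 u] by auto

lemma H_cont: "continuous_on {0..1} H"
  unfolding H_def by (rule indefinite_integral_continuous_1) (use eta_integrable[of 0 1] in auto)

lemma H_dist:
  assumes "0 \<le> u" "u \<le> 1" "0 \<le> v" "v \<le> 1" shows "\<bar>H u - H v\<bar> \<le> \<bar>u - v\<bar>"
  using assms H_mono[of u v] H_mono[of v u] H_lipschitz[of u v] H_lipschitz[of v u]
  by (cases "u \<le> v") auto

text \<open>
  At a jump, \<open>eta_bar\<close> is the slope of the chord of \<open>H\<close> over the jump; this yields the last identity,
  and the bounds follow since \<open>\<eta>\<close> decreases.
\<close>
lemma eta_bar_bounds:
  assumes \<gamma>: "distribution_function \<gamma>"
  shows "\<eta> (\<gamma> y) \<le> eta_bar \<eta> y \<gamma>" "a < y \<Longrightarrow> eta_bar \<eta> y \<gamma> \<le> \<eta> (\<gamma> a)"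
    "0 \<le> eta_bar \<eta> y \<gamma>" "eta_bar \<eta> y \<gamma> \<le> 1"
    "eta_bar \<eta> y \<gamma> * (\<gamma> y - Lim (at_left y) \<gamma>) = H (\<gamma> y) - H (Lim (at_left y) \<gamma>)"
proof -
  note D = distribution_functionD[OF \<gamma>]
  note L = distribution_function_left_limit[OF \<gamma>]
  define l where "l = Lim (at_left y) \<gamma>"
  have l: "0 \<le> l" "l \<le> \<gamma> y" "a < y \<Longrightarrow> \<gamma> a \<le> l" for a
    using L(3)[of y] L(2)[of _ y] order_trans[OF D(2) L(2)[of "y - 1" y]] by (auto simp: l_def)
  show 5: "eta_bar \<eta> y \<gamma> * (\<gamma> y - Lim (at_left y) \<gamma>) = H (\<gamma> y) - H (Lim (at_left y) \<gamma>)"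
    unfolding l_def[symmetric]
  proof (cases "isCont \<gamma> y")
    case True
    then show "eta_bar \<eta> y \<gamma> * (\<gamma> y - l) = H (\<gamma> y) - H l"
      using L(4)[of y] by (simp add: l_def)
  next
    case False
    then have "l < \<gamma> y" using L(4)[of y] l by (simp add: l_def)
    then show "eta_bar \<eta> y \<gamma> * (\<gamma> y - l) = H (\<gamma> y) - H l"
      using False l D(3) by (simp add: eta_bar_def Let_def l_def[symmetric] H_diff)
  qed
  have *: "\<eta> (\<gamma> y) \<le> eta_bar \<eta> y \<gamma> \<and> eta_bar \<eta> y \<gamma> \<le> \<eta> l"
  proof (cases "isCont \<gamma> y")
    case True
    then show ?thesis using L(4)[of y] by (simp add: l_def eta_bar_def)
  next
    case False
    then have "l < \<gamma> y" using L(4)[of y] l by (simp add: l_def)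
    then show ?thesis
      using H_diff_bounds[of l "\<gamma> y"] l D(3) by (simp add: 5[folded l_def, symmetric])
  qed
  then show "\<eta> (\<gamma> y) \<le> eta_bar \<eta> y \<gamma>" by simp
  show "eta_bar \<eta> y \<gamma> \<le> \<eta> (\<gamma> a)" if "a < y" for a
    using * anti[of "\<gamma> a" l] l(3)[OF that] D(2) l(2) D(3)[of y] by force
  show "0 \<le> eta_bar \<eta> y \<gamma>" "eta_bar \<eta> y \<gamma> \<le> 1"
    using * eta_bounds[of "\<gamma> y"] eta_bounds[of l] l D(2,3)[of y] by auto
qed

lemma rate_compose_measurable:
  assumes \<gamma>: "distribution_function \<gamma>"
  shows "(\<lambda>y. \<eta> (\<gamma> y)) \<in> borel_measurable borel" "(\<lambda>y. H (\<gamma> y)) \<in> borel_measurable borel"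
proof -
  note D = distribution_functionD[OF \<gamma>]
  have "mono (\<lambda>y. - \<eta> (\<gamma> y))"
    by (auto simp: mono_def intro!: anti D)
  from borel_measurable_uminus[OF borel_measurable_mono[OF this]]
  show "(\<lambda>y. \<eta> (\<gamma> y)) \<in> borel_measurable borel" by simp
  have "mono (\<lambda>y. H (\<gamma> y))"
    by (auto simp: mono_def intro!: H_mono D)
  then show "(\<lambda>y. H (\<gamma> y)) \<in> borel_measurable borel"
    by (rule borel_measurable_mono)
qed

lemma eta_bar_measurable:
  assumes \<gamma>: "distribution_function \<gamma>"
  shows "(\<lambda>y. eta_bar \<eta> y \<gamma>) \<in> borel_measurable borel"
proof (rule measurable_discrete_difference[where X="{y. \<not> isCont \<gamma> y}"])
  show "(\<lambda>y. \<eta> (\<gamma> y)) \<in> borel_measurable borel"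
    by (rule rate_compose_measurable[OF \<gamma>])
  show "countable {y. \<not> isCont \<gamma> y}"
    by (rule mono_ctble_discont) (rule distribution_functionD[OF \<gamma>])
qed (auto simp: eta_bar_def)

text \<open>
  Let \<open>\<delta>\<close> be the difference of the distribution functions of the two measures. On \<open>(a, b]\<close> both have
  average rate between \<open>\<eta>(\<gamma>(b))\<close> and \<open>\<eta>(\<gamma>(a))\<close>, which bounds the increment of \<open>\<delta>\<close> by the oscillation of
  \<open>\<eta>(\<gamma>)\<close> times \<open>\<gamma>(b) - \<gamma>(a)\<close>. This is useless across a jump, but there the two measures agree exactly,
  so \<open>\<delta>\<close> is left-continuous. A continuity argument from the left then shows \<open>\<bar>\<delta>\<bar> \<le> \<epsilon> \<gamma>\<close> for every
  \<open>\<epsilon> > 0\<close>: the inequality holds near \<open>-\<infinity>\<close>, passes to left limits, and propagates to the right of each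
  point because \<open>\<eta>(\<gamma>)\<close> is right-continuous.
\<close>
lemma interval_measure_H:
  assumes \<gamma>: "distribution_function \<gamma>"
  shows "interval_measure (\<lambda>y. H (\<gamma> y))
           = density (interval_measure \<gamma>) (\<lambda>y. ennreal (eta_bar \<eta> y \<gamma>))"
proof -
  note D = distribution_functionD[OF \<gamma>]
  note L = distribution_function_left_limit[OF \<gamma>]
  define M where "M = interval_measure \<gamma>"
  interpret real_distribution M
    unfolding M_def by (rule real_distribution_distribution_function[OF \<gamma>])
  define e where "e y = eta_bar \<eta> y \<gamma>" for y
  have e_meas [measurable]: "e \<in> borel_measurable borel"
    unfolding e_def by (rule eta_bar_measurable[OF \<gamma>])
  note e = eta_bar_bounds[OF \<gamma>, folded e_def]
  define A where "A S = (LINT y:S|M. e y)" for S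
  have e_int: "set_integrable M S e" if "S \<in> sets borel" for S
    unfolding set_integrable_def using that e(3,4)
    by (intro integrable_const_bound[where B=1]) (auto split: split_indicator)
  have A_bounds: "c * measure M S \<le> A S \<and> A S \<le> d * measure M S"
    if "S \<in> sets borel" "\<And>y. y \<in> S \<Longrightarrow> c \<le> e y \<and> e y \<le> d" for c d S
  proof -
    have int: "integrable M (indicat_real S)"
      using that(1) by (intro integrable_const_bound[where B=1]) auto
    then have "c * measure M S = (LINT y:S|M. c)" "d * measure M S = (LINT y:S|M. d)"
      using that(1) by (auto simp: set_lebesgue_integral_def mult.commute)
    moreover have "(LINT y:S|M. c) \<le> A S" "A S \<le> (LINT y:S|M. d)"
      unfolding A_def using that int
      by (auto intro!: set_integral_mono e_int simp: set_integrable_def)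
    ultimately show ?thesis by simp
  qed
  have mIoc: "measure M {a<..b} = \<gamma> b - \<gamma> a" if "a \<le> b" for a b
    unfolding M_def using that D by (intro measure_interval_measure_Ioc) auto
  have mIic: "measure M {..b} = \<gamma> b" for b
    unfolding M_def using D by (intro measure_interval_measure_Iic) auto
  have mIio: "measure M {..<y} = Lim (at_left y) \<gamma>" for y
    unfolding M_def by (rule L(5))
  define \<delta> where "\<delta> x = A {..x} - H (\<gamma> x)" for x
  have A_Ioc: "A {..b} - A {..a} = A {a<..b}" if "a \<le> b" for a b
  proof -
    have "{..b} = {..a} \<union> {a<..b}" using that by auto
    then show ?thesis
      unfolding A_def by (simp add: set_integral_Un e_int ivl_disj_int)
  qed
  have osc: "\<bar>\<delta> b - \<delta> a\<bar> \<le> (\<eta> (\<gamma> a) - \<eta> (\<gamma> b)) * (\<gamma> b - \<gamma> a)" if ab: "a \<le> b" for a b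
  proof -
    have "\<eta> (\<gamma> b) \<le> e y \<and> e y \<le> \<eta> (\<gamma> a)" if "y \<in> {a<..b}" for y
      using that e(1)[of y] e(2)[of a y] anti[of "\<gamma> y" "\<gamma> b"] D(2,3) D(7)[of y b] by force
    then have "\<eta> (\<gamma> b) * (\<gamma> b - \<gamma> a) \<le> A {a<..b} \<and> A {a<..b} \<le> \<eta> (\<gamma> a) * (\<gamma> b - \<gamma> a)"
      using A_bounds[of "{a<..b}" "\<eta> (\<gamma> b)" "\<eta> (\<gamma> a)"] mIoc[OF ab] by auto
    moreover have "\<eta> (\<gamma> b) * (\<gamma> b - \<gamma> a) \<le> H (\<gamma> b) - H (\<gamma> a)" "H (\<gamma> b) - H (\<gamma> a) \<le> \<eta> (\<gamma> a) * (\<gamma> b - \<gamma> a)"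
      using H_diff_bounds[of "\<gamma> a" "\<gamma> b"] D(2,3) D(7)[OF ab] by auto
    ultimately show ?thesis
      using A_Ioc[OF ab] by (auto simp: \<delta>_def left_diff_distrib)
  qed
  have left: "\<bar>\<delta> y - \<delta> a\<bar> \<le> 2 * (Lim (at_left y) \<gamma> - \<gamma> a)" if ay: "a < y" for a y
  proof -
    let ?l = "Lim (at_left y) \<gamma>"
    have l: "0 \<le> ?l" "?l \<le> \<gamma> y" "\<gamma> a \<le> ?l"
      using L(2)[OF ay] L(3)[of y] D(2)[of a] by auto
    have "{a<..y} = {a<..<y} \<union> {y}" using ay by auto
    then have 1: "A {a<..y} = A {a<..<y} + A {y}"
      unfolding A_def by (simp del: Un_insert_right add: set_integral_Un e_int)
    have "measure M {y} = measure M ({..y} - {..<y})"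
      by (rule arg_cong[where f="measure M"]) auto
    also have "\<dots> = \<gamma> y - ?l"
      by (subst finite_measure_Diff) (auto simp: mIic mIio)
    finally have 2: "A {y} = e y * (\<gamma> y - ?l)"
      using A_bounds[of "{y}" "e y" "e y"] by auto
    have "measure M {a<..<y} = measure M ({..<y} - {..a})"
      by (rule arg_cong[where f="measure M"]) auto
    also have "\<dots> = ?l - \<gamma> a"
      using ay by (subst finite_measure_Diff) (auto simp: mIic mIio)
    finally have 3: "0 \<le> A {a<..<y}" "A {a<..<y} \<le> ?l - \<gamma> a"
      using A_bounds[of "{a<..<y}" 0 1] e(3,4) by auto
    have "0 \<le> H ?l - H (\<gamma> a)" "H ?l - H (\<gamma> a) \<le> ?l - \<gamma> a"
      using H_mono[of "\<gamma> a" ?l] H_lipschitz[of "\<gamma> a" ?l] l D(2,3) order_trans[OF l(2) D(3)] by auto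
    with 1 2 3 show ?thesis
      using A_Ioc[of a y] ay e(5)[of y] by (auto simp: \<delta>_def)
  qed
  have small: "\<bar>\<delta> a\<bar> \<le> \<gamma> a" for a
    using A_bounds[of "{..a}" 0 1] e(3,4) mIic[of a] H_bounds[of "\<gamma> a"] D(2,3)[of a]
    by (auto simp: \<delta>_def abs_le_iff)
  have "\<bar>\<delta> x\<bar> \<le> \<epsilon> * \<gamma> x" if \<epsilon>: "\<epsilon> > 0" for \<epsilon> x
  proof (rule ccontr)
    assume neg: "\<not> ?thesis"
    define S where "S = {x. \<not> \<bar>\<delta> x\<bar> \<le> \<epsilon> * \<gamma> x}"
    have "S \<noteq> {}" using neg by (auto simp: S_def)
    have "continuous (at 0 within {0..1}) \<eta>"
      using cont by (auto simp: continuous_on_eq_continuous_within)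
    then obtain d where d: "d > 0" "\<And>u. 0 \<le> u \<Longrightarrow> u \<le> 1 \<Longrightarrow> u < d \<Longrightarrow> 1 - \<eta> u < \<epsilon>"
      using \<epsilon> unfolding continuous_within_eps_delta by (force simp: at0 dist_real_def)
    have "eventually (\<lambda>x. \<gamma> x < d) at_bot"
      using order_tendstoD(2)[OF D(5) d(1)] .
    then obtain x0 where x0: "\<And>x. x \<le> x0 \<Longrightarrow> \<gamma> x < d"
      by (auto simp: eventually_at_bot_linorder)
    \<comment> \<open>Below \<open>x0\<close> the oscillation of \<open>\<eta>(\<gamma>)\<close> is less than \<open>\<epsilon>\<close>; the left end point is sent to \<open>-\<infinity>\<close>.\<close>
    have start: "\<bar>\<delta> b\<bar> \<le> \<epsilon> * \<gamma> b" if b: "b \<le> x0" for b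
    proof (rule tendsto_le[where F=at_bot])
      have "((\<lambda>a. \<epsilon> * \<gamma> b + \<gamma> a) \<longlongrightarrow> \<epsilon> * \<gamma> b + 0) at_bot"
        by (intro tendsto_intros D(5))
      then show "((\<lambda>a. \<epsilon> * \<gamma> b + \<gamma> a) \<longlongrightarrow> \<epsilon> * \<gamma> b) at_bot" by simp
      show "((\<lambda>a::real. \<bar>\<delta> b\<bar>) \<longlongrightarrow> \<bar>\<delta> b\<bar>) at_bot" by simp
      show "eventually (\<lambda>a. \<bar>\<delta> b\<bar> \<le> \<epsilon> * \<gamma> b + \<gamma> a) at_bot"
        using eventually_le_at_bot[of b]
      proof eventually_elim
        case (elim a)
        have "\<eta> (\<gamma> a) - \<eta> (\<gamma> b) \<le> \<epsilon>"
          using eta_bounds[of "\<gamma> a"] d(2)[of "\<gamma> b"] x0[OF b] D(2,3) by force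
        then have "(\<eta> (\<gamma> a) - \<eta> (\<gamma> b)) * (\<gamma> b - \<gamma> a) \<le> \<epsilon> * \<gamma> b"
          using D(2)[of a] D(7)[OF elim] \<epsilon> by (intro mult_mono) auto
        with osc[OF elim] small[of a] show ?case by auto
      qed
    qed auto
    have bdd: "bdd_below S"
    proof (rule bdd_belowI)
      fix x assume "x \<in> S"
      then show "x0 \<le> x"
        using start[of x] by (cases "x \<le> x0") (auto simp: S_def)
    qed
    \<comment> \<open>The infimum \<open>s\<close> of the exceptional set is not exceptional, and neither are the points just right of it.\<close>
    define s where "s = Inf S"
    have below: "\<bar>\<delta> y\<bar> \<le> \<epsilon> * \<gamma> y" if "y < s" for y
    proof (rule ccontr)
      assume "\<not> \<bar>\<delta> y\<bar> \<le> \<epsilon> * \<gamma> y"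
      then have "s \<le> y"
        using cInf_lower[OF _ bdd, of y] by (auto simp: S_def s_def)
      with that show False by simp
    qed
    have at_s: "\<bar>\<delta> s\<bar> \<le> \<epsilon> * \<gamma> s"
    proof -
      let ?l = "Lim (at_left s) \<gamma>"
      have "\<bar>\<delta> s\<bar> \<le> \<epsilon> * ?l"
      proof (rule tendsto_le[where F="at_left s"])
        have "((\<lambda>a. \<epsilon> * \<gamma> a + 2 * (?l - \<gamma> a)) \<longlongrightarrow> \<epsilon> * ?l + 2 * (?l - ?l)) (at_left s)"
          by (intro tendsto_intros L(1))
        then show "((\<lambda>a. \<epsilon> * \<gamma> a + 2 * (?l - \<gamma> a)) \<longlongrightarrow> \<epsilon> * ?l) (at_left s)" by simp
        show "((\<lambda>a. \<bar>\<delta> s\<bar>) \<longlongrightarrow> \<bar>\<delta> s\<bar>) (at_left s)" by simp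
        show "eventually (\<lambda>a. \<bar>\<delta> s\<bar> \<le> \<epsilon> * \<gamma> a + 2 * (?l - \<gamma> a)) (at_left s)"
          using eventually_at_left_real[of "s - 1" s]
        proof (rule eventually_mono)
          fix a assume "a \<in> {s - 1<..<s}"
          then show "\<bar>\<delta> s\<bar> \<le> \<epsilon> * \<gamma> a + 2 * (?l - \<gamma> a)"
            using left[of a s] below[of a] by auto
        qed auto
      qed auto
      also have "\<dots> \<le> \<epsilon> * \<gamma> s"
        using \<epsilon> L(3)[of s] by auto
      finally show ?thesis .
    qed
    have "((\<lambda>b. \<eta> (\<gamma> b)) \<longlongrightarrow> \<eta> (\<gamma> s)) (at_right s)"
    proof (rule continuous_on_tendsto_compose[OF cont])
      show "(\<gamma> \<longlongrightarrow> \<gamma> s) (at_right s)"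
        using D(4)[of s] by (simp add: continuous_within)
    qed (use D(2,3) in auto)
    then have "eventually (\<lambda>b. \<eta> (\<gamma> b) > \<eta> (\<gamma> s) - \<epsilon>) (at_right s)"
      using \<epsilon> by (intro order_tendstoD) auto
    then obtain d where d: "d > s" "\<And>b. s < b \<Longrightarrow> b < d \<Longrightarrow> \<eta> (\<gamma> b) > \<eta> (\<gamma> s) - \<epsilon>"
      by (auto simp: eventually_at_right_field)
    have right: "\<bar>\<delta> b\<bar> \<le> \<epsilon> * \<gamma> b" if "s < b" "b < d" for b
    proof -
      have "(\<eta> (\<gamma> s) - \<eta> (\<gamma> b)) * (\<gamma> b - \<gamma> s) \<le> \<epsilon> * (\<gamma> b - \<gamma> s)"
        using d(2)[OF that] D(7)[of s b] that by (intro mult_right_mono) auto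
      with osc[of s b] that at_s show ?thesis
        by (auto simp: right_diff_distrib)
    qed
    have "d \<le> Inf S"
    proof (rule cInf_greatest[OF \<open>S \<noteq> {}\<close>])
      fix x assume "x \<in> S"
      show "d \<le> x"
      proof (rule ccontr)
        assume "\<not> d \<le> x"
        with \<open>x \<in> S\<close> show False
        using below[of x] at_s right[of x] by (cases x s rule: linorder_cases) (auto simp: S_def)
      qed
    qed
    with d(1) show False by (simp add: s_def)
  qed
  then have \<delta>0: "\<delta> x = 0" for x
  proof -
    have "\<bar>\<delta> x\<bar> \<le> 0 + \<epsilon>" if "\<epsilon> > 0" for \<epsilon>
    proof -
      have "\<epsilon> * \<gamma> x \<le> \<epsilon> * 1"
        using that by (intro mult_left_mono D(3)) auto
      with \<open>\<And>\<epsilon> x. \<epsilon> > 0 \<Longrightarrow> \<bar>\<delta> x\<bar> \<le> \<epsilon> * \<gamma> x\<close>[OF that, of x] show ?thesis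
        by linarith
    qed
    then have "\<bar>\<delta> x\<bar> \<le> 0" by (rule field_le_epsilon)
    then show ?thesis by simp
  qed
  have "density M (\<lambda>y. ennreal (e y)) = interval_measure (\<lambda>y. H (\<gamma> y))"
  proof (rule interval_measure_eqI)
    show "mono (\<lambda>y. H (\<gamma> y))"
      by (auto simp: mono_def intro!: H_mono D)
    show "continuous (at_right x) (\<lambda>y. H (\<gamma> y))" for x
      unfolding continuous_within
    proof (rule continuous_on_tendsto_compose[OF H_cont])
      show "(\<gamma> \<longlongrightarrow> \<gamma> x) (at_right x)"
        using D(4)[of x] by (simp add: continuous_within)
    qed (use D(2,3) in auto)
    show "emeasure (density M (\<lambda>y. ennreal (e y))) {a<..b} = ennreal (H (\<gamma> b) - H (\<gamma> a))" if ab: "a \<le> b" for a b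
    proof -
      have "emeasure (density M (\<lambda>y. ennreal (e y))) {a<..b} = (\<integral>\<^sup>+y. ennreal (indicator {a<..b} y * e y) \<partial>M)"
        by (subst emeasure_density) (auto intro!: nn_integral_cong simp: ennreal_indicator[symmetric] ennreal_mult'[symmetric] mult.commute e(3) split: split_indicator)
      also have "\<dots> = ennreal (A {a<..b})"
        unfolding A_def set_lebesgue_integral_def
        using e_int[of "{a<..b}"] e(3)
        by (subst nn_integral_eq_integral) (auto simp: set_integrable_def)
      also have "A {a<..b} = H (\<gamma> b) - H (\<gamma> a)"
        using A_Ioc[OF ab] \<delta>0[of a] \<delta>0[of b] by (simp add: \<delta>_def)
      finally show ?thesis .
    qed
  qed (simp add: M_def)
  then show ?thesis by (simp add: M_def e_def)
qed

end

section \<open>The mean-field equation as a differential equation\<close>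

lemma distribution_function_shift:
  assumes "distribution_function \<gamma>" shows "distribution_function (\<lambda>x. \<gamma> (x - a))"
proof -
  note D = distribution_functionD[OF assms]
  have r: "filterlim (\<lambda>x. x - a) (at_right (x - a)) (at_right x)" for x
    unfolding filterlim_at
    by (auto intro!: tendsto_intros simp: eventually_at_filter)
  have l: "filterlim (\<lambda>x. x - a) (at_left (x - a)) (at_left x)" for x
    unfolding filterlim_at
    by (auto intro!: tendsto_intros simp: eventually_at_filter)
  have bot: "filterlim (\<lambda>x. x - a) at_bot at_bot"
    unfolding filterlim_at_bot
  proof
    fix Z :: real
    show "eventually (\<lambda>x. x - a \<le> Z) at_bot"
      using eventually_le_at_bot[of "Z + a"] by eventually_elim simp
  qed
  have top: "filterlim (\<lambda>x. x - a) at_top at_top"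
    using filterlim_tendsto_add_at_top[OF tendsto_const[of "- a"] filterlim_ident] by simp
  show ?thesis
    unfolding distribution_function_def
  proof (intro conjI allI)
    show "mono (\<lambda>x. \<gamma> (x - a))" "range (\<lambda>x. \<gamma> (x - a)) \<subseteq> {0..1}"
      using D by (auto simp: mono_def)
    show "continuous (at_right x) (\<lambda>x. \<gamma> (x - a))" for x
      using filterlim_compose[OF D(4)[unfolded continuous_within] r] by (simp add: continuous_within)
    show "\<exists>l. ((\<lambda>x. \<gamma> (x - a)) \<longlongrightarrow> l) (at_left x)" for x
      using filterlim_compose[OF distribution_function_left_limit(1)[OF assms] l] by blast
    show "((\<lambda>x. \<gamma> (x - a)) \<longlongrightarrow> 0) at_bot"
      by (rule filterlim_compose[OF D(5) bot])
    show "((\<lambda>x. \<gamma> (x - a)) \<longlongrightarrow> 1) at_top"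
      by (rule filterlim_compose[OF D(6) top])
  qed
qed

locale mean_field = decreasing_rate +
  fixes \<mu> :: real and J J' :: "real \<Rightarrow> real"
  assumes mu: "\<mu> > 0"
    and strict: "\<And>u v. 0 \<le> u \<Longrightarrow> u < v \<Longrightarrow> v \<le> 1 \<Longrightarrow> \<eta> v < \<eta> u"
    and J: "distribution_function J"
    and moment1: "integrable (interval_measure J) (\<lambda>z. z)"
    and moment2: "integrable (interval_measure J) (\<lambda>z. z\<^sup>2)"
    and J'_meas [measurable]: "J' \<in> borel_measurable borel"
    and J'_density: "interval_measure J = density lborel (\<lambda>y. ennreal (indicator {0..} y * J' y))"
    and J'_pos: "\<And>y. y \<ge> 0 \<Longrightarrow> J' y > 0"
begin

definition MJ :: "real measure" where "MJ = interval_measure J"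

sublocale MJ: real_distribution MJ
  unfolding MJ_def by (rule real_distribution_distribution_function[OF J])

lemma sets_MJ [measurable_cong]: "sets MJ = sets borel"
  by simp

lemma MJ_UNIV [simp]: "measure MJ UNIV = 1"
  using MJ.prob_space by simp

lemma MJ_Iic: "measure MJ {..w} = J w"
  unfolding MJ_def using distribution_functionD[OF J]
  by (intro measure_interval_measure_Iic) auto

lemma MJ_Ioi: "measure MJ {w<..} = 1 - J w"
proof -
  have "{w<..} = space MJ - {..w}" by auto
  then show ?thesis
    using MJ.prob_compl[of "{..w}"] by (simp add: MJ_Iic)
qed

lemma AE_MJ_pos: "AE z in MJ. 0 < z"
proof -
  have "AE z::real in lborel. z \<noteq> 0"
    by (rule AE_lborel_singleton)
  then show ?thesis
    unfolding MJ_def J'_density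
    by (subst AE_density) (auto elim!: eventually_mono split: split_indicator)
qed

definition m1 :: real where "m1 = (\<integral>z. z \<partial>MJ)"

lemma integrable_MJ_id: "integrable MJ (\<lambda>z. z)"
  unfolding MJ_def by (rule moment1)

lemma m1_pos: "m1 > 0"
proof -
  have "m1 \<ge> 0"
    unfolding m1_def using AE_MJ_pos by (intro integral_nonneg_AE) (auto elim: eventually_mono)
  moreover have "m1 \<noteq> 0"
  proof
    assume "m1 = 0"
    then have "AE z in MJ. z = 0"
      using integral_nonneg_eq_0_iff_AE[OF integrable_MJ_id] AE_MJ_pos
      by (simp add: m1_def eventually_mono[OF AE_MJ_pos])
    with AE_MJ_pos have "AE z in MJ. False"
      by eventually_elim auto
    then show False by simp
  qed
  ultimately show ?thesis by simp
qed

lemma H_strict: assumes "0 \<le> u" "u < v" "v \<le> 1" shows "H u < H v"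
proof -
  define m where "m = (u + v) / 2"
  have m: "u < m" "m < v" using assms by (auto simp: m_def)
  have "0 < \<eta> m * (m - u)"
    using strict[of m 1] at1 m assms by auto
  also have "\<dots> \<le> H m - H u"
    using H_diff_bounds(1)[of u m] m assms by auto
  also have "\<dots> \<le> H v - H u"
    using H_mono[of m v] m assms by auto
  finally show ?thesis by simp
qed

definition H1 :: real where "H1 = H 1"

lemma H1_pos: "H1 > 0"
  using H_strict[of 0 1] by (simp add: H1_def)

text \<open>
  The mean displacement per unit time, shown below to equal the prescribed wave speed.
\<close>
definition v :: real where "v = \<mu> * m1 * H1"

lemma v_pos: "v > 0"
  using mu m1_pos H1_pos by (simp add: v_def)

text \<open>
  The evolution equation will read \<open>d/dt f = - \<mu> N(f)\<close>: mass never enters \<open>(-\<infinity>, x]\<close>, and it leaves at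
  the rate at which jumps of law \<open>J\<close> from points \<open>y \<le> x\<close>, taken at rate \<open>d H(f(y))\<close>, cross \<open>x\<close>.
\<close>
definition N :: "(real \<Rightarrow> real) \<Rightarrow> real \<Rightarrow> real" where
  "N \<gamma> x = (\<integral>z. H (\<gamma> x) - H (\<gamma> (x - z)) \<partial>MJ)"

lemma H_compose_measurable:
  "distribution_function \<gamma> \<Longrightarrow> (\<lambda>y. H (\<gamma> y)) \<in> borel_measurable borel"
  by (rule rate_compose_measurable)

lemma H_range: "distribution_function \<gamma> \<Longrightarrow> 0 \<le> H (\<gamma> x) \<and> H (\<gamma> x) \<le> 1"
  using H_bounds[of "\<gamma> x"] distribution_functionD(2,3)[of \<gamma> x] by auto

lemma H_shift_integrable:
  "distribution_function \<gamma> \<Longrightarrow> integrable MJ (\<lambda>z. H (\<gamma> (x - z)))"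
  using H_range[of \<gamma>] H_compose_measurable[of \<gamma>]
  by (intro MJ.integrable_const_bound[where B=1]) (auto intro!: measurable_compose[of _ _ _ "\<lambda>y. H (\<gamma> y)"])

lemma N_bounds:
  assumes \<gamma>: "distribution_function \<gamma>"
  shows "0 \<le> N \<gamma> x" "N \<gamma> x \<le> 1"
proof -
  note D = distribution_functionD[OF \<gamma>]
  show "0 \<le> N \<gamma> x"
    unfolding N_def
  proof (rule integral_nonneg_AE)
    show "AE z in MJ. 0 \<le> H (\<gamma> x) - H (\<gamma> (x - z))"
      using AE_MJ_pos by eventually_elim (use D H_mono in auto)
  qed
  have "N \<gamma> x \<le> (\<integral>z. 1 \<partial>MJ)"
    unfolding N_def using H_range[OF \<gamma>] H_shift_integrable[OF \<gamma>, of x]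
    by (intro integral_mono) (auto simp: algebra_simps add_increasing2)
  then show "N \<gamma> x \<le> 1" by simp
qed

lemma N_shift: "N (\<lambda>x. \<gamma> (x - a)) x = N \<gamma> (x - a)"
  by (simp add: N_def algebra_simps)

lemma H_compose_interval_measure:
  assumes \<gamma>: "distribution_function \<gamma>"
  shows "mono (\<lambda>y. H (\<gamma> y))" "continuous (at_right x) (\<lambda>y. H (\<gamma> y))"
    "((\<lambda>y. H (\<gamma> y)) \<longlongrightarrow> 0) at_bot" "((\<lambda>y. H (\<gamma> y)) \<longlongrightarrow> H1) at_top"
proof -
  note D = distribution_functionD[OF \<gamma>]
  have *: "((\<lambda>y. H (\<gamma> y)) \<longlongrightarrow> H l) F" if "(\<gamma> \<longlongrightarrow> l) F" "0 \<le> l" "l \<le> 1" for l F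
    by (rule continuous_on_tendsto_compose[OF H_cont that(1)]) (use that D(2,3) in auto)
  show "mono (\<lambda>y. H (\<gamma> y))"
    by (auto simp: mono_def intro!: H_mono D)
  show "continuous (at_right x) (\<lambda>y. H (\<gamma> y))"
    using D(2,3,4)[of x] by (auto simp: continuous_within intro: *)
  show "((\<lambda>y. H (\<gamma> y)) \<longlongrightarrow> 0) at_bot" "((\<lambda>y. H (\<gamma> y)) \<longlongrightarrow> H1) at_top"
    using *[OF D(5)] *[OF D(6)] by (auto simp: H1_def)
qed

lemma finite_interval_measure_H:
  assumes \<gamma>: "distribution_function \<gamma>"
  shows "emeasure (interval_measure (\<lambda>y. H (\<gamma> y))) UNIV = H1"
    "finite_borel_measure (interval_measure (\<lambda>y. H (\<gamma> y)))"
  using H_compose_interval_measure[OF \<gamma>] H1_pos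
  by (auto intro!: interval_measure_UNIV finite_borel_measure_interval_measure simp: mono_def)

text \<open>
  Write \<open>1 - J(x - y)\<close> as the probability that a jump exceeds \<open>x - y\<close> and exchange the integrals: the
  inner integral becomes the \<open>H(\<gamma>)\<close>-measure of \<open>(x - z, x]\<close>.
\<close>
lemma stieltjes_rate_eq_N:
  assumes \<gamma>: "distribution_function \<gamma>"
  shows "(LINT y:{..x}|interval_measure \<gamma>. eta_bar \<eta> y \<gamma> * (1 - J (x - y))) = N \<gamma> x"
proof -
  note D = distribution_functionD[OF \<gamma>]
  define \<nu> where "\<nu> = interval_measure (\<lambda>y. H (\<gamma> y))"
  interpret \<nu>: finite_borel_measure \<nu>
    unfolding \<nu>_def by (rule finite_interval_measure_H[OF \<gamma>])
  have [measurable_cong]: "sets \<nu> = sets borel" by (simp add: \<nu>_def)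
  have [measurable]: "J \<in> borel_measurable borel"
    by (rule distribution_function_measurable[OF J])
  have [measurable]: "(\<lambda>y. eta_bar \<eta> y \<gamma>) \<in> borel_measurable borel"
    by (rule eta_bar_measurable[OF \<gamma>])
  interpret P: pair_sigma_finite \<nu> MJ ..
  interpret PF: finite_measure "\<nu> \<Otimes>\<^sub>M MJ"
    by (rule finite_measure_pair_measure) unfold_locales
  have "(LINT y:{..x}|interval_measure \<gamma>. eta_bar \<eta> y \<gamma> * (1 - J (x - y)))
      = (\<integral>y. eta_bar \<eta> y \<gamma> *\<^sub>R (indicator {..x} y * (1 - J (x - y))) \<partial>interval_measure \<gamma>)"
    unfolding set_lebesgue_integral_def by (intro Bochner_Integration.integral_cong) auto
  also have "\<dots> = (\<integral>y. indicator {..x} y * (1 - J (x - y)) \<partial>\<nu>)"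
    unfolding \<nu>_def interval_measure_H[OF \<gamma>]
    by (subst integral_density) (auto simp: eta_bar_bounds[OF \<gamma>])
  also have "\<dots> = (\<integral>y. (\<integral>z. indicator {..x} y * indicator {x - y<..} z \<partial>MJ) \<partial>\<nu>)"
    by (intro Bochner_Integration.integral_cong) (simp_all add: MJ_Ioi)
  also have "\<dots> = (\<integral>y. (\<integral>z. (if y \<le> x \<and> x - y < z then 1 else 0) \<partial>MJ) \<partial>\<nu>)"
    by (intro Bochner_Integration.integral_cong) (auto simp: indicator_def)
  also have "\<dots> = (\<integral>z. (\<integral>y. (if y \<le> x \<and> x - y < z then 1 else 0) \<partial>\<nu>) \<partial>MJ)"
    by (rule P.Fubini_integral[symmetric]) (intro PF.integrable_const_bound[where B=1], auto)
  also have "\<dots> = N \<gamma> x"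
    unfolding N_def
  proof (rule integral_cong_AE)
    show "(\<lambda>z. \<integral>y. (if y \<le> x \<and> x - y < z then 1 else 0 :: real) \<partial>\<nu>) \<in> borel_measurable MJ"
      by (rule \<nu>.borel_measurable_lebesgue_integral) measurable
    show "(\<lambda>z. H (\<gamma> x) - H (\<gamma> (x - z))) \<in> borel_measurable MJ"
      using borel_measurable_integrable[OF H_shift_integrable[OF \<gamma>, of x]] by simp
    show "AE z in MJ. (\<integral>y. (if y \<le> x \<and> x - y < z then 1 else 0) \<partial>\<nu>) = H (\<gamma> x) - H (\<gamma> (x - z))"
      using AE_MJ_pos
    proof eventually_elim
      case (elim z)
      have "(\<integral>y. (if y \<le> x \<and> x - y < z then 1 else 0) \<partial>\<nu>) = (\<integral>y. indicator {x - z<..x} y \<partial>\<nu>)"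
        by (intro Bochner_Integration.integral_cong) (auto simp: indicator_def)
      also have "\<dots> = measure \<nu> {x - z<..x}"
        by simp
      also have "\<dots> = H (\<gamma> x) - H (\<gamma> (x - z))"
        unfolding \<nu>_def using elim H_compose_interval_measure(1,2)[OF \<gamma>]
        by (intro measure_interval_measure_Ioc) (auto simp: mono_def)
      finally show ?case .
    qed
  qed
  finally show ?thesis .
qed

definition solution :: "(real \<Rightarrow> real \<Rightarrow> real) \<Rightarrow> bool" where
  "solution f \<longleftrightarrow> (\<forall>t\<ge>0. distribution_function (\<lambda>x. f x t)) \<and>
     (\<forall>x. \<forall>t\<ge>0. (f x has_real_derivative - \<mu> * N (\<lambda>y. f y t) x) (at t within {0..}))"

lemma solutionD:
  assumes "solution f"
  shows "t \<ge> 0 \<Longrightarrow> distribution_function (\<lambda>x. f x t)"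
    "t \<ge> 0 \<Longrightarrow> (f x has_real_derivative - \<mu> * N (\<lambda>y. f y t) x) (at t within {0..})"
  using assms by (auto simp: solution_def)

lemma at_within_nonneg_nontrivial: 
  fixes t :: real assumes t: "0 \<le> t" shows "at t within {0..} \<noteq> bot"
proof
  assume bot: "at t within {0..} = bot"
  have "at_right t \<le> at t within {0..}"
    using t by (intro at_le) auto
  with bot have "at_right t = bot"
    by (simp add: bot.extremum_unique)
  then show False
    using trivial_limit_at_right_real[of t] by simp
qed

text \<open>
  Since \<open>H\<close> is 1-Lipschitz, \<open>N\<close> is 2-Lipschitz in the supremum norm. This gives continuity in time of the
  right-hand side of the equation along any Lipschitz family.
\<close>
lemma N_dist:
  assumes "distribution_function f" "distribution_function g" "\<And>x. \<bar>f x - g x\<bar> \<le> d"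
  shows "\<bar>N f x - N g x\<bar> \<le> 2 * d"
proof -
  have *: "\<bar>H (f y) - H (g y)\<bar> \<le> d" for y
    using H_dist[of "f y" "g y"] distribution_functionD(2,3)[OF assms(1), of y]
      distribution_functionD(2,3)[OF assms(2), of y] assms(3)[of y] by auto
  have eq: "N f x - N g x = (\<integral>z. (H (f x) - H (f (x - z))) - (H (g x) - H (g (x - z))) \<partial>MJ)"
    unfolding N_def using H_shift_integrable[OF assms(1), of x] H_shift_integrable[OF assms(2), of x]
    by (subst Bochner_Integration.integral_diff) auto
  have "\<bar>\<integral>z. (H (f x) - H (f (x - z))) - (H (g x) - H (g (x - z))) \<partial>MJ\<bar> \<le> (\<integral>z. 2 * d \<partial>MJ)"
  proof (rule order_trans[OF integral_abs_bound], rule integral_mono)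
    show "\<bar>(H (f x) - H (f (x - z))) - (H (g x) - H (g (x - z)))\<bar> \<le> 2 * d" for z
      using *[of x] *[of "x - z"] by linarith
    show "integrable MJ (\<lambda>z. \<bar>(H (f x) - H (f (x - z))) - (H (g x) - H (g (x - z)))\<bar>)"
      using H_shift_integrable[OF assms(1), of x] H_shift_integrable[OF assms(2), of x]
      by (intro integrable_abs) auto
  qed simp
  then show ?thesis by (simp add: eq)
qed

lemma N_continuous:
  fixes f :: "real \<Rightarrow> real \<Rightarrow> real"
  assumes dist: "\<And>t. t \<ge> 0 \<Longrightarrow> distribution_function (\<lambda>x. f x t)"
    and lip: "\<And>x. c-lipschitz_on {0..} (f x)"
  shows "continuous_on {0..} (\<lambda>t. N (\<lambda>y. f y t) x)"
proof -
  have c: "c \<ge> 0" using lip lipschitz_on_nonneg by blast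
  have "(2 * c)-lipschitz_on {0..} (\<lambda>t. N (\<lambda>y. f y t) x)"
  proof (rule lipschitz_onI)
    fix s t :: real assume st: "s \<in> {0..}" "t \<in> {0..}"
    have "\<bar>N (\<lambda>y. f y s) x - N (\<lambda>y. f y t) x\<bar> \<le> 2 * (c * dist s t)"
      using st lipschitz_onD[OF lip st]
      by (intro N_dist dist) (auto simp: dist_real_def)
    then show "dist (N (\<lambda>y. f y s) x) (N (\<lambda>y. f y t) x) \<le> 2 * c * dist s t"
      by (simp add: dist_real_def)
  qed (use c in auto)
  then show ?thesis by (rule lipschitz_on_continuous_on)
qed

lemma solution_mono_lipschitz:
  assumes "solution f"
  shows "antimono_on {0..} (f x)" "\<mu>-lipschitz_on {0..} (f x)"
proof -
  have d: "(f x has_real_derivative - \<mu> * N (\<lambda>y. f y t) x) (at t within {0..})" if "t \<ge> 0" for t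
    by (rule solutionD[OF assms that])
  have *: "f x t \<le> f x s \<and> f x s - f x t \<le> \<mu> * (t - s)" if st: "0 \<le> s" "s \<le> t" for s t
  proof (cases "s = t")
    case False
    then have "s < t" using st by simp
    then obtain z where z: "z \<in> {s<..<t}" "f x t - f x s = (t - s) * (- \<mu> * N (\<lambda>y. f y z) x)"
    proof -
      have "\<exists>z\<in>{s<..<t}. f x t - f x s = (\<lambda>h. h * (- \<mu> * N (\<lambda>y. f y z) x)) (t - s)"
      proof (rule mvt_simple[OF \<open>s < t\<close>])
        fix z assume "s \<le> z" "z \<le> t"
        then have "(f x has_real_derivative - \<mu> * N (\<lambda>y. f y z) x) (at z within {s..t})"
          using st by (intro DERIV_subset[OF d]) auto
        then show "(f x has_derivative (\<lambda>h. h * (- \<mu> * N (\<lambda>y. f y z) x))) (at z within {s..t})"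
          unfolding has_field_derivative_def
          by (rule has_derivative_eq_rhs) (simp add: fun_eq_iff mult.commute)
      qed
      then show ?thesis using that by auto
    qed
    have n: "0 \<le> N (\<lambda>y. f y z) x" "N (\<lambda>y. f y z) x \<le> 1"
      using N_bounds[OF solutionD(1)[OF assms, of z]] z(1) st by auto
    have "0 \<le> (t - s) * (\<mu> * N (\<lambda>y. f y z) x)" "(t - s) * (\<mu> * N (\<lambda>y. f y z) x) \<le> (t - s) * (\<mu> * 1)"
      using n mu \<open>s < t\<close> by (auto intro!: mult_left_mono)
    then show ?thesis using z(2) by (auto simp: algebra_simps)
  qed simp
  show "antimono_on {0..} (f x)"
    using * by (auto simp: monotone_on_def)
  show "\<mu>-lipschitz_on {0..} (f x)"
  proof (rule lipschitz_onI)
    fix s t :: real assume "s \<in> {0..}" "t \<in> {0..}"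
    then show "dist (f x s) (f x t) \<le> \<mu> * dist s t"
      using *[of s t] *[of t s] by (cases "s \<le> t") (auto simp: dist_real_def)
  qed (use mu in simp)
qed

text \<open>
  From left to right, the equation extends from the points of differentiability to all times. From right to
  left, \<open>0 \<le> N \<le> 1\<close> yields monotonicity and the Lipschitz constant \<open>\<mu>\<close>.
\<close>
lemma mean_field_model_iff_solution:
  "mean_field_model \<mu> \<eta> J f \<longleftrightarrow> solution f"
proof
  assume f: "mean_field_model \<mu> \<eta> J f"
  then have dist: "\<And>t. t \<ge> 0 \<Longrightarrow> distribution_function (\<lambda>x. f x t)"
    by (auto simp: mean_field_model_def)
  obtain c where c: "\<And>x. antimono_on {0..} (f x)" "\<And>x. c-lipschitz_on {0..} (f x)"
    using f unfolding mean_field_model_def by metis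
  have deriv: "D = - \<mu> * N (\<lambda>y. f y t) x"
    if "t \<ge> 0" "(f x has_real_derivative D) (at t within {0..})" for x t D
  proof -
    have "D = - \<mu> * (LINT y:{..x}|interval_measure (\<lambda>y. f y t). eta_bar \<eta> y (\<lambda>z. f z t) * (1 - J (x - y)))"
      using f that unfolding mean_field_model_def by blast
    then show ?thesis
      using stieltjes_rate_eq_N[OF dist[OF that(1)], of x] by simp
  qed
  have "(f x has_real_derivative - \<mu> * N (\<lambda>y. f y t) x) (at t within {0..})" if "t \<ge> 0" for x t
    by (rule lipschitz_derivative_everywhere[OF c])
       (rule continuous_intros N_continuous[OF dist c(2)] deriv that | assumption)+
  with dist show "solution f" by (auto simp: solution_def)
next
  assume f: "solution f"
  have "D = - \<mu> * (LINT y:{..x}|interval_measure (\<lambda>y. f y t). eta_bar \<eta> y (\<lambda>z. f z t) * (1 - J (x - y)))"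
    if "t \<ge> 0" "(f x has_real_derivative D) (at t within {0..})" for x t D
  proof -
    have "D = - \<mu> * N (\<lambda>y. f y t) x"
      by (rule has_field_derivative_unique[OF that(2) solutionD(2)[OF f that(1)] at_within_nonneg_nontrivial[OF that(1)]])
    then show ?thesis
      using stieltjes_rate_eq_N[OF solutionD(1)[OF f that(1)], of x] by simp
  qed
  with solutionD(1)[OF f] solution_mono_lipschitz[OF f] show "mean_field_model \<mu> \<eta> J f"
    unfolding mean_field_model_def by blast
qed

section \<open>Conservation of mass in the moving frame\<close>

text \<open>
  The integrand is the \<open>H(\<gamma>)\<close>-measure of \<open>(x - z, x]\<close>. Each point \<open>y\<close> lies in these intervals for a set of
  \<open>x\<close> of length \<open>z\<close>, and the total mass is \<open>H(1)\<close>.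
\<close>
lemma nn_integral_H_shift:
  assumes \<gamma>: "distribution_function \<gamma>" and z: "z > 0"
  shows "(\<integral>\<^sup>+x. ennreal (H (\<gamma> x) - H (\<gamma> (x - z))) \<partial>lborel) = ennreal (z * H1)"
proof -
  define \<nu> where "\<nu> = interval_measure (\<lambda>y. H (\<gamma> y))"
  interpret \<nu>: finite_borel_measure \<nu>
    unfolding \<nu>_def by (rule finite_interval_measure_H[OF \<gamma>])
  have [measurable_cong]: "sets \<nu> = sets borel" by (simp add: \<nu>_def)
  interpret P: pair_sigma_finite \<nu> lborel ..
  have "(\<integral>\<^sup>+x. ennreal (H (\<gamma> x) - H (\<gamma> (x - z))) \<partial>lborel)
      = (\<integral>\<^sup>+x. (\<integral>\<^sup>+y. (if x - z < y \<and> y \<le> x then 1 else 0) \<partial>\<nu>) \<partial>lborel)"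
  proof (rule nn_integral_cong)
    fix x
    have "(\<integral>\<^sup>+y. (if x - z < y \<and> y \<le> x then 1 else 0) \<partial>\<nu>) = (\<integral>\<^sup>+y. indicator {x - z<..x} y \<partial>\<nu>)"
      by (intro nn_integral_cong) (auto simp: indicator_def)
    also have "\<dots> = emeasure \<nu> {x - z<..x}"
      by simp
    also have "\<dots> = ennreal (H (\<gamma> x) - H (\<gamma> (x - z)))"
      unfolding \<nu>_def using z H_compose_interval_measure(1,2)[OF \<gamma>]
      by (intro emeasure_interval_measure_Ioc) (auto simp: mono_def)
    finally show "ennreal (H (\<gamma> x) - H (\<gamma> (x - z))) = (\<integral>\<^sup>+y. (if x - z < y \<and> y \<le> x then 1 else 0) \<partial>\<nu>)"
      by simp
  qed
  also have "\<dots> = (\<integral>\<^sup>+y. (\<integral>\<^sup>+x. (if x - z < y \<and> y \<le> x then 1 else 0) \<partial>lborel) \<partial>\<nu>)"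
    by (rule P.Fubini') measurable
  also have "\<dots> = (\<integral>\<^sup>+y. ennreal z \<partial>\<nu>)"
  proof (rule nn_integral_cong)
    fix y
    have "(\<integral>\<^sup>+x. (if x - z < y \<and> y \<le> x then 1 else 0) \<partial>lborel) = (\<integral>\<^sup>+x. indicator {y..<y + z} x \<partial>lborel)"
      by (intro nn_integral_cong) (auto simp: indicator_def)
    then show "(\<integral>\<^sup>+x. (if x - z < y \<and> y \<le> x then 1 else 0) \<partial>lborel) = ennreal z"
      using z by simp
  qed
  also have "\<dots> = ennreal (z * H1)"
    using finite_interval_measure_H(1)[OF \<gamma>] z H1_pos by (simp add: \<nu>_def ennreal_mult)
  finally show ?thesis .
qed

lemma nn_integral_N:
  assumes \<gamma>: "distribution_function \<gamma>"
  shows "(\<integral>\<^sup>+x. ennreal (N \<gamma> x) \<partial>lborel) = ennreal (m1 * H1)"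
proof -
  have [measurable]: "(\<lambda>y. H (\<gamma> y)) \<in> borel_measurable borel"
    by (rule H_compose_measurable[OF \<gamma>])
  interpret Q: pair_sigma_finite MJ lborel ..
  have mono: "H (\<gamma> (x - z)) \<le> H (\<gamma> x)" if "z > 0" for x z
    using monoD[OF H_compose_interval_measure(1)[OF \<gamma>], of "x - z" x] that by simp
  note * = nn_integral_H_shift[OF \<gamma>]
  have "(\<integral>\<^sup>+x. ennreal (N \<gamma> x) \<partial>lborel) = (\<integral>\<^sup>+x. (\<integral>\<^sup>+z. ennreal (H (\<gamma> x) - H (\<gamma> (x - z))) \<partial>MJ) \<partial>lborel)"
  proof (rule nn_integral_cong)
    fix x
    show "ennreal (N \<gamma> x) = (\<integral>\<^sup>+z. ennreal (H (\<gamma> x) - H (\<gamma> (x - z))) \<partial>MJ)"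
      unfolding N_def
    proof (rule nn_integral_eq_integral[symmetric])
      show "integrable MJ (\<lambda>z. H (\<gamma> x) - H (\<gamma> (x - z)))"
        using H_shift_integrable[OF \<gamma>] by auto
      show "AE z in MJ. 0 \<le> H (\<gamma> x) - H (\<gamma> (x - z))"
        using AE_MJ_pos by eventually_elim (use mono in auto)
    qed
  qed
  also have "\<dots> = (\<integral>\<^sup>+z. (\<integral>\<^sup>+x. ennreal (H (\<gamma> x) - H (\<gamma> (x - z))) \<partial>lborel) \<partial>MJ)"
    by (rule Q.Fubini') measurable
  also have "\<dots> = (\<integral>\<^sup>+z. ennreal (z * H1) \<partial>MJ)"
    by (rule nn_integral_cong_AE) (rule eventually_mono[OF AE_MJ_pos], rule *)
  also have "\<dots> = ennreal (\<integral>z. z * H1 \<partial>MJ)"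
  proof (rule nn_integral_eq_integral)
    show "integrable MJ (\<lambda>z. z * H1)"
      using integrable_MJ_id by auto
    show "AE z in MJ. 0 \<le> z * H1"
      using AE_MJ_pos by eventually_elim (use H1_pos in auto)
  qed
  also have "(\<integral>z. z * H1 \<partial>MJ) = m1 * H1"
    by (simp add: m1_def)
  finally show ?thesis .
qed

text \<open>
  Solutions are only constrained at times \<open>t \<ge> 0\<close>; freezing them at negative times makes joint
  measurability a statement about the whole plane.
\<close>
definition extended :: "(real \<Rightarrow> real \<Rightarrow> real) \<Rightarrow> real \<Rightarrow> real \<Rightarrow> real" where
  "extended f x t = f x (max 0 t)"

lemma extended_eq: "t \<ge> 0 \<Longrightarrow> extended f x t = f x t"
  by (simp add: extended_def max_def)

lemma extended_distribution: "solution f \<Longrightarrow> distribution_function (\<lambda>x. extended f x t)"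
  unfolding extended_def by (rule solutionD) auto

text \<open>
  A function that is measurable in \<open>x\<close> and continuous in \<open>t\<close> is the limit of its values at the grid times
  below \<open>t\<close>.
\<close>
lemma solution_measurable:
  assumes f: "solution f"
  shows "case_prod (extended f) \<in> borel_measurable (borel \<Otimes>\<^sub>M borel)"
proof (rule borel_measurable_LIMSEQ_real)
  define a where "a n t = real_of_int \<lfloor>real (Suc n) * t\<rfloor> / real (Suc n)" for n t
  have a: "\<bar>a n t - t\<bar> \<le> 1 / real (Suc n)" for n t
  proof -
    define c where "c = real (Suc n)"
    have c: "c > 0" by (simp add: c_def)
    have "\<bar>real_of_int \<lfloor>c * t\<rfloor> - c * t\<bar> \<le> 1" by linarith
    then have "\<bar>real_of_int \<lfloor>c * t\<rfloor> - c * t\<bar> / c \<le> 1 / c"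
      using c by (intro divide_right_mono) auto
    moreover have "a n t - t = (real_of_int \<lfloor>c * t\<rfloor> - c * t) / c"
      unfolding a_def c_def[symmetric] using c by (simp add: diff_divide_distrib)
    ultimately show ?thesis
      unfolding c_def[symmetric] using c by (simp add: abs_divide)
  qed
  have alim: "(\<lambda>n. a n t) \<longlonglongrightarrow> t" for t
  proof (rule LIMSEQ_I)
    fix r :: real assume "r > 0"
    then obtain N where "1 / real (Suc N) < r"
      using nat_approx_posE by blast
    then have "norm (a n t - t) < r" if "n \<ge> N" for n
      using a[of n t] frac_le[of 1 1 "real (Suc N)" "real (Suc n)"] that by auto
    then show "\<exists>no. \<forall>n\<ge>no. norm (a n t - t) < r" by blast
  qed
  show "(\<lambda>n. case p of (x, t) \<Rightarrow> extended f x (a n t)) \<longlonglongrightarrow> (case p of (x, t) \<Rightarrow> extended f x t)" for p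
  proof (cases p)
    case (Pair x t)
    have "continuous_on {0..} (f x)"
      using solution_mono_lipschitz(2)[OF f] by (rule lipschitz_on_continuous_on)
    moreover have "(\<lambda>n. max 0 (a n t)) \<longlonglongrightarrow> max 0 t"
      by (intro tendsto_intros alim)
    ultimately have "(\<lambda>n. f x (max 0 (a n t))) \<longlonglongrightarrow> f x (max 0 t)"
      by (rule continuous_on_tendsto_compose) auto
    then show ?thesis by (simp add: Pair extended_def)
  qed
  show "(\<lambda>p. case p of (x, t) \<Rightarrow> extended f x (a n t)) \<in> borel_measurable (borel \<Otimes>\<^sub>M borel)" for n
  proof -
    have "(\<lambda>p. extended f (fst p) (real_of_int \<lfloor>real (Suc n) * snd p\<rfloor> / real (Suc n)))
        \<in> borel_measurable (borel \<Otimes>\<^sub>M borel)"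
    proof (rule measurable_compose_countable[where f="\<lambda>k p. extended f (fst p) (real_of_int k / real (Suc n))"
          and g="\<lambda>p. \<lfloor>real (Suc n) * snd p\<rfloor>"])
      show "(\<lambda>p. extended f (fst p) (real_of_int k / real (Suc n))) \<in> borel_measurable (borel \<Otimes>\<^sub>M borel)" for k
        by (rule measurable_compose[OF measurable_fst distribution_function_measurable[OF extended_distribution[OF f]]])
    qed measurable
    then show ?thesis
      by (simp add: case_prod_beta' a_def)
  qed
qed

end

lemma nn_integral_Icc_has_integral:
  fixes g :: "real \<Rightarrow> real"
  assumes "continuous_on {a..b} g" "\<And>s. s \<in> {a..b} \<Longrightarrow> 0 \<le> g s" "(g has_integral I) {a..b}"
  shows "(\<integral>\<^sup>+s. ennreal (indicator {a..b} s * g s) \<partial>lborel) = ennreal I"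
proof -
  have "set_integrable lborel {a..b} g"
    using borel_integrable_atLeastAtMost'[OF assms(1)] .
  then have "integrable lborel (\<lambda>s. indicator {a..b} s * g s)"
    by (simp add: set_integrable_def)
  moreover have "(\<integral>s. indicator {a..b} s * g s \<partial>lborel) = I"
    using set_borel_integral_eq_integral(2)[OF \<open>set_integrable lborel {a..b} g\<close>] integral_unique[OF assms(3)]
    by (simp add: set_lebesgue_integral_def)
  ultimately show ?thesis
    using assms(2) by (subst nn_integral_eq_integral) (auto split: split_indicator)
qed

context mean_field
begin

lemma solution_N_continuous:
  assumes f: "solution f"
  shows "continuous_on {0..} (\<lambda>t. N (\<lambda>y. f y t) x)"
  using N_continuous[OF solutionD(1)[OF f] solution_mono_lipschitz(2)[OF f]] by blast

lemma solution_H_continuous: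
  assumes f: "solution f"
  shows "continuous_on {0..} (\<lambda>t. H (f x t))"
proof (rule continuous_on_compose2[OF H_cont])
  show "continuous_on {0..} (f x)"
    using solution_mono_lipschitz(2)[OF f] by (rule lipschitz_on_continuous_on)
  show "f x ` {0..} \<subseteq> {0..1}"
    using distribution_functionD(2,3)[OF solutionD(1)[OF f]] by force
qed

lemma solution_H_measurable:
  assumes f: "solution f"
  shows "(\<lambda>p. H (extended f (fst p) (snd p))) \<in> borel_measurable (borel \<Otimes>\<^sub>M borel)"
proof -
  \<comment> \<open>\<open>H\<close> is controlled on the unit interval only, where its values coincide with those of a monotone function.\<close>
  define K where "K = (\<lambda>u. H (max 0 (min 1 u)))"
  have "mono K"
    unfolding K_def by (auto simp: mono_def intro!: H_mono)
  then have [measurable]: "K \<in> borel_measurable borel"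
    by (rule borel_measurable_mono)
  have "(\<lambda>p. K (case_prod (extended f) p)) \<in> borel_measurable (borel \<Otimes>\<^sub>M borel)"
    using solution_measurable[OF f] by measurable
  moreover have "K (case_prod (extended f) p) = H (extended f (fst p) (snd p))" for p
    using distribution_functionD(2,3)[OF extended_distribution[OF f], of "fst p" "snd p"]
    by (simp add: K_def case_prod_beta' min_absorb2 max_absorb2)
  ultimately show ?thesis by simp
qed

text \<open>
  The mass that has crossed each point, integrated over all points, is the total displacement: integrate the
  equation over \<open>[s, t]\<close>, exchange the integrals, and use that the integral of \<open>N\<close> over the line is
  \<open>m1 * H1\<close>.
\<close>
lemma nn_integral_solution_decrease:
  assumes f: "solution f" and t: "0 \<le> s" "s \<le> t"
  shows "(\<integral>\<^sup>+x. ennreal (f x s - f x t) \<partial>lborel) = ennreal (v * (t - s))"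
proof -
  define G where "G x r = indicator {s..t} r * (\<mu> * N (\<lambda>y. extended f y r) x)" for x r :: real
  have [measurable]: "(\<lambda>p. H (extended f (fst p) (snd p))) \<in> borel_measurable (borel \<Otimes>\<^sub>M borel)"
    by (rule solution_H_measurable[OF f])
  have m2: "(\<lambda>q. H (extended f (fst (fst q) - snd q) (snd (fst q)))) \<in> borel_measurable ((borel \<Otimes>\<^sub>M borel) \<Otimes>\<^sub>M MJ)"
    using measurable_compose[of "\<lambda>q. (fst (fst q) - snd q, snd (fst q))" "(borel \<Otimes>\<^sub>M borel) \<Otimes>\<^sub>M MJ" "borel \<Otimes>\<^sub>M borel" "\<lambda>p. H (extended f (fst p) (snd p))" borel]
    by simp
  have m3: "(\<lambda>q. H (extended f (fst (fst q)) (snd (fst q)))) \<in> borel_measurable ((borel \<Otimes>\<^sub>M borel) \<Otimes>\<^sub>M MJ)"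
    using measurable_compose[of "\<lambda>q. fst q" "(borel \<Otimes>\<^sub>M borel) \<Otimes>\<^sub>M MJ" "borel \<Otimes>\<^sub>M borel" "\<lambda>p. H (extended f (fst p) (snd p))" borel]
    by simp
  have [measurable]: "(\<lambda>p. N (\<lambda>y. extended f y (snd p)) (fst p)) \<in> borel_measurable (borel \<Otimes>\<^sub>M borel)"
    unfolding N_def
    by (rule MJ.borel_measurable_lebesgue_integral) (use m2 m3 in \<open>simp add: case_prod_beta'\<close>)
  have G_meas: "case_prod G \<in> borel_measurable (lborel \<Otimes>\<^sub>M lborel)"
    unfolding G_def case_prod_beta' by measurable
  have "(\<integral>\<^sup>+x. ennreal (f x s - f x t) \<partial>lborel) = (\<integral>\<^sup>+x. (\<integral>\<^sup>+r. ennreal (G x r) \<partial>lborel) \<partial>lborel)"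
  proof (rule nn_integral_cong)
    fix x
    have st: "{s..t} \<subseteq> {0..}" using t by auto
    have "((\<lambda>r. - \<mu> * N (\<lambda>y. f y r) x) has_integral f x t - f x s) {s..t}"
    proof (rule fundamental_theorem_of_calculus[OF t(2)])
      fix r assume "r \<in> {s..t}"
      then show "(f x has_vector_derivative - \<mu> * N (\<lambda>y. f y r) x) (at r within {s..t})"
        using DERIV_subset[OF solutionD(2)[OF f] st, of r x] t
        by (simp add: has_real_derivative_iff_has_vector_derivative)
    qed
    from has_integral_neg[OF this]
    have "((\<lambda>r. \<mu> * N (\<lambda>y. f y r) x) has_integral f x s - f x t) {s..t}"
      by simp
    then have "(\<integral>\<^sup>+r. ennreal (indicator {s..t} r * (\<mu> * N (\<lambda>y. f y r) x)) \<partial>lborel) = ennreal (f x s - f x t)"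
      using mu t N_bounds(1)[OF solutionD(1)[OF f]]
      by (intro nn_integral_Icc_has_integral)
         (auto intro!: continuous_intros continuous_on_subset[OF solution_N_continuous[OF f] st])
    moreover have "(\<integral>\<^sup>+r. ennreal (G x r) \<partial>lborel) = (\<integral>\<^sup>+r. ennreal (indicator {s..t} r * (\<mu> * N (\<lambda>y. f y r) x)) \<partial>lborel)"
      using t by (intro nn_integral_cong) (auto simp: G_def extended_eq split: split_indicator)
    ultimately show "ennreal (f x s - f x t) = (\<integral>\<^sup>+r. ennreal (G x r) \<partial>lborel)"
      by simp
  qed
  also have "\<dots> = (\<integral>\<^sup>+r. (\<integral>\<^sup>+x. ennreal (G x r) \<partial>lborel) \<partial>lborel)"
    by (rule lborel_pair.Fubini'[symmetric]) (use G_meas in \<open>simp add: case_prod_beta'\<close>)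
  also have "\<dots> = (\<integral>\<^sup>+r. ennreal (\<mu> * (m1 * H1)) * indicator {s..t} r \<partial>lborel)"
  proof (rule nn_integral_cong)
    fix r
    have d: "distribution_function (\<lambda>y. extended f y r)" by (rule extended_distribution[OF f])
    have [measurable]: "N (\<lambda>y. extended f y r) \<in> borel_measurable borel"
      using measurable_compose[of "\<lambda>x. (x, r)" borel "borel \<Otimes>\<^sub>M borel" "\<lambda>p. N (\<lambda>y. extended f y (snd p)) (fst p)" borel]
      by simp
    have "(\<integral>\<^sup>+x. ennreal (G x r) \<partial>lborel) = (\<integral>\<^sup>+x. ennreal \<mu> * indicator {s..t} r * ennreal (N (\<lambda>y. extended f y r) x) \<partial>lborel)"
      using mu N_bounds(1)[OF d] by (intro nn_integral_cong) (auto simp: G_def ennreal_mult split: split_indicator)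
    also have "\<dots> = ennreal \<mu> * indicator {s..t} r * (\<integral>\<^sup>+x. ennreal (N (\<lambda>y. extended f y r) x) \<partial>lborel)"
      by (rule nn_integral_cmult) measurable
    also have "\<dots> = ennreal (\<mu> * (m1 * H1)) * indicator {s..t} r"
      using mu m1_pos H1_pos nn_integral_N[OF d] by (simp add: ennreal_mult ac_simps)
    finally show "(\<integral>\<^sup>+x. ennreal (G x r) \<partial>lborel) = ennreal (\<mu> * (m1 * H1)) * indicator {s..t} r" .
  qed
  also have "\<dots> = ennreal (v * (t - s))"
    using t mu m1_pos H1_pos by (simp add: nn_integral_cmult_indicator v_def ennreal_mult[symmetric] mult.assoc)
  finally show ?thesis .
qed

lemma solution_decrease_integrable:
  assumes f: "solution f" and t: "0 \<le> s" "s \<le> t"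
  shows "integrable lborel (\<lambda>x. f x s - f x t)" "(\<integral>x. f x s - f x t \<partial>lborel) = v * (t - s)"
proof -
  have [measurable]: "(\<lambda>x. f x s) \<in> borel_measurable borel" "(\<lambda>x. f x t) \<in> borel_measurable borel"
    using distribution_function_measurable[OF solutionD(1)[OF f]] t by auto
  have nn: "AE x in lborel. 0 \<le> f x s - f x t"
    using solution_mono_lipschitz(1)[OF f] t by (auto simp: monotone_on_def)
  have v: "0 \<le> v * (t - s)" using v_pos t by auto
  have "integrable lborel (\<lambda>x. f x s - f x t) \<and> (\<integral>x. f x s - f x t \<partial>lborel) = v * (t - s)"
    using nn_integral_solution_decrease[OF f t]
    by (subst (asm) nn_integral_eq_integrable[OF _ nn v]) auto
  then show "integrable lborel (\<lambda>x. f x s - f x t)" "(\<integral>x. f x s - f x t \<partial>lborel) = v * (t - s)"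
    by auto
qed

text \<open>
  Both solutions lose the same integral \<open>v t\<close>, so the integral of their difference is conserved. The crude
  linear bound on the \<open>L\<^sub>1\<close> distance serves only to make later cancellations legitimate.
\<close>
lemma solution_difference_integral:
  assumes f: "solution f" and g: "solution g" and t: "0 \<le> t"
    and int: "integrable lborel (\<lambda>x. f x 0 - g x 0)"
  shows "integrable lborel (\<lambda>x. f x t - g x t)"
    "(\<integral>x. f x t - g x t \<partial>lborel) = (\<integral>x. f x 0 - g x 0 \<partial>lborel)"
    "(\<integral>x. \<bar>f x t - g x t\<bar> \<partial>lborel) \<le> (\<integral>x. \<bar>f x 0 - g x 0\<bar> \<partial>lborel) + 2 * v * t"
proof -
  note F = solution_decrease_integrable[OF f order_refl t] and G = solution_decrease_integrable[OF g order_refl t]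
  have eq: "(\<lambda>x. f x t - g x t) = (\<lambda>x. (f x 0 - g x 0) - (f x 0 - f x t) + (g x 0 - g x t))"
    by (auto simp: fun_eq_iff)
  have gen: "(\<integral>x. a x - b x + c x \<partial>lborel) = (\<integral>x. a x \<partial>lborel) - (\<integral>x. b x \<partial>lborel) + (\<integral>x. c x \<partial>lborel)"
    "(\<integral>x. a x + b x + c x \<partial>lborel) = (\<integral>x. a x \<partial>lborel) + (\<integral>x. b x \<partial>lborel) + (\<integral>x. c x \<partial>lborel)"
    if "integrable lborel a" "integrable lborel b" "integrable lborel c" for a b c :: "real \<Rightarrow> real"
    using that by simp_all
  show i: "integrable lborel (\<lambda>x. f x t - g x t)"
    unfolding eq
    by (rule Bochner_Integration.integrable_add[OF Bochner_Integration.integrable_diff[OF int F(1)] G(1)])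
  show "(\<integral>x. f x t - g x t \<partial>lborel) = (\<integral>x. f x 0 - g x 0 \<partial>lborel)"
    unfolding eq gen(1)[OF int F(1) G(1)] F(2) G(2) by simp
  have nn: "0 \<le> f x 0 - f x t" "0 \<le> g x 0 - g x t" for x
    using solution_mono_lipschitz(1)[OF f, of x] solution_mono_lipschitz(1)[OF g, of x] t
    by (auto simp: monotone_on_def)
  have "(\<integral>x. \<bar>f x t - g x t\<bar> \<partial>lborel) \<le> (\<integral>x. \<bar>f x 0 - g x 0\<bar> + (f x 0 - f x t) + (g x 0 - g x t) \<partial>lborel)"
  proof (rule integral_mono)
    show "\<bar>f x t - g x t\<bar> \<le> \<bar>f x 0 - g x 0\<bar> + (f x 0 - f x t) + (g x 0 - g x t)" for x
      using nn[of x] by linarith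
  qed (rule integrable_abs[OF i]
      Bochner_Integration.integrable_add[OF Bochner_Integration.integrable_add[OF integrable_abs[OF int] F(1)] G(1)])+
  also have "\<dots> = (\<integral>x. \<bar>f x 0 - g x 0\<bar> \<partial>lborel) + v * t + v * t"
    unfolding gen(2)[OF integrable_abs[OF int] F(1) G(1)] F(2) G(2) by simp
  finally show "(\<integral>x. \<bar>f x t - g x t\<bar> \<partial>lborel) \<le> (\<integral>x. \<bar>f x 0 - g x 0\<bar> \<partial>lborel) + 2 * v * t"
    by (simp add: mult.commute add.commute)
qed

end

section \<open>Dissipation of the \<open>L\<^sub>1\<close> distance\<close>

text \<open>
  The chain rule for \<open>\<bar>w\<bar>\<close>, obtained from the smooth approximations \<open>sqrt(w\<^sup>2 + e)\<close> as \<open>e\<close> tends to 0: their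
  derivatives are dominated by \<open>\<bar>w'\<bar>\<close> and converge to \<open>sgn(w) w'\<close>, also where \<open>w\<close> vanishes.
\<close>
lemma has_integral_sgn_derivative:
  fixes w w' :: "real \<Rightarrow> real"
  assumes "a \<le> b"
    and w: "\<And>s. s \<in> {a..b} \<Longrightarrow> (w has_real_derivative w' s) (at s within {a..b})"
    and w': "continuous_on {a..b} w'"
  shows "((\<lambda>s. sgn (w s) * w' s) has_integral \<bar>w b\<bar> - \<bar>w a\<bar>) {a..b}"
proof -
  have cw: "continuous_on {a..b} w"
    by (rule DERIV_continuous_on[OF w]) auto
  define e where "e = (\<lambda>n::nat. inverse (real (Suc n)))"
  have e: "e n > 0" for n by (simp add: e_def)
  have e0: "e \<longlonglongrightarrow> 0" unfolding e_def by (rule LIMSEQ_inverse_real_of_nat)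
  define p where "p = (\<lambda>n u. sqrt (u\<^sup>2 + e n))"
  have pos: "u\<^sup>2 + e n > 0" for u n
    using e[of n] by (simp add: add_nonneg_pos)
  define q where "q = (\<lambda>n s. w s / p n (w s) * w' s)"
  have hi: "(q n has_integral p n (w b) - p n (w a)) {a..b}" for n
  proof (rule fundamental_theorem_of_calculus[OF \<open>a \<le> b\<close>])
    fix s assume "s \<in> {a..b}"
    have "((\<lambda>s. p n (w s)) has_real_derivative q n s) (at s within {a..b})"
      unfolding p_def q_def using pos[of "w s" n]
      by (auto intro!: derivative_eq_intros w[OF \<open>s \<in> {a..b}\<close>] simp: field_simps)
    then show "((\<lambda>s. p n (w s)) has_vector_derivative q n s) (at s within {a..b})"
      by (simp add: has_real_derivative_iff_has_vector_derivative)
  qed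
  have lim: "(\<lambda>n. p n u) \<longlonglongrightarrow> \<bar>u\<bar>" for u
  proof -
    have "(\<lambda>n. sqrt (u\<^sup>2 + e n)) \<longlonglongrightarrow> sqrt (u\<^sup>2 + 0)"
      by (intro tendsto_intros e0)
    then show ?thesis by (simp add: p_def)
  qed
  have qlim: "(\<lambda>n. q n s) \<longlonglongrightarrow> sgn (w s) * w' s" for s
  proof (cases "w s = 0")
    case False
    then have "(\<lambda>n. w s / p n (w s) * w' s) \<longlonglongrightarrow> w s / \<bar>w s\<bar> * w' s"
      by (intro tendsto_intros lim) auto
    then show ?thesis by (simp add: q_def sgn_real_def abs_real_def split: if_splits)
  qed (simp add: q_def)
  have bound: "norm (q n s) \<le> \<bar>w' s\<bar>" for n s
  proof -
    have "\<bar>w s\<bar> \<le> p n (w s)"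
      unfolding p_def using e[of n] by (intro real_le_rsqrt) auto
    then have "\<bar>w s\<bar> / p n (w s) \<le> 1"
      by (intro divide_le_eq_1_pos[THEN iffD2]) (auto simp: p_def pos)
    moreover have "p n (w s) > 0" by (simp add: p_def pos)
    ultimately have "\<bar>w s\<bar> / p n (w s) * \<bar>w' s\<bar> \<le> 1 * \<bar>w' s\<bar>"
      by (intro mult_right_mono) auto
    with \<open>p n (w s) > 0\<close> show ?thesis by (simp add: q_def abs_mult)
  qed
  have "(\<lambda>s. sgn (w s) * w' s) integrable_on {a..b} \<and>
      (\<lambda>n. integral {a..b} (q n)) \<longlonglongrightarrow> integral {a..b} (\<lambda>s. sgn (w s) * w' s)"
    using dominated_convergence[of q "{a..b}" "\<lambda>s. \<bar>w' s\<bar>" "\<lambda>s. sgn (w s) * w' s"] hi bound qlim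
      integrable_continuous_real[OF continuous_on_rabs[OF w']]
    by (auto simp: integrable_on_def)
  moreover have "(\<lambda>n. integral {a..b} (q n)) \<longlonglongrightarrow> \<bar>w b\<bar> - \<bar>w a\<bar>"
    unfolding integral_unique[OF hi] by (intro tendsto_intros lim)
  ultimately show ?thesis
    using LIMSEQ_unique by (metis has_integral_integral)
qed

context mean_field
begin

definition flux_diff :: "(real \<Rightarrow> real) \<Rightarrow> (real \<Rightarrow> real) \<Rightarrow> real \<Rightarrow> real" where
  "flux_diff f g y = H (f y) - H (g y)"

text \<open>
  The integrand is nonnegative, and it vanishes precisely when the difference at \<open>x - z\<close> does not have the
  sign opposite to that at \<open>x\<close> (for a nonzero difference at \<open>x\<close>).
\<close>
definition sign_defect :: "(real \<Rightarrow> real) \<Rightarrow> (real \<Rightarrow> real) \<Rightarrow> real \<Rightarrow> real" where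
  "sign_defect f g x = (\<integral>z. \<bar>flux_diff f g (x - z)\<bar> - sgn (flux_diff f g x) * flux_diff f g (x - z) \<partial>MJ)"

context
  fixes f g :: "real \<Rightarrow> real"
  assumes f: "distribution_function f" and g: "distribution_function g"
begin

lemma flux_diff_le: "\<bar>flux_diff f g y\<bar> \<le> \<bar>f y - g y\<bar>" and flux_diff_le_1: "\<bar>flux_diff f g y\<bar> \<le> 1"
  and sgn_flux_diff: "sgn (flux_diff f g y) = sgn (f y - g y)"
proof -
  note F = distribution_functionD(2,3)[OF f, of y] and G = distribution_functionD(2,3)[OF g, of y]
  show "\<bar>flux_diff f g y\<bar> \<le> \<bar>f y - g y\<bar>"
    unfolding flux_diff_def using F G by (intro H_dist) auto
  then show "\<bar>flux_diff f g y\<bar> \<le> 1" using F G by auto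
  show "sgn (flux_diff f g y) = sgn (f y - g y)"
    unfolding flux_diff_def using F G H_strict[of "f y" "g y"] H_strict[of "g y" "f y"]
    by (cases "f y" "g y" rule: linorder_cases) auto
qed

lemma flux_diff_measurable [measurable]: "flux_diff f g \<in> borel_measurable borel"
  unfolding flux_diff_def[abs_def] using H_compose_measurable[OF f] H_compose_measurable[OF g] by auto

lemma flux_diff_shift_integrable: "integrable MJ (\<lambda>z. flux_diff f g (x - z))"
  using flux_diff_le_1 by (intro MJ.integrable_const_bound[where B=1]) auto

lemma sign_defect_nonneg: "0 \<le> sign_defect f g x"
  unfolding sign_defect_def
  by (intro integral_nonneg_AE AE_I2) (auto simp: sgn_real_def)

text \<open>
  The right-hand side without the defect integrates to 0 over \<open>x\<close> by translation invariance, so the defect is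
  what remains as the rate of decrease of the \<open>L\<^sub>1\<close> distance. It matters here that \<open>f - g\<close> and \<open>H(f) - H(g)\<close>
  have the same sign, since \<open>H\<close> is strictly increasing.
\<close>
lemma sgn_N_diff:
  "sgn (f x - g x) * (N f x - N g x)
     = \<bar>flux_diff f g x\<bar> - (\<integral>z. \<bar>flux_diff f g (x - z)\<bar> \<partial>MJ) + sign_defect f g x"
proof -
  have "N f x - N g x = (\<integral>z. (H (f x) - H (f (x - z))) - (H (g x) - H (g (x - z))) \<partial>MJ)"
    unfolding N_def using H_shift_integrable[OF f, of x] H_shift_integrable[OF g, of x]
    by (subst Bochner_Integration.integral_diff) auto
  also have "\<dots> = (\<integral>z. flux_diff f g x - flux_diff f g (x - z) \<partial>MJ)"
    by (intro Bochner_Integration.integral_cong) (auto simp: flux_diff_def)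
  also have "\<dots> = flux_diff f g x - (\<integral>z. flux_diff f g (x - z) \<partial>MJ)"
    using flux_diff_shift_integrable[of x] by simp
  finally have 1: "N f x - N g x = flux_diff f g x - (\<integral>z. flux_diff f g (x - z) \<partial>MJ)" .
  have 2: "sign_defect f g x = (\<integral>z. \<bar>flux_diff f g (x - z)\<bar> \<partial>MJ) - sgn (flux_diff f g x) * (\<integral>z. flux_diff f g (x - z) \<partial>MJ)"
    unfolding sign_defect_def using flux_diff_shift_integrable[of x] by simp
  show ?thesis
    unfolding 1 2 sgn_flux_diff[symmetric] by (simp add: algebra_simps abs_sgn)
qed

lemma nn_integral_shift_average:
  "(\<integral>\<^sup>+x. (\<integral>\<^sup>+z. ennreal \<bar>flux_diff f g (x - z)\<bar> \<partial>MJ) \<partial>lborel) = (\<integral>\<^sup>+x. ennreal \<bar>flux_diff f g x\<bar> \<partial>lborel)"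
proof -
  interpret Q: pair_sigma_finite MJ lborel ..
  have "(\<integral>\<^sup>+x. (\<integral>\<^sup>+z. ennreal \<bar>flux_diff f g (x - z)\<bar> \<partial>MJ) \<partial>lborel)
      = (\<integral>\<^sup>+z. (\<integral>\<^sup>+x. ennreal \<bar>flux_diff f g (x - z)\<bar> \<partial>lborel) \<partial>MJ)"
    by (rule Q.Fubini') measurable
  also have "\<dots> = (\<integral>\<^sup>+z. (\<integral>\<^sup>+x. ennreal \<bar>flux_diff f g x\<bar> \<partial>lborel) \<partial>MJ)"
  proof (rule nn_integral_cong)
    fix z
    show "(\<integral>\<^sup>+x. ennreal \<bar>flux_diff f g (x - z)\<bar> \<partial>lborel) = (\<integral>\<^sup>+x. ennreal \<bar>flux_diff f g x\<bar> \<partial>lborel)"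
      using nn_integral_real_affine[of "\<lambda>x. ennreal \<bar>flux_diff f g x\<bar>" 1 "- z"] by simp
  qed
  also have "\<dots> = (\<integral>\<^sup>+x. ennreal \<bar>flux_diff f g x\<bar> \<partial>lborel)"
    using MJ.emeasure_space_1 by simp
  finally show ?thesis .
qed

end

text \<open>
  The balance at one point \<open>x\<close> over \<open>[s, t]\<close>, arranged so that all terms are nonnegative and can be integrated
  over \<open>x\<close> by Tonelli.
\<close>
lemma dissipation_pointwise:
  assumes f: "solution f" and g: "solution g" and t: "0 \<le> s" "s \<le> t"
    and meas: "(\<lambda>r. sign_defect (\<lambda>y. extended f y r) (\<lambda>y. extended g y r) x) \<in> borel_measurable borel"
  defines "A r \<equiv> \<bar>flux_diff (\<lambda>y. extended f y r) (\<lambda>y. extended g y r) x\<bar>"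
    and "B r \<equiv> \<integral>\<^sup>+z. ennreal \<bar>flux_diff (\<lambda>y. extended f y r) (\<lambda>y. extended g y r) (x - z)\<bar> \<partial>MJ"
    and "R r \<equiv> sign_defect (\<lambda>y. extended f y r) (\<lambda>y. extended g y r) x"
  shows "ennreal \<bar>f x t - g x t\<bar> + (\<integral>\<^sup>+r. indicator {s..t} r * ennreal (\<mu> * A r) \<partial>lborel)
       + (\<integral>\<^sup>+r. indicator {s..t} r * ennreal (\<mu> * R r) \<partial>lborel)
     = ennreal \<bar>f x s - g x s\<bar> + (\<integral>\<^sup>+r. indicator {s..t} r * (ennreal \<mu> * B r) \<partial>lborel)"
proof -
  have st: "{s..t} \<subseteq> {0..}" using t by auto
  define b where "b r = (\<integral>z. \<bar>flux_diff (\<lambda>y. extended f y r) (\<lambda>y. extended g y r) (x - z)\<bar> \<partial>MJ)" for r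
  note ef = extended_distribution[OF f] and eg = extended_distribution[OF g]
  have Bb: "B r = ennreal (b r)" for r
    unfolding B_def b_def using flux_diff_shift_integrable[OF ef eg]
    by (intro nn_integral_eq_integral) auto
  have b0: "0 \<le> b r" for r unfolding b_def by simp
  have R0: "0 \<le> R r" for r unfolding R_def by (rule sign_defect_nonneg[OF ef eg])
  have cH: "continuous_on {s..t} (\<lambda>r. H (extended h y r))" if "solution h" for h y
  proof -
    have "continuous_on {s..t} (\<lambda>r. H (h y r))"
      by (rule continuous_on_subset[OF solution_H_continuous[OF that] st])
    then show ?thesis
      by (rule continuous_on_eq) (use t in \<open>auto simp: extended_eq\<close>)
  qed
  have cA: "continuous_on {s..t} A"
    unfolding A_def flux_diff_def by (intro continuous_intros cH f g)
  \<comment> \<open>The time integral of \<open>R\<close> is obtained by subtraction, so only \<open>A\<close> and \<open>b\<close> have to be continuous.\<close>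
  have cb: "continuous_on {s..t} b"
    unfolding continuous_on_sequentially
  proof (intro allI ballI impI, elim conjE)
    fix u :: "nat \<Rightarrow> real" and a assume u: "\<forall>n. u n \<in> {s..t}" "u \<longlonglongrightarrow> a" and a: "a \<in> {s..t}"
    have "(\<lambda>n. \<integral>z. \<bar>flux_diff (\<lambda>y. extended f y (u n)) (\<lambda>y. extended g y (u n)) (x - z)\<bar> \<partial>MJ) \<longlonglongrightarrow> b a"
      unfolding b_def
    proof (rule integral_dominated_convergence[where w="\<lambda>_. 1"])
      show "AE z in MJ. (\<lambda>n. \<bar>flux_diff (\<lambda>y. extended f y (u n)) (\<lambda>y. extended g y (u n)) (x - z)\<bar>)
              \<longlonglongrightarrow> \<bar>flux_diff (\<lambda>y. extended f y a) (\<lambda>y. extended g y a) (x - z)\<bar>"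
      proof (rule AE_I2)
        fix z
        have "continuous_on {s..t} (\<lambda>r. \<bar>flux_diff (\<lambda>y. extended f y r) (\<lambda>y. extended g y r) (x - z)\<bar>)"
          unfolding flux_diff_def by (intro continuous_intros cH f g)
        then show "(\<lambda>n. \<bar>flux_diff (\<lambda>y. extended f y (u n)) (\<lambda>y. extended g y (u n)) (x - z)\<bar>)
              \<longlonglongrightarrow> \<bar>flux_diff (\<lambda>y. extended f y a) (\<lambda>y. extended g y a) (x - z)\<bar>"
          using u a unfolding continuous_on_sequentially comp_def by blast
      qed
      show "AE z in MJ. norm \<bar>flux_diff (\<lambda>y. extended f y (u n)) (\<lambda>y. extended g y (u n)) (x - z)\<bar> \<le> 1" for n
        using flux_diff_le_1[OF ef eg] by simp
      show "(\<lambda>z. \<bar>flux_diff (\<lambda>y. extended f y (u n)) (\<lambda>y. extended g y (u n)) (x - z)\<bar>) \<in> borel_measurable MJ" for n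
        using flux_diff_shift_integrable[OF ef eg] by auto
      show "(\<lambda>z. \<bar>flux_diff (\<lambda>y. extended f y a) (\<lambda>y. extended g y a) (x - z)\<bar>) \<in> borel_measurable MJ"
        using flux_diff_shift_integrable[OF ef eg] by auto
    qed simp
    then show "(b \<circ> u) \<longlonglongrightarrow> b a" by (simp add: b_def comp_def)
  qed
  have "((\<lambda>r. sgn (f x r - g x r) * (- \<mu> * N (\<lambda>y. f y r) x - - \<mu> * N (\<lambda>y. g y r) x))
        has_integral \<bar>f x t - g x t\<bar> - \<bar>f x s - g x s\<bar>) {s..t}"
  proof (rule has_integral_sgn_derivative[OF t(2)])
    fix r assume "r \<in> {s..t}"
    then show "((\<lambda>r. f x r - g x r) has_real_derivative - \<mu> * N (\<lambda>y. f y r) x - - \<mu> * N (\<lambda>y. g y r) x) (at r within {s..t})"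
      using t by (intro DERIV_diff DERIV_subset[OF solutionD(2)[OF f] st] DERIV_subset[OF solutionD(2)[OF g] st]) auto
  next
    show "continuous_on {s..t} (\<lambda>r. - \<mu> * N (\<lambda>y. f y r) x - - \<mu> * N (\<lambda>y. g y r) x)"
      by (intro continuous_intros continuous_on_subset[OF solution_N_continuous[OF f] st]
          continuous_on_subset[OF solution_N_continuous[OF g] st])
  qed
  moreover have "sgn (f x r - g x r) * (- \<mu> * N (\<lambda>y. f y r) x - - \<mu> * N (\<lambda>y. g y r) x) = \<mu> * b r - \<mu> * A r - \<mu> * R r"
    if "r \<in> {s..t}" for r
  proof -
    have r: "extended f y r = f y r" "extended g y r = g y r" for y
      using that t by (auto simp: extended_eq)
    have "sgn (f x r - g x r) * (- \<mu> * N (\<lambda>y. f y r) x - - \<mu> * N (\<lambda>y. g y r) x)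
        = - \<mu> * (sgn (f x r - g x r) * (N (\<lambda>y. f y r) x - N (\<lambda>y. g y r) x))"
      by (simp add: algebra_simps)
    also have "\<dots> = - \<mu> * (A r - b r + R r)"
      using sgn_N_diff[OF ef[of r] eg[of r], of x] by (simp add: A_def b_def R_def r)
    finally show ?thesis by (simp add: algebra_simps)
  qed
  ultimately have hi: "((\<lambda>r. \<mu> * b r - \<mu> * A r - \<mu> * R r) has_integral \<bar>f x t - g x t\<bar> - \<bar>f x s - g x s\<bar>) {s..t}"
    by (rule has_integral_eq[rotated]) 
  define Ia where "Ia = integral {s..t} (\<lambda>r. \<mu> * A r)"
  define Ib where "Ib = integral {s..t} (\<lambda>r. \<mu> * b r)"
  have ha: "((\<lambda>r. \<mu> * A r) has_integral Ia) {s..t}"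
    unfolding Ia_def by (intro integrable_integral integrable_continuous_real continuous_intros cA)
  have hb: "((\<lambda>r. \<mu> * b r) has_integral Ib) {s..t}"
    unfolding Ib_def by (intro integrable_integral integrable_continuous_real continuous_intros cb)
  define Ir where "Ir = Ib - Ia - (\<bar>f x t - g x t\<bar> - \<bar>f x s - g x s\<bar>)"
  have "((\<lambda>r. (\<mu> * b r - \<mu> * A r) - (\<mu> * b r - \<mu> * A r - \<mu> * R r)) has_integral Ir) {s..t}"
    unfolding Ir_def by (intro has_integral_diff ha hb hi)
  then have hr: "((\<lambda>r. \<mu> * R r) has_integral Ir) {s..t}"
    by simp
  have nA: "(\<integral>\<^sup>+r. indicator {s..t} r * ennreal (\<mu> * A r) \<partial>lborel) = ennreal Ia"
    using nn_integral_Icc_has_integral[OF continuous_on_mult_left[OF cA] _ ha] mu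
    by (simp add: ennreal_mult' ennreal_indicator[symmetric] A_def)
  have nb: "(\<integral>\<^sup>+r. indicator {s..t} r * ennreal (\<mu> * b r) \<partial>lborel) = ennreal Ib"
    using nn_integral_Icc_has_integral[OF continuous_on_mult_left[OF cb] _ hb] mu b0
    by (simp add: ennreal_mult' ennreal_indicator[symmetric])
  have "((\<lambda>r. if r \<in> {s..t} then \<mu> * R r else 0) has_integral Ir) UNIV"
    using hr by (simp only: has_integral_restrict_UNIV)
  then have "((\<lambda>r. indicator {s..t} r * (\<mu> * R r)) has_integral Ir) UNIV"
    by (rule has_integral_eq[rotated]) (auto simp: indicator_def)
  then have "(\<integral>\<^sup>+r. ennreal (indicator {s..t} r * (\<mu> * R r)) \<partial>lborel) = ennreal Ir"
    using meas mu R0 unfolding R_def[symmetric]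
    by (intro nn_integral_has_integral_lborel) auto
  then have nr: "(\<integral>\<^sup>+r. indicator {s..t} r * ennreal (\<mu> * R r) \<partial>lborel) = ennreal Ir"
    by (simp add: ennreal_mult' ennreal_indicator[symmetric])
  have I0: "0 \<le> Ia" "0 \<le> Ib" "0 \<le> Ir"
    using has_integral_nonneg[OF ha] has_integral_nonneg[OF hb] has_integral_nonneg[OF hr] mu b0 R0
    by (auto simp: A_def)
  have "\<bar>f x t - g x t\<bar> + Ia + Ir = \<bar>f x s - g x s\<bar> + Ib"
    by (simp add: Ir_def)
  then have "ennreal (\<bar>f x t - g x t\<bar> + Ia + Ir) = ennreal (\<bar>f x s - g x s\<bar> + Ib)"
    by simp
  moreover have "ennreal \<mu> * B r = ennreal (\<mu> * b r)" for r
    using mu b0[of r] by (simp add: Bb ennreal_mult)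
  ultimately show ?thesis
    using I0 by (simp add: nA nr nb)
qed

lemma solution_flux_diff_measurable:
  assumes f: "solution f" and g: "solution g"
  shows "(\<lambda>p. flux_diff (\<lambda>y. extended f y (snd p)) (\<lambda>y. extended g y (snd p)) (fst p)) \<in> borel_measurable (borel \<Otimes>\<^sub>M borel)"
    "(\<lambda>q. flux_diff (\<lambda>y. extended f y (snd (fst q))) (\<lambda>y. extended g y (snd (fst q))) (fst (fst q) - snd q))
        \<in> borel_measurable ((borel \<Otimes>\<^sub>M borel) \<Otimes>\<^sub>M MJ)"
    "(\<lambda>p. sign_defect (\<lambda>y. extended f y (snd p)) (\<lambda>y. extended g y (snd p)) (fst p)) \<in> borel_measurable (borel \<Otimes>\<^sub>M borel)"
    "(\<lambda>p. \<integral>\<^sup>+z. ennreal \<bar>flux_diff (\<lambda>y. extended f y (snd p)) (\<lambda>y. extended g y (snd p)) (fst p - z)\<bar> \<partial>MJ) \<in> borel_measurable (borel \<Otimes>\<^sub>M borel)"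
proof -
  show 1: "(\<lambda>p. flux_diff (\<lambda>y. extended f y (snd p)) (\<lambda>y. extended g y (snd p)) (fst p)) \<in> borel_measurable (borel \<Otimes>\<^sub>M borel)"
    unfolding flux_diff_def using solution_H_measurable[OF f] solution_H_measurable[OF g] by auto
  have m: "(\<lambda>q. (fst (fst q) - snd q, snd (fst q))) \<in> (borel \<Otimes>\<^sub>M borel) \<Otimes>\<^sub>M MJ \<rightarrow>\<^sub>M (borel \<Otimes>\<^sub>M borel :: (real \<times> real) measure)"
    by measurable
  show 2: "(\<lambda>q. flux_diff (\<lambda>y. extended f y (snd (fst q))) (\<lambda>y. extended g y (snd (fst q))) (fst (fst q) - snd q))
        \<in> borel_measurable ((borel \<Otimes>\<^sub>M borel) \<Otimes>\<^sub>M MJ)"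
    using measurable_compose[OF m 1] by simp
  have 3: "(\<lambda>q. flux_diff (\<lambda>y. extended f y (snd (fst q))) (\<lambda>y. extended g y (snd (fst q))) (fst (fst q)))
        \<in> borel_measurable ((borel \<Otimes>\<^sub>M borel) \<Otimes>\<^sub>M MJ)"
    by (rule measurable_compose[OF measurable_fst 1])
  have [measurable]: "(sgn :: real \<Rightarrow> real) \<in> borel_measurable borel"
    by (rule borel_measurable_sgn) 
  show "(\<lambda>p. sign_defect (\<lambda>y. extended f y (snd p)) (\<lambda>y. extended g y (snd p)) (fst p)) \<in> borel_measurable (borel \<Otimes>\<^sub>M borel)"
    unfolding sign_defect_def
    by (rule MJ.borel_measurable_lebesgue_integral)
       (use 2 3 in \<open>simp add: case_prod_beta'\<close>)
  show "(\<lambda>p. \<integral>\<^sup>+z. ennreal \<bar>flux_diff (\<lambda>y. extended f y (snd p)) (\<lambda>y. extended g y (snd p)) (fst p - z)\<bar> \<partial>MJ) \<in> borel_measurable (borel \<Otimes>\<^sub>M borel)"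
    by (rule MJ.borel_measurable_nn_integral)
       (use 2 in \<open>simp add: case_prod_beta'\<close>)
qed

text \<open>
  Integrate the pointwise balance over \<open>x\<close>. The two averaged terms have equal integrals by translation
  invariance and cancel; they are finite since the distance grows at most linearly.
\<close>
lemma dissipation:
  assumes f: "solution f" and g: "solution g" and t: "0 \<le> s" "s \<le> t"
    and int: "integrable lborel (\<lambda>x. f x 0 - g x 0)"
  shows "(\<integral>\<^sup>+x. ennreal \<bar>f x t - g x t\<bar> \<partial>lborel)
       + (\<integral>\<^sup>+r. indicator {s..t} r * (\<integral>\<^sup>+x. ennreal (\<mu> * sign_defect (\<lambda>y. extended f y r) (\<lambda>y. extended g y r) x) \<partial>lborel) \<partial>lborel)
     = (\<integral>\<^sup>+x. ennreal \<bar>f x s - g x s\<bar> \<partial>lborel)"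
proof -
  define D where "D r = flux_diff (\<lambda>y. extended f y r) (\<lambda>y. extended g y r)" for r
  define R where "R r = sign_defect (\<lambda>y. extended f y r) (\<lambda>y. extended g y r)" for r
  note ef = extended_distribution[OF f] and eg = extended_distribution[OF g]
  note M = solution_flux_diff_measurable[OF f g, folded D_def R_def]
  have [measurable]: "(\<lambda>p. D (snd p) (fst p)) \<in> borel_measurable (borel \<Otimes>\<^sub>M borel)"
    "(\<lambda>p. R (snd p) (fst p)) \<in> borel_measurable (borel \<Otimes>\<^sub>M borel)"
    "(\<lambda>p. \<integral>\<^sup>+z. ennreal \<bar>D (snd p) (fst p - z)\<bar> \<partial>MJ) \<in> borel_measurable (borel \<Otimes>\<^sub>M borel)"
    using M by auto
  have [measurable]: "(\<lambda>x. f x s) \<in> borel_measurable borel" "(\<lambda>x. f x t) \<in> borel_measurable borel"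
      "(\<lambda>x. g x s) \<in> borel_measurable borel" "(\<lambda>x. g x t) \<in> borel_measurable borel"
    using distribution_function_measurable[OF solutionD(1)[OF f]]
      distribution_function_measurable[OF solutionD(1)[OF g]] t by auto
  have Rr [measurable]: "(\<lambda>r. R r x) \<in> borel_measurable borel" for x
    using measurable_compose[of "\<lambda>r. (x, r)" borel "borel \<Otimes>\<^sub>M borel" "\<lambda>p. R (snd p) (fst p)" borel]
    by simp
  let ?A = "\<lambda>x. \<integral>\<^sup>+r. indicator {s..t} r * ennreal (\<mu> * \<bar>D r x\<bar>) \<partial>lborel"
  let ?R = "\<lambda>x. \<integral>\<^sup>+r. indicator {s..t} r * ennreal (\<mu> * R r x) \<partial>lborel"
  let ?B = "\<lambda>x. \<integral>\<^sup>+r. indicator {s..t} r * (ennreal \<mu> * (\<integral>\<^sup>+z. ennreal \<bar>D r (x - z)\<bar> \<partial>MJ)) \<partial>lborel"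
  have meas: "?A \<in> borel_measurable lborel" "?R \<in> borel_measurable lborel" "?B \<in> borel_measurable lborel"
    by (rule lborel.borel_measurable_nn_integral; measurable)+
  have pw: "ennreal \<bar>f x t - g x t\<bar> + ?A x + ?R x = ennreal \<bar>f x s - g x s\<bar> + ?B x" for x
    using dissipation_pointwise[OF f g t, of x] Rr[of x] by (simp add: D_def R_def)
  have eqA: "(\<integral>\<^sup>+x. ?A x \<partial>lborel) = (\<integral>\<^sup>+r. indicator {s..t} r * (ennreal \<mu> * (\<integral>\<^sup>+x. ennreal \<bar>D r x\<bar> \<partial>lborel)) \<partial>lborel)"
  proof -
    have "(\<integral>\<^sup>+x. ?A x \<partial>lborel) = (\<integral>\<^sup>+r. (\<integral>\<^sup>+x. indicator {s..t} r * ennreal (\<mu> * \<bar>D r x\<bar>) \<partial>lborel) \<partial>lborel)"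
      by (rule lborel_pair.Fubini'[symmetric]) (simp add: case_prod_beta')
    also have "\<dots> = (\<integral>\<^sup>+r. indicator {s..t} r * (ennreal \<mu> * (\<integral>\<^sup>+x. ennreal \<bar>D r x\<bar> \<partial>lborel)) \<partial>lborel)"
      using mu flux_diff_measurable[OF ef eg] by (intro nn_integral_cong) (simp add: ennreal_mult nn_integral_cmult D_def)
    finally show ?thesis .
  qed
  have eqR: "(\<integral>\<^sup>+x. ?R x \<partial>lborel) = (\<integral>\<^sup>+r. indicator {s..t} r * (\<integral>\<^sup>+x. ennreal (\<mu> * R r x) \<partial>lborel) \<partial>lborel)"
  proof -
    have Rx: "R r \<in> borel_measurable borel" for r
      using measurable_compose[of "\<lambda>x. (x, r)" borel "borel \<Otimes>\<^sub>M borel" "\<lambda>p. R (snd p) (fst p)" borel]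
      by simp
    have "(\<integral>\<^sup>+x. ?R x \<partial>lborel) = (\<integral>\<^sup>+r. (\<integral>\<^sup>+x. indicator {s..t} r * ennreal (\<mu> * R r x) \<partial>lborel) \<partial>lborel)"
      by (rule lborel_pair.Fubini'[symmetric]) (simp add: case_prod_beta')
    also have "\<dots> = (\<integral>\<^sup>+r. indicator {s..t} r * (\<integral>\<^sup>+x. ennreal (\<mu> * R r x) \<partial>lborel) \<partial>lborel)"
      using Rx by (intro nn_integral_cong) (simp add: nn_integral_cmult)
    finally show ?thesis .
  qed
  have eqB: "(\<integral>\<^sup>+x. ?B x \<partial>lborel) = (\<integral>\<^sup>+r. indicator {s..t} r * (ennreal \<mu> * (\<integral>\<^sup>+x. ennreal \<bar>D r x\<bar> \<partial>lborel)) \<partial>lborel)"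
  proof -
    have Bx: "(\<lambda>x. \<integral>\<^sup>+z. ennreal \<bar>D r (x - z)\<bar> \<partial>MJ) \<in> borel_measurable borel" for r
      using measurable_compose[of "\<lambda>x. (x, r)" borel "borel \<Otimes>\<^sub>M borel" "\<lambda>p. \<integral>\<^sup>+z. ennreal \<bar>D (snd p) (fst p - z)\<bar> \<partial>MJ" borel]
      by simp
    have "(\<integral>\<^sup>+x. ?B x \<partial>lborel) = (\<integral>\<^sup>+r. (\<integral>\<^sup>+x. indicator {s..t} r * (ennreal \<mu> * (\<integral>\<^sup>+z. ennreal \<bar>D r (x - z)\<bar> \<partial>MJ)) \<partial>lborel) \<partial>lborel)"
      by (rule lborel_pair.Fubini'[symmetric]) (simp add: case_prod_beta')
    also have "\<dots> = (\<integral>\<^sup>+r. indicator {s..t} r * (ennreal \<mu> * (\<integral>\<^sup>+x. ennreal \<bar>D r x\<bar> \<partial>lborel)) \<partial>lborel)"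
    proof (rule nn_integral_cong)
      fix r
      have "(\<integral>\<^sup>+x. indicator {s..t} r * (ennreal \<mu> * (\<integral>\<^sup>+z. ennreal \<bar>D r (x - z)\<bar> \<partial>MJ)) \<partial>lborel)
          = indicator {s..t} r * (ennreal \<mu> * (\<integral>\<^sup>+x. (\<integral>\<^sup>+z. ennreal \<bar>D r (x - z)\<bar> \<partial>MJ) \<partial>lborel))"
        using Bx by (simp add: nn_integral_cmult)
      then show "(\<integral>\<^sup>+x. indicator {s..t} r * (ennreal \<mu> * (\<integral>\<^sup>+z. ennreal \<bar>D r (x - z)\<bar> \<partial>MJ)) \<partial>lborel)
          = indicator {s..t} r * (ennreal \<mu> * (\<integral>\<^sup>+x. ennreal \<bar>D r x\<bar> \<partial>lborel))"
        unfolding D_def nn_integral_shift_average[OF ef eg] .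
    qed
    finally show ?thesis .
  qed
  define C where "C = (\<integral>x. \<bar>f x 0 - g x 0\<bar> \<partial>lborel) + 2 * v * t"
  have C0: "0 \<le> C" using v_pos t by (auto simp: C_def)
  have fin: "(\<integral>\<^sup>+x. ?A x \<partial>lborel) < \<infinity>"
  proof -
    have "(\<integral>\<^sup>+x. ?A x \<partial>lborel) \<le> (\<integral>\<^sup>+r. ennreal (\<mu> * C) * indicator {s..t} r \<partial>lborel)"
      unfolding eqA
    proof (rule nn_integral_mono)
      fix r
      have "(\<integral>\<^sup>+x. ennreal \<bar>D r x\<bar> \<partial>lborel) \<le> ennreal C" if r: "r \<in> {s..t}"
      proof -
        have r0: "0 \<le> r" using r t by auto
        have "(\<integral>\<^sup>+x. ennreal \<bar>D r x\<bar> \<partial>lborel) \<le> (\<integral>\<^sup>+x. ennreal \<bar>f x r - g x r\<bar> \<partial>lborel)"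
          using flux_diff_le[OF ef[of r] eg[of r]] r0
          by (intro nn_integral_mono ennreal_leI) (simp add: D_def extended_eq)
        also have "\<dots> = ennreal (\<integral>x. \<bar>f x r - g x r\<bar> \<partial>lborel)"
          by (rule nn_integral_eq_integral) (auto intro!: integrable_abs solution_difference_integral(1) f g r0 int)
        also have "\<dots> \<le> ennreal C"
          using solution_difference_integral(3)[OF f g r0 int] r v_pos
          by (intro ennreal_leI) (auto simp: C_def intro: order_trans mult_left_mono)
        finally show ?thesis .
      qed
      then show "indicator {s..t} r * (ennreal \<mu> * (\<integral>\<^sup>+x. ennreal \<bar>D r x\<bar> \<partial>lborel)) \<le> ennreal (\<mu> * C) * indicator {s..t} r"
        using mu C0 by (auto simp: ennreal_mult intro!: mult_left_mono split: split_indicator)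
    qed
    also have "\<dots> < \<infinity>"
      using mu C0 t by (simp add: nn_integral_cmult_indicator ennreal_mult_less_top)
    finally show ?thesis .
  qed
  have "(\<integral>\<^sup>+x. ennreal \<bar>f x t - g x t\<bar> \<partial>lborel) + (\<integral>\<^sup>+x. ?A x \<partial>lborel) + (\<integral>\<^sup>+x. ?R x \<partial>lborel)
      = (\<integral>\<^sup>+x. ennreal \<bar>f x t - g x t\<bar> + ?A x + ?R x \<partial>lborel)"
    using meas by (subst nn_integral_add; (subst nn_integral_add)?) simp_all
  also have "\<dots> = (\<integral>\<^sup>+x. ennreal \<bar>f x s - g x s\<bar> \<partial>lborel) + (\<integral>\<^sup>+x. ?B x \<partial>lborel)"
    unfolding pw using meas by (subst nn_integral_add) simp_all
  also have "(\<integral>\<^sup>+x. ?B x \<partial>lborel) = (\<integral>\<^sup>+x. ?A x \<partial>lborel)"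
    by (simp only: eqA eqB)
  finally have "(\<integral>\<^sup>+x. ?A x \<partial>lborel) + ((\<integral>\<^sup>+x. ennreal \<bar>f x t - g x t\<bar> \<partial>lborel) + (\<integral>\<^sup>+x. ?R x \<partial>lborel))
      = (\<integral>\<^sup>+x. ?A x \<partial>lborel) + (\<integral>\<^sup>+x. ennreal \<bar>f x s - g x s\<bar> \<partial>lborel)"
    by (simp only: ac_simps)
  then have "(\<integral>\<^sup>+x. ennreal \<bar>f x t - g x t\<bar> \<partial>lborel) + (\<integral>\<^sup>+x. ?R x \<partial>lborel)
      = (\<integral>\<^sup>+x. ennreal \<bar>f x s - g x s\<bar> \<partial>lborel)"
    using fin by (simp only: ennreal_add_left_cancel) auto
  then show ?thesis unfolding eqR unfolding R_def .
qed

end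

section \<open>The mean as an area\<close>

text \<open>
  By Fubini, the positive and the negative part of the mean are the areas between the graph of \<open>\<gamma>\<close> and the
  unit step, to the right and to the left of 0. Thus the integral of the difference of two
  distribution functions is a difference of means.
\<close>
lemma
  assumes \<gamma>: "distribution_function \<gamma>"
  shows finite_mean_iff_integrable: "finite_mean \<gamma> \<longleftrightarrow> integrable lborel (\<lambda>x. indicator {0..} x - \<gamma> x)"
    and mean_eq_integral: "finite_mean \<gamma> \<Longrightarrow> mean \<gamma> = (\<integral>x. indicator {0..} x - \<gamma> x \<partial>lborel)"
proof -
  note D = distribution_functionD[OF \<gamma>]
  define M where "M = interval_measure \<gamma>"
  interpret M: real_distribution M
    unfolding M_def by (rule real_distribution_distribution_function[OF \<gamma>])
  interpret P: pair_sigma_finite M lborel ..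
  have [measurable]: "\<gamma> \<in> borel_measurable borel"
    by (rule distribution_function_measurable[OF \<gamma>])
  have Iic: "emeasure M {..x} = ennreal (\<gamma> x)" for x
    unfolding M_def using D by (intro emeasure_interval_measure_Iic) auto
  have Ioi: "emeasure M {x<..} = ennreal (1 - \<gamma> x)" for x
  proof -
    have "{x<..} = space M - {..x}" by auto
    then show ?thesis
      using M.prob_compl[of "{..x}"] Iic[of x] D(2)[of x] by (simp add: M.emeasure_eq_measure)
  qed
  have pos: "(\<integral>\<^sup>+y. ennreal y \<partial>M) = (\<integral>\<^sup>+x. ennreal (indicator {0..} x - \<gamma> x) \<partial>lborel)"
  proof -
    have "(\<integral>\<^sup>+y. ennreal y \<partial>M) = (\<integral>\<^sup>+y. (\<integral>\<^sup>+x. (if 0 \<le> x \<and> x < y then 1 else 0) \<partial>lborel) \<partial>M)"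
    proof (rule nn_integral_cong)
      fix y :: real
      have "(\<integral>\<^sup>+x. (if 0 \<le> x \<and> x < y then 1 else 0) \<partial>lborel) = (\<integral>\<^sup>+x. indicator {0..<y} x \<partial>lborel)"
        by (intro nn_integral_cong) (auto simp: indicator_def)
      then show "ennreal y = (\<integral>\<^sup>+x. (if 0 \<le> x \<and> x < y then 1 else 0) \<partial>lborel)"
        by (cases "0 \<le> y") (auto simp: ennreal_neg)
    qed
    also have "\<dots> = (\<integral>\<^sup>+x. (\<integral>\<^sup>+y. (if 0 \<le> x \<and> x < y then 1 else 0) \<partial>M) \<partial>lborel)"
      by (rule P.Fubini'[symmetric]) measurable
    also have "\<dots> = (\<integral>\<^sup>+x. ennreal (indicator {0..} x - \<gamma> x) \<partial>lborel)"
    proof (rule nn_integral_cong)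
      fix x :: real
      show "(\<integral>\<^sup>+y. (if 0 \<le> x \<and> x < y then 1 else 0) \<partial>M) = ennreal (indicator {0..} x - \<gamma> x)"
      proof (cases "0 \<le> x")
        case True
        then have "(\<integral>\<^sup>+y. (if 0 \<le> x \<and> x < y then 1 else 0) \<partial>M) = (\<integral>\<^sup>+y. indicator {x<..} y \<partial>M)"
          by (intro nn_integral_cong) (auto simp: indicator_def)
        then show ?thesis using True by (simp add: Ioi)
      next
        case False
        then show ?thesis using D(2)[of x] by (simp add: ennreal_neg)
      qed
    qed
    finally show ?thesis .
  qed
  have neg: "(\<integral>\<^sup>+y. ennreal (- y) \<partial>M) = (\<integral>\<^sup>+x. ennreal (- (indicator {0..} x - \<gamma> x)) \<partial>lborel)"
  proof -
    have "(\<integral>\<^sup>+y. ennreal (- y) \<partial>M) = (\<integral>\<^sup>+y. (\<integral>\<^sup>+x. (if x < 0 \<and> y \<le> x then 1 else 0) \<partial>lborel) \<partial>M)"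
    proof (rule nn_integral_cong)
      fix y :: real
      have "(\<integral>\<^sup>+x. (if x < 0 \<and> y \<le> x then 1 else 0) \<partial>lborel) = (\<integral>\<^sup>+x. indicator {y..<0} x \<partial>lborel)"
        by (intro nn_integral_cong) (auto simp: indicator_def)
      then show "ennreal (- y) = (\<integral>\<^sup>+x. (if x < 0 \<and> y \<le> x then 1 else 0) \<partial>lborel)"
        by (cases "y \<le> 0") (auto simp: ennreal_neg)
    qed
    also have "\<dots> = (\<integral>\<^sup>+x. (\<integral>\<^sup>+y. (if x < 0 \<and> y \<le> x then 1 else 0) \<partial>M) \<partial>lborel)"
      by (rule P.Fubini'[symmetric]) measurable
    also have "\<dots> = (\<integral>\<^sup>+x. ennreal (- (indicator {0..} x - \<gamma> x)) \<partial>lborel)"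
    proof (rule nn_integral_cong)
      fix x :: real
      show "(\<integral>\<^sup>+y. (if x < 0 \<and> y \<le> x then 1 else 0) \<partial>M) = ennreal (- (indicator {0..} x - \<gamma> x))"
      proof (cases "x < 0")
        case True
        then have "(\<integral>\<^sup>+y. (if x < 0 \<and> y \<le> x then 1 else 0) \<partial>M) = (\<integral>\<^sup>+y. indicator {..x} y \<partial>M)"
          by (intro nn_integral_cong) (auto simp: indicator_def)
        then show ?thesis using True by (simp add: Iic)
      next
        case False
        then show ?thesis using D(3)[of x] by (simp add: ennreal_neg)
      qed
    qed
    finally show ?thesis .
  qed
  show *: "finite_mean \<gamma> \<longleftrightarrow> integrable lborel (\<lambda>x. indicator {0..} x - \<gamma> x)"
    unfolding finite_mean_def M_def[symmetric] real_integrable_def pos neg by auto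
  show "mean \<gamma> = (\<integral>x. indicator {0..} x - \<gamma> x \<partial>lborel)" if fm: "finite_mean \<gamma>"
  proof -
    have "integrable M (\<lambda>y. y)" using fm by (simp add: finite_mean_def M_def)
    from real_lebesgue_integral_def[OF this] real_lebesgue_integral_def[OF *[THEN iffD1, OF fm]]
    show ?thesis by (simp add: mean_def M_def[symmetric] pos neg del: minus_diff_eq)
  qed
qed

lemma mean_shift:
  assumes \<gamma>: "distribution_function \<gamma>" and fm: "finite_mean \<gamma>"
  shows "mean (\<lambda>x. \<gamma> (x - c)) = mean \<gamma> + c"
proof -
  note D = distribution_functionD[OF \<gamma>]
  note S = distribution_functionD[OF distribution_function_shift[OF \<gamma>, of c]]
  interpret M: real_distribution "interval_measure \<gamma>"
    by (rule real_distribution_distribution_function[OF \<gamma>])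
  have eq: "distr (interval_measure \<gamma>) borel (\<lambda>x. x + c) = interval_measure (\<lambda>x. \<gamma> (x - c))"
  proof (rule interval_measure_eqI)
    fix a b :: real assume "a \<le> b"
    have "(\<lambda>x. x + c) -` {a<..b} = {a - c<..b - c}" by auto
    then show "emeasure (distr (interval_measure \<gamma>) borel (\<lambda>x. x + c)) {a<..b} = ennreal (\<gamma> (b - c) - \<gamma> (a - c))"
      using \<open>a \<le> b\<close> D(1,4) by (subst emeasure_distr) (auto simp: emeasure_interval_measure_Ioc mono_def)
  qed (auto intro: S)
  have "mean (\<lambda>x. \<gamma> (x - c)) = (\<integral>x. x + c \<partial>interval_measure \<gamma>)"
    unfolding mean_def eq[symmetric] by (subst integral_distr) auto
  also have "\<dots> = mean \<gamma> + c"
    using fm M.prob_space by (simp add: mean_def finite_mean_def)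
  finally show ?thesis .
qed

section \<open>The wave profile equation\<close>

context mean_field
begin

lemma speed_eq: "speed \<mu> \<eta> J = v"
proof -
  have "moment J 1 = (\<integral>y. indicator {0..} y *\<^sub>R y \<partial>MJ)"
    by (simp add: moment_def set_lebesgue_integral_def MJ_def)
  also have "\<dots> = m1"
    unfolding m1_def
  proof (rule integral_cong_AE)
    show "AE y in MJ. indicator {0..} y *\<^sub>R y = y"
      using AE_MJ_pos by eventually_elim auto
  qed auto
  finally show ?thesis by (simp add: speed_def v_def H1_def H_def)
qed

definition profile :: "(real \<Rightarrow> real) \<Rightarrow> bool" where
  "profile \<phi> \<longleftrightarrow> distribution_function \<phi> \<and>
     (\<forall>x. (\<phi> has_real_derivative N \<phi> x / (m1 * H1)) (at x))"

lemma profileD: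
  assumes "profile \<phi>"
  shows "distribution_function \<phi>" "(\<phi> has_real_derivative N \<phi> x / (m1 * H1)) (at x)"
    "continuous_on UNIV \<phi>"
proof -
  show d: "distribution_function \<phi>" "(\<phi> has_real_derivative N \<phi> x / (m1 * H1)) (at x)" for x
    using assms by (auto simp: profile_def)
  show "continuous_on UNIV \<phi>"
    using d(2) DERIV_isCont by (auto simp: continuous_on_eq_continuous_at)
qed

lemma profile_shift: assumes "profile \<phi>" shows "profile (\<lambda>x. \<phi> (x - c))"
  unfolding profile_def
proof (intro conjI allI)
  show "distribution_function (\<lambda>x. \<phi> (x - c))"
    by (rule distribution_function_shift[OF profileD(1)[OF assms]])
  fix x
  have "((\<lambda>x. \<phi> (x - c)) has_real_derivative N \<phi> (x - c) / (m1 * H1) * 1) (at x)"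
    by (rule DERIV_chain2[OF profileD(2)[OF assms]]) (auto intro!: derivative_eq_intros)
  then show "((\<lambda>x. \<phi> (x - c)) has_real_derivative N (\<lambda>x. \<phi> (x - c)) x / (m1 * H1)) (at x)"
    by (simp add: N_shift)
qed

lemma profile_solution:
  assumes "profile \<phi>" shows "solution (\<lambda>x t. \<phi> (x - v * t))"
  unfolding solution_def
proof (intro conjI allI impI)
  fix t :: real
  show "distribution_function (\<lambda>x. \<phi> (x - v * t))"
    by (rule distribution_function_shift[OF profileD(1)[OF assms]])
  fix x
  have "((\<lambda>t. \<phi> (x - v * t)) has_real_derivative N \<phi> (x - v * t) / (m1 * H1) * (- v)) (at t within {0..})"
    by (rule DERIV_chain2[OF profileD(2)[OF assms]]) (auto intro!: derivative_eq_intros)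
  moreover have "N \<phi> (x - v * t) / (m1 * H1) * (- v) = - \<mu> * N (\<lambda>y. \<phi> (y - v * t)) x"
    using m1_pos H1_pos by (simp add: N_shift v_def)
  ultimately show "((\<lambda>t. \<phi> (x - v * t)) has_real_derivative - \<mu> * N (\<lambda>y. \<phi> (y - v * t)) x) (at t within {0..})"
    by simp
qed

text \<open>
  Solving the equation of a travelling solution for the spatial derivative: near time 1 and for the point
  \<open>x + v\<close>, the map \<open>t \<mapsto> x + v - v t\<close> passes through \<open>x\<close>. An interior time is used to have a two-sided
  derivative.
\<close>
lemma traveling_wave_shape_iff_profile: "traveling_wave_shape \<mu> \<eta> J \<phi> \<longleftrightarrow> profile \<phi>"
proof
  assume "profile \<phi>"
  then show "traveling_wave_shape \<mu> \<eta> J \<phi>"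
    using profile_solution profileD(1)
    by (auto simp: traveling_wave_shape_def speed_eq mean_field_model_iff_solution)
next
  assume "traveling_wave_shape \<mu> \<eta> J \<phi>"
  then have d: "distribution_function \<phi>" and s: "solution (\<lambda>x t. \<phi> (x - v * t))"
    by (auto simp: traveling_wave_shape_def speed_eq mean_field_model_iff_solution)
  have "(\<phi> has_real_derivative N \<phi> x / (m1 * H1)) (at x)" for x
  proof -
    have "((\<lambda>t. \<phi> (x + v - v * t)) has_real_derivative - \<mu> * N (\<lambda>y. \<phi> (y - v * 1)) (x + v)) (at 1 within {0..})"
      using solutionD(2)[OF s, of 1 "x + v"] by simp
    moreover have "at (1::real) within {0..} = at 1"
      by (rule at_within_interior) auto
    ultimately have "((\<lambda>t. \<phi> (x + v - v * t)) has_real_derivative - \<mu> * N \<phi> x) (at ((x + v - x) / v))"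
      using v_pos N_shift[of \<phi> v "x + v"] by simp
    moreover have "((\<lambda>y. (x + v - y) / v) has_real_derivative - 1 / v) (at x)"
      using v_pos by (auto intro!: derivative_eq_intros)
    ultimately have "((\<lambda>y. \<phi> (x + v - v * ((x + v - y) / v))) has_real_derivative - \<mu> * N \<phi> x * (- 1 / v)) (at x)"
      by (rule DERIV_chain2[where f="\<lambda>t. \<phi> (x + v - v * t)" and g="\<lambda>y. (x + v - y) / v"])
    moreover have "(\<lambda>y. \<phi> (x + v - v * ((x + v - y) / v))) = \<phi>"
      using v_pos by (auto simp: fun_eq_iff)
    moreover have "- \<mu> * N \<phi> x * (- 1 / v) = N \<phi> x / (m1 * H1)"
      using mu by (simp add: v_def)
    ultimately show ?thesis by simp
  qed
  with d show "profile \<phi>" by (simp add: profile_def)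
qed

section \<open>The fixed-point form of the profile equation\<close>

text \<open>
  The stationary excess (equilibrium) distribution of the renewal process with steps of law \<open>J\<close>. It appears
  because integrating \<open>G(y) - G(y - w)\<close> over \<open>y \<le> x\<close> and averaging over the jump length \<open>w\<close> weights
  \<open>G(x - z)\<close> by the probability that \<open>w > z\<close>.
\<close>
definition excess :: "real measure" where
  "excess = density lborel (\<lambda>z. ennreal (indicator {0..} z * (1 - J z) / m1))"

lemma sets_excess [simp, measurable_cong]: "sets excess = sets borel" and space_excess [simp]: "space excess = UNIV"
  by (auto simp: excess_def)

lemma J_measurable [measurable]: "J \<in> borel_measurable borel"
  by (rule distribution_function_measurable[OF J])

lemma nn_integral_excess:
  assumes [measurable]: "g \<in> borel_measurable borel"
  shows "(\<integral>\<^sup>+z. g z \<partial>excess) = (\<integral>\<^sup>+w. (\<integral>\<^sup>+z. indicator {0..<w} z * g z \<partial>lborel) \<partial>MJ) / ennreal m1"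
proof -
  interpret P: pair_sigma_finite MJ lborel ..
  have J1: "0 \<le> 1 - J z" for z using distribution_functionD(3)[OF J] by simp
  have "(\<integral>\<^sup>+z. g z \<partial>excess) = (\<integral>\<^sup>+z. ennreal (indicator {0..} z * (1 - J z) / m1) * g z \<partial>lborel)"
    unfolding excess_def by (subst nn_integral_density) measurable
  also have "\<dots> = (\<integral>\<^sup>+z. (indicator {0..} z * ennreal (1 - J z) * g z) / ennreal m1 \<partial>lborel)"
    using m1_pos J1 by (intro nn_integral_cong) (auto simp: divide_ennreal[symmetric] ennreal_times_divide mult.commute split: split_indicator)
  also have "\<dots> = (\<integral>\<^sup>+z. indicator {0..} z * ennreal (1 - J z) * g z \<partial>lborel) / ennreal m1"
    by (rule nn_integral_divide) measurable
  also have "(\<integral>\<^sup>+z. indicator {0..} z * ennreal (1 - J z) * g z \<partial>lborel)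
      = (\<integral>\<^sup>+z. (\<integral>\<^sup>+w. (if 0 \<le> z \<and> z < w then g z else 0) \<partial>MJ) \<partial>lborel)"
  proof (rule nn_integral_cong)
    fix z
    have "(\<integral>\<^sup>+w. (if 0 \<le> z \<and> z < w then g z else 0) \<partial>MJ) = (\<integral>\<^sup>+w. (indicator {0..} z * g z) * indicator {z<..} w \<partial>MJ)"
      by (intro nn_integral_cong) (auto simp: indicator_def)
    also have "\<dots> = indicator {0..} z * g z * emeasure MJ {z<..}"
      by (rule nn_integral_cmult_indicator) simp
    also have "emeasure MJ {z<..} = ennreal (1 - J z)"
      by (simp add: MJ.emeasure_eq_measure MJ_Ioi)
    finally show "indicator {0..} z * ennreal (1 - J z) * g z = (\<integral>\<^sup>+w. (if 0 \<le> z \<and> z < w then g z else 0) \<partial>MJ)"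
      by (simp add: ac_simps)
  qed
  also have "\<dots> = (\<integral>\<^sup>+w. (\<integral>\<^sup>+z. (if 0 \<le> z \<and> z < w then g z else 0) \<partial>lborel) \<partial>MJ)"
    by (rule P.Fubini') measurable
  also have "\<dots> = (\<integral>\<^sup>+w. (\<integral>\<^sup>+z. indicator {0..<w} z * g z \<partial>lborel) \<partial>MJ)"
    by (intro nn_integral_cong) (auto simp: indicator_def)
  finally show ?thesis .
qed

text \<open>
  With an antiderivative \<open>P\<close> of \<open>G\<close>, averages over the excess distribution become averages of increments of
  \<open>P\<close> over the jump distribution, which can be differentiated in \<open>x\<close>.
\<close>
lemma nn_integral_excess_antiderivative:
  assumes P: "\<And>y. (P has_real_derivative G y) (at y)" and G: "\<And>y. 0 \<le> G y" "\<And>y. G y \<le> B"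
    and cont: "continuous_on UNIV G"
  shows "(\<integral>\<^sup>+z. ennreal (G (x - z)) \<partial>excess) = ennreal ((\<integral>w. P x - P (x - w) \<partial>MJ) / m1)"
    and "integrable MJ (\<lambda>w. P x - P (x - w))"
    and "0 \<le> (\<integral>w. P x - P (x - w) \<partial>MJ)"
proof -
  have [measurable]: "G \<in> borel_measurable borel"
    using cont by (rule borel_measurable_continuous_onI)
  have "continuous_on UNIV P"
    using P DERIV_isCont by (auto simp: continuous_on_eq_continuous_at)
  then have [measurable]: "P \<in> borel_measurable borel"
    by (rule borel_measurable_continuous_onI)
  have inner: "(\<integral>\<^sup>+z. indicator {0..<w} z * ennreal (G (x - z)) \<partial>lborel) = ennreal (P x - P (x - w))" if w: "w > 0" for w
  proof -
    have h: "((\<lambda>z. G (x - z)) has_integral (- P (x - w)) - (- P (x - 0))) {0..w}"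
    proof (rule fundamental_theorem_of_calculus)
      fix z
      have "((\<lambda>z. P (x - z)) has_real_derivative G (x - z) * (- 1)) (at z within {0..w})"
        by (rule DERIV_chain2[OF P]) (auto intro!: derivative_eq_intros)
      then have "((\<lambda>z. - P (x - z)) has_real_derivative - (G (x - z) * (- 1))) (at z within {0..w})"
        by (rule DERIV_minus)
      then show "((\<lambda>z. - P (x - z)) has_vector_derivative G (x - z)) (at z within {0..w})"
        by (simp add: has_real_derivative_iff_has_vector_derivative)
    qed (use w in simp)
    have c: "continuous_on {0..w} (\<lambda>z. G (x - z))"
      by (intro continuous_on_compose2[OF cont] continuous_intros) auto
    have "(\<integral>\<^sup>+z. indicator {0..<w} z * ennreal (G (x - z)) \<partial>lborel) = (\<integral>\<^sup>+z. ennreal (indicator {0..w} z * G (x - z)) \<partial>lborel)"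
    proof (rule nn_integral_cong_AE)
      show "AE z in lborel. indicator {0..<w} z * ennreal (G (x - z)) = ennreal (indicator {0..w} z * G (x - z))"
        using AE_lborel_singleton[of w] by eventually_elim (auto split: split_indicator)
    qed
    also have "\<dots> = ennreal (- P (x - w) - - P (x - 0))"
      by (rule nn_integral_Icc_has_integral[OF c _ h]) (rule G)
    finally show ?thesis by simp
  qed
  have nonneg: "0 \<le> P x - P (x - w)" and le: "P x - P (x - w) \<le> B * w" if w: "w > 0" for w
  proof -
    have "\<exists>z>x - w. z < x \<and> P x - P (x - w) = (x - (x - w)) * G z"
      by (rule MVT2) (use w P in auto)
    then obtain z where "P x - P (x - w) = w * G z" by auto
    then show "0 \<le> P x - P (x - w)" "P x - P (x - w) \<le> B * w"
      using w G[of z] by (auto simp: mult.commute intro: mult_right_mono)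
  qed
  show i: "integrable MJ (\<lambda>w. P x - P (x - w))"
  proof (rule Bochner_Integration.integrable_bound)
    show "integrable MJ (\<lambda>w. B * w)" using integrable_MJ_id by simp
    show "AE w in MJ. norm (P x - P (x - w)) \<le> norm (B * w)"
      using AE_MJ_pos
    proof eventually_elim
      case (elim w)
      then show ?case using nonneg[OF elim] le[OF elim] by simp
    qed
  qed measurable
  show int0: "0 \<le> (\<integral>w. P x - P (x - w) \<partial>MJ)"
    by (rule integral_nonneg_AE) (rule eventually_mono[OF AE_MJ_pos nonneg])
  have "(\<integral>\<^sup>+z. ennreal (G (x - z)) \<partial>excess) = (\<integral>\<^sup>+w. (\<integral>\<^sup>+z. indicator {0..<w} z * ennreal (G (x - z)) \<partial>lborel) \<partial>MJ) / ennreal m1"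
    by (rule nn_integral_excess) measurable
  also have "(\<integral>\<^sup>+w. (\<integral>\<^sup>+z. indicator {0..<w} z * ennreal (G (x - z)) \<partial>lborel) \<partial>MJ) = (\<integral>\<^sup>+w. ennreal (P x - P (x - w)) \<partial>MJ)"
    by (rule nn_integral_cong_AE) (rule eventually_mono[OF AE_MJ_pos inner])
  also have "\<dots> = ennreal (\<integral>w. P x - P (x - w) \<partial>MJ)"
    by (rule nn_integral_eq_integral[OF i]) (rule eventually_mono[OF AE_MJ_pos nonneg])
  finally show "(\<integral>\<^sup>+z. ennreal (G (x - z)) \<partial>excess) = ennreal ((\<integral>w. P x - P (x - w) \<partial>MJ) / m1)"
    using m1_pos int0 by (simp add: divide_ennreal)
qed

sublocale excess: real_distribution excess
proof -
  \<comment> \<open>The constant function 1 has the antiderivative \<open>P(x) = x\<close>.\<close>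
  have "(\<integral>\<^sup>+z. ennreal ((\<lambda>_. 1) (0 - z)) \<partial>excess) = ennreal ((\<integral>w. 0 - (0 - w) \<partial>MJ) / m1)"
    by (rule nn_integral_excess_antiderivative(1)[where B=1]) (auto intro!: derivative_eq_intros)
  then have "emeasure excess (space excess) = 1"
    using m1_pos by (simp add: m1_def[symmetric])
  then show "real_distribution excess"
    by (simp add: real_distribution_def real_distribution_axioms_def prob_spaceI)
qed

lemma AE_excess_pos: "AE z in excess. 0 < z"
proof -
  have "AE z::real in lborel. z \<noteq> 0"
    by (rule AE_lborel_singleton)
  then show ?thesis
    unfolding excess_def by (subst AE_density) (auto elim!: eventually_mono split: split_indicator)
qed

text \<open>
  The mean of the excess distribution is bounded by the second moment of \<open>J\<close> divided by \<open>m1\<close>.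
\<close>
lemma nn_integral_excess_id: "(\<integral>\<^sup>+z. ennreal z \<partial>excess) < \<infinity>"
proof -
  have "(\<integral>\<^sup>+z. indicator {0..<w} z * ennreal z \<partial>lborel) \<le> ennreal (w\<^sup>2)" if "w > 0" for w :: real
  proof -
    have "(\<integral>\<^sup>+z. indicator {0..<w} z * ennreal z \<partial>lborel) \<le> (\<integral>\<^sup>+z. ennreal w * indicator {0..<w} z \<partial>lborel)"
      by (intro nn_integral_mono) (auto split: split_indicator intro: ennreal_leI)
    also have "\<dots> = ennreal (w\<^sup>2)"
      using that by (simp add: nn_integral_cmult_indicator power2_eq_square ennreal_mult)
    finally show ?thesis .
  qed
  then have "(\<integral>\<^sup>+w. (\<integral>\<^sup>+z. indicator {0..<w} z * ennreal z \<partial>lborel) \<partial>MJ) \<le> (\<integral>\<^sup>+w. ennreal (w\<^sup>2) \<partial>MJ)"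
    by (intro nn_integral_mono_AE eventually_mono[OF AE_MJ_pos])
  also have "\<dots> < \<infinity>"
    using moment2 by (subst nn_integral_eq_integral) (auto simp: MJ_def)
  finally have "(\<integral>\<^sup>+w. (\<integral>\<^sup>+z. indicator {0..<w} z * ennreal z \<partial>lborel) \<partial>MJ) < \<infinity>" .
  then show ?thesis
    using m1_pos by (subst nn_integral_excess) (auto simp: ennreal_divide_eq_top_iff less_top[symmetric])
qed

end

lemma bounded_mono_tendsto:
  fixes f :: "real \<Rightarrow> real"
  assumes "mono f" "\<And>x. 0 \<le> f x" "\<And>x. f x \<le> 1"
  obtains l L where "(f \<longlongrightarrow> l) at_bot" "(f \<longlongrightarrow> L) at_top" "\<And>x. l \<le> f x" "\<And>x. f x \<le> L" "0 \<le> l" "L \<le> 1"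
proof
  have b: "bdd_above (range f)" "bdd_below (range f)"
    using assms(2,3) by (auto intro!: bdd_aboveI[of _ 1] bdd_belowI[of _ 0])
  show up: "f x \<le> (SUP x. f x)" and lo: "(INF x. f x) \<le> f x" for x
    using b by (auto intro: cSUP_upper cINF_lower)
  show "(f \<longlongrightarrow> (SUP x. f x)) at_top"
  proof (rule order_tendstoI)
    fix a assume "a < (SUP x. f x)"
    then obtain x where "a < f x"
      using less_cSUP_iff[OF _ b(1), of a] by auto
    then have "a < f y" if "x \<le> y" for y
      using monoD[OF assms(1) that] by auto
    then show "eventually (\<lambda>y. a < f y) at_top"
      by (auto simp: eventually_at_top_linorder)
  next
    fix a assume "(SUP x. f x) < a"
    then show "eventually (\<lambda>y. f y < a) at_top"
      using up by (auto intro!: always_eventually intro: le_less_trans)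
  qed
  show "(f \<longlongrightarrow> (INF x. f x)) at_bot"
  proof (rule order_tendstoI)
    fix a assume "(INF x. f x) < a"
    then obtain x where "f x < a"
      using cINF_less_iff[OF _ b(2), of a] by auto
    then have "f y < a" if "y \<le> x" for y
      using monoD[OF assms(1) that] by auto
    then show "eventually (\<lambda>y. f y < a) at_bot"
      by (auto simp: eventually_at_bot_linorder)
  next
    fix a assume "a < (INF x. f x)"
    then show "eventually (\<lambda>y. a < f y) at_bot"
      using lo by (auto intro!: always_eventually intro: less_le_trans)
  qed
  show "0 \<le> (INF x. f x)" "(SUP x. f x) \<le> 1"
    using assms(2,3) by (auto intro: cINF_greatest cSUP_least)
qed

context mean_field
begin

lemma continuous_compose_unit_measurable:
  fixes g u :: "real \<Rightarrow> real"
  assumes g: "continuous_on {0..1} g" and u: "\<And>x. 0 \<le> u x" "\<And>x. u x \<le> 1" "u \<in> borel_measurable borel"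
  shows "(\<lambda>x. g (u x)) \<in> borel_measurable borel"
proof -
  have "continuous_on UNIV (\<lambda>y. g (max 0 (min 1 y)))"
    by (rule continuous_on_compose2[OF g]) (auto intro!: continuous_intros)
  then have "(\<lambda>y. g (max 0 (min 1 y))) \<in> borel_measurable borel"
    by (rule borel_measurable_continuous_onI)
  from measurable_compose[OF u(3) this] show ?thesis
    using u(1,2) by (simp add: min_absorb2 max_absorb2)
qed

lemma average_integrable:
  fixes g u :: "real \<Rightarrow> real"
  assumes g: "continuous_on {0..1} g" and u: "\<And>x. 0 \<le> u x" "\<And>x. u x \<le> 1" "u \<in> borel_measurable borel"
  shows "integrable excess (\<lambda>z. g (u (x - z)))"
proof -
  have "bounded (g ` {0..1})"
    by (intro compact_imp_bounded compact_continuous_image g) simp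
  then obtain B where "\<forall>y\<in>g ` {0..1}. norm y \<le> B"
    unfolding bounded_iff by blast
  then have "\<And>y. y \<in> {0..1} \<Longrightarrow> norm (g y) \<le> B" by blast
  then show ?thesis
    using u by (intro excess.integrable_const_bound[where B=B])
      (auto intro!: measurable_compose[OF _ continuous_compose_unit_measurable[OF g u]])
qed

lemma average_limit:
  fixes g u :: "real \<Rightarrow> real"
  assumes g: "continuous_on {0..1} g" and u: "\<And>x. 0 \<le> u x" "\<And>x. u x \<le> 1" "u \<in> borel_measurable borel"
    and lim: "\<And>z. (\<lambda>n. u (X n - z)) \<longlonglongrightarrow> L"
  shows "(\<lambda>n. \<integral>z. g (u (X n - z)) \<partial>excess) \<longlonglongrightarrow> g L"
proof -
  have "bounded (g ` {0..1})"
    by (intro compact_imp_bounded compact_continuous_image g) simp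
  then obtain B where "\<forall>y\<in>g ` {0..1}. norm y \<le> B"
    unfolding bounded_iff by blast
  then have B: "\<And>y. y \<in> {0..1} \<Longrightarrow> norm (g y) \<le> B" by blast
  have L: "L \<in> {0..1}"
    using LIMSEQ_le_const[OF lim[of 0]] LIMSEQ_le_const2[OF lim[of 0]] u by auto
  have "(\<lambda>n. \<integral>z. g (u (X n - z)) \<partial>excess) \<longlonglongrightarrow> (\<integral>z. g L \<partial>excess)"
  proof (rule integral_dominated_convergence[where w="\<lambda>_. B"])
    show "AE z in excess. (\<lambda>n. g (u (X n - z))) \<longlonglongrightarrow> g L"
      using L u by (intro AE_I2 continuous_on_tendsto_compose[OF g lim]) auto
    show "AE z in excess. norm (g (u (X n - z))) \<le> B" for n
      using B u by auto
    show "(\<lambda>z. g (u (X n - z))) \<in> borel_measurable excess" for n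
      by (rule borel_measurable_integrable[OF average_integrable[OF g u]])
  qed auto
  then show ?thesis using excess.prob_space by simp
qed

lemma filterlim_minus_const_real: "filterlim (\<lambda>n. - real n - z) at_bot sequentially"
  and filterlim_real_minus_const: "filterlim (\<lambda>n. real n - z) at_top sequentially"
proof -
  show *: "filterlim (\<lambda>n. real n - z) at_top sequentially" for z
    using filterlim_tendsto_add_at_top[OF tendsto_const[of "- z"] filterlim_real_sequentially] by simp
  show "filterlim (\<lambda>n. - real n - z) at_bot sequentially"
  proof -
    have "(\<lambda>n. - real n - z) = (\<lambda>n. - (real n - - z))" by auto
    then show ?thesis
      using filterlim_compose[OF filterlim_uminus_at_bot_at_top *[of "- z"]] by (simp only:)
  qed
qed

text \<open>
  Differentiation under the integral: difference quotients of increments of the 1-Lipschitz function \<open>P\<close> are bounded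
  by 2.
\<close>
lemma excess_average_derivative:
  assumes \<phi>: "distribution_function \<phi>" and cont: "continuous_on UNIV \<phi>"
  shows "((\<lambda>x. \<integral>z. H (\<phi> (x - z)) \<partial>excess) has_real_derivative N \<phi> x / m1) (at x)"
proof -
  define G where "G y = H (\<phi> y)" for y
  have cG: "continuous_on UNIV G"
    unfolding G_def using distribution_functionD(2,3)[OF \<phi>]
    by (intro continuous_on_compose2[OF H_cont cont]) auto
  have G: "0 \<le> G y" "G y \<le> 1" for y
    using H_range[OF \<phi>, of y] by (auto simp: G_def)
  obtain P where P: "\<And>y. (P has_real_derivative G y) (at y)"
    using einterval_antiderivative[of "-\<infinity>" \<infinity> G] cG
    by (auto simp: continuous_on_eq_continuous_at has_real_derivative_iff_has_vector_derivative)
  note nn = nn_integral_excess_antiderivative[OF P G cG]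
  have eq: "(\<integral>z. G (x - z) \<partial>excess) = (\<integral>w. P x - P (x - w) \<partial>MJ) / m1" for x
    using nn(1)[of x] G m1_pos nn(3)[of x]
    by (intro nn_integral_eq_integrable[THEN iffD1, THEN conjunct2])
       (auto intro!: measurable_compose[OF _ borel_measurable_continuous_onI[OF cG]])
  have lip: "\<bar>P a - P b\<bar> \<le> \<bar>a - b\<bar>" for a b
  proof -
    have "norm (P a - P b) \<le> 1 * norm (a - b)"
      by (rule field_differentiable_bound[of UNIV P G])
         (use P G in \<open>auto simp: has_field_derivative_at_within\<close>)
    then show ?thesis by simp
  qed
  have "((\<lambda>x. \<integral>w. P x - P (x - w) \<partial>MJ) has_real_derivative (\<integral>w. G x - G (x - w) \<partial>MJ)) (at x)"
    unfolding DERIV_def tendsto_at_iff_sequentially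
  proof (intro allI impI)
    fix X :: "nat \<Rightarrow> real" assume X: "\<forall>i. X i \<in> UNIV - {0}" "X \<longlonglongrightarrow> 0"
    define q where "q i w = ((P (x + X i) - P x) - (P (x - w + X i) - P (x - w))) / X i" for i w
    have qe: "((\<integral>w. P (x + X i) - P (x + X i - w) \<partial>MJ) - (\<integral>w. P x - P (x - w) \<partial>MJ)) / X i = (\<integral>w. q i w \<partial>MJ)" for i
    proof -
      have 1: "(\<integral>w. P (x + X i) - P (x + X i - w) \<partial>MJ) - (\<integral>w. P x - P (x - w) \<partial>MJ)
          = (\<integral>w. (P (x + X i) - P (x + X i - w)) - (P x - P (x - w)) \<partial>MJ)"
        by (rule Bochner_Integration.integral_diff[OF nn(2) nn(2), symmetric])
      have "(\<integral>w. (P (x + X i) - P (x + X i - w)) - (P x - P (x - w)) \<partial>MJ) / X i = (\<integral>w. ((P (x + X i) - P (x + X i - w)) - (P x - P (x - w))) / X i \<partial>MJ)"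
        by simp
      also have "\<dots> = (\<integral>w. q i w \<partial>MJ)"
        by (intro Bochner_Integration.integral_cong) (auto simp: q_def algebra_simps)
      finally show ?thesis by (simp only: 1)
    qed
    have dq: "(\<lambda>i. (P (a + X i) - P a) / X i) \<longlonglongrightarrow> G a" for a
      using P[of a] X unfolding DERIV_def tendsto_at_iff_sequentially by (auto simp: comp_def)
    have Pm [measurable]: "P \<in> borel_measurable borel"
      using P DERIV_isCont by (intro borel_measurable_continuous_onI) (auto simp: continuous_on_eq_continuous_at)
    have [measurable]: "G \<in> borel_measurable borel"
      using cG by (rule borel_measurable_continuous_onI)
    have "(\<lambda>i. \<integral>w. q i w \<partial>MJ) \<longlonglongrightarrow> (\<integral>w. G x - G (x - w) \<partial>MJ)"
    proof (rule integral_dominated_convergence[where w="\<lambda>_. 2"])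
      show "AE w in MJ. (\<lambda>i. q i w) \<longlonglongrightarrow> G x - G (x - w)"
        unfolding q_def diff_divide_distrib
        by (intro AE_I2 tendsto_diff dq[unfolded diff_divide_distrib])
      show "AE w in MJ. norm (q i w) \<le> 2" for i
      proof (rule AE_I2)
        fix w
        have "X i \<noteq> 0" using X(1) by auto
        moreover have "\<bar>(P (x + X i) - P x) - (P (x - w + X i) - P (x - w))\<bar> \<le> 2 * \<bar>X i\<bar>"
          using lip[of "x + X i" x] lip[of "x - w + X i" "x - w"] by auto
        ultimately show "norm (q i w) \<le> 2"
          by (simp add: q_def abs_divide divide_le_eq)
      qed
      show "q i \<in> borel_measurable MJ" for i
        unfolding q_def by measurable
    qed simp_all
    then show "((\<lambda>h. ((\<integral>w. P (x + h) - P (x + h - w) \<partial>MJ) - (\<integral>w. P x - P (x - w) \<partial>MJ)) / h) \<circ> X) \<longlonglongrightarrow> (\<integral>w. G x - G (x - w) \<partial>MJ)"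
      by (simp add: comp_def qe)
  qed
  then have "((\<lambda>x. (\<integral>w. P x - P (x - w) \<partial>MJ) / m1) has_real_derivative (\<integral>w. G x - G (x - w) \<partial>MJ) / m1) (at x)"
    by (rule DERIV_cdivide)
  then show ?thesis
    unfolding eq[symmetric] by (simp add: G_def N_def)
qed

lemma profile_of_fixpoint:
  assumes \<phi>: "distribution_function \<phi>" and cont: "continuous_on UNIV \<phi>"
    and fp: "\<And>x. \<phi> x = (\<integral>z. H (\<phi> (x - z)) \<partial>excess) / H1"
  shows "profile \<phi>"
  unfolding profile_def
proof (intro conjI allI)
  fix x
  have "((\<lambda>x. (\<integral>z. H (\<phi> (x - z)) \<partial>excess) / H1) has_real_derivative N \<phi> x / m1 / H1) (at x)"
    by (intro DERIV_cdivide excess_average_derivative \<phi> cont)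
  moreover have "(\<lambda>x. (\<integral>z. H (\<phi> (x - z)) \<partial>excess) / H1) = \<phi>"
    by (simp only: fp[symmetric])
  ultimately show "(\<phi> has_real_derivative N \<phi> x / (m1 * H1)) (at x)"
    by simp
qed (rule \<phi>)

text \<open>
  Both sides have the same derivative, and both tend to 0 at \<open>-\<infinity>\<close>.
\<close>
lemma fixpoint_of_profile:
  assumes p: "profile \<phi>"
  shows "\<phi> x = (\<integral>z. H (\<phi> (x - z)) \<partial>excess) / H1"
proof -
  note \<phi> = profileD[OF p]
  note D = distribution_functionD[OF \<phi>(1)]
  define E where "E x = \<phi> x - (\<integral>z. H (\<phi> (x - z)) \<partial>excess) / H1" for x
  have dE: "(E has_real_derivative 0) (at x)" for x
  proof -
    have "(E has_real_derivative N \<phi> x / (m1 * H1) - N \<phi> x / m1 / H1) (at x)"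
      unfolding E_def
      by (intro DERIV_diff \<phi>(2) DERIV_cdivide excess_average_derivative \<phi>(1,3))
    then show ?thesis by simp
  qed
  have const: "E x = E y" for x y
    by (rule DERIV_isconst_all) (rule allI, rule dE)
  obtain c where c: "\<And>x. E x = c" using const by blast
  have m: "\<And>x. 0 \<le> \<phi> x" "\<And>x. \<phi> x \<le> 1" "\<phi> \<in> borel_measurable borel"
    using D borel_measurable_mono by auto
  have "(\<lambda>n. E (- real n)) \<longlonglongrightarrow> 0 - H 0 / H1"
    unfolding E_def
  proof (intro tendsto_intros average_limit[OF H_cont m])
    show "(\<lambda>n. \<phi> (- real n)) \<longlonglongrightarrow> 0"
      by (rule filterlim_compose[OF D(5)]) (rule filterlim_minus_const_real[of 0, simplified])
    show "(\<lambda>n. \<phi> (- real n - z)) \<longlonglongrightarrow> 0" for z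
      by (rule filterlim_compose[OF D(5) filterlim_minus_const_real])
  qed (use H1_pos in auto)
  then have "c = 0"
    by (simp add: c LIMSEQ_const_iff)
  then show ?thesis using c[of x] by (simp add: E_def)
qed

text \<open>
  The graph of the concave function \<open>H / H(1)\<close> lies above the chords from its midpoint to \<open>(0,0)\<close> and \<open>(1,1)\<close>;
  \<open>d\<close> is the height of the midpoint above the diagonal, positive because \<open>\<eta>\<close> is strictly decreasing.
\<close>
lemma H_concave_gap:
  defines "d \<equiv> H (1/2) / H1 - 1/2"
  shows "d > 0" "0 \<le> u \<Longrightarrow> u \<le> 1 \<Longrightarrow> 2 * d * min u (1 - u) \<le> H u / H1 - u"
proof -
  have "\<eta> (1/4) * (1/4) \<le> H (1/4)" "\<eta> (1/2) * (1/4) \<le> H (1/2) - H (1/4)" "H 1 - H (1/2) \<le> \<eta> (1/2) * (1/2)"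
    using H_diff_bounds(1)[of 0 "1/4"] H_diff_bounds(1)[of "1/4" "1/2"] H_diff_bounds(2)[of "1/2" 1] by auto
  moreover have "\<eta> (1/2) < \<eta> (1/4)" by (rule strict) auto
  ultimately have gt: "H1 < 2 * H (1/2)" by (simp add: H1_def)
  then show "d > 0"
    using H1_pos by (simp add: d_def field_simps)
  show "2 * d * min u (1 - u) \<le> H u / H1 - u" if u: "0 \<le> u" "u \<le> 1"
  proof (cases "u \<le> 1/2")
    case True
    have "H (1/2) - H u \<le> \<eta> u * (1/2 - u)" "\<eta> u * u \<le> H u"
      using H_diff_bounds(2)[of u "1/2"] H_diff_bounds(1)[of 0 u] H_diff_bounds(2)[of 0 u] True u
        H_diff_bounds(1)[of 0 u] by auto
    then have "u * (H (1/2) - H u) \<le> u * (\<eta> u * (1/2 - u))" "(1/2 - u) * (\<eta> u * u) \<le> (1/2 - u) * H u"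
      using u True by (auto intro!: mult_left_mono)
    then have "2 * u * H (1/2) \<le> H u"
      by (simp add: algebra_simps)
    then have "2 * u * H (1/2) / H1 \<le> H u / H1"
      using H1_pos by (intro divide_right_mono) auto
    then show ?thesis
      using True by (simp add: d_def min_def algebra_simps)
  next
    case False
    have "H 1 - H u \<le> \<eta> u * (1 - u)" "\<eta> u * (u - 1/2) \<le> H u - H (1/2)"
      using H_diff_bounds(2)[of u 1] H_diff_bounds(1)[of "1/2" u] False u by auto
    note le = this
    have "(u - 1/2) * (H1 - H u) \<le> (u - 1/2) * (\<eta> u * (1 - u))"
      unfolding H1_def using le(1) False by (intro mult_left_mono) auto
    also have "\<dots> = (1 - u) * (\<eta> u * (u - 1/2))"
      by (simp only: ac_simps)
    also have "\<dots> \<le> (1 - u) * (H u - H (1/2))"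
      using le(2) u by (intro mult_left_mono) auto
    finally have "(u - 1/2) * (H1 - H u) \<le> (1 - u) * (H u - H (1/2))" .
    then have "2 * (1 - u) * H (1/2) + (2 * u - 1) * H1 \<le> H u"
      by (simp add: algebra_simps)
    then have "(2 * (1 - u) * H (1/2) + (2 * u - 1) * H1) / H1 \<le> H u / H1"
      using H1_pos by (intro divide_right_mono) auto
    then have "2 * (1 - u) * (H (1/2) / H1) + (2 * u - 1) \<le> H u / H1"
      using H1_pos by (simp add: add_divide_distrib)
    then show ?thesis
      using False u by (simp add: d_def min_def algebra_simps)
  qed
qed

text \<open>
  By the fixed-point equation, \<open>H(\<phi>(x)) / H(1) - \<phi>(x)\<close> is an average of the increments
  \<open>(H(\<phi>(x)) - H(\<phi>(x - z))) / H(1)\<close>, whose integral over \<open>x\<close> is \<open>z\<close>. So its integral is the mean of the excess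
  distribution. By concavity it dominates a multiple of the smaller of the two tails
  \<open>\<phi>\<close> and \<open>1 - \<phi>\<close>.
\<close>
lemma profile_finite_mean:
  assumes p: "profile \<phi>" shows "finite_mean \<phi>"
proof -
  note \<phi> = profileD[OF p]
  note D = distribution_functionD[OF \<phi>(1)]
  interpret Q: pair_sigma_finite excess lborel ..
  have [measurable]: "\<phi> \<in> borel_measurable borel" "(\<lambda>y. H (\<phi> y)) \<in> borel_measurable borel"
    using distribution_function_measurable[OF \<phi>(1)] H_compose_measurable[OF \<phi>(1)] by auto
  define d where "d = H (1/2) / H1 - 1/2"
  have d: "d > 0" "2 * d * min (\<phi> x) (1 - \<phi> x) \<le> H (\<phi> x) / H1 - \<phi> x" for x
    unfolding d_def by (rule H_concave_gap D(2,3))+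
  have int: "integrable excess (\<lambda>z. H (\<phi> (x - z)))" for x
    using H_range[OF \<phi>(1)] by (intro excess.integrable_const_bound[where B=1]) auto
  have mono: "H (\<phi> (x - z)) \<le> H (\<phi> x)" if "z > 0" for x z
    using that by (intro H_mono D) auto
  have gap: "ennreal (H (\<phi> x) - H1 * \<phi> x) = (\<integral>\<^sup>+z. ennreal (H (\<phi> x) - H (\<phi> (x - z))) \<partial>excess)" for x
  proof -
    have "H (\<phi> x) - H1 * \<phi> x = (\<integral>z. H (\<phi> x) - H (\<phi> (x - z)) \<partial>excess)"
      using fixpoint_of_profile[OF p, of x] H1_pos int excess.prob_space by (simp add: field_simps)
    then show ?thesis
      using int by (subst nn_integral_eq_integral) (auto intro: eventually_mono[OF AE_excess_pos] mono)
  qed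
  have "(\<integral>\<^sup>+x. ennreal (H (\<phi> x) - H1 * \<phi> x) \<partial>lborel)
      = (\<integral>\<^sup>+z. (\<integral>\<^sup>+x. ennreal (H (\<phi> x) - H (\<phi> (x - z))) \<partial>lborel) \<partial>excess)"
    unfolding gap by (rule Q.Fubini') measurable
  also have "\<dots> = (\<integral>\<^sup>+z. ennreal z * ennreal H1 \<partial>excess)"
    by (rule nn_integral_cong_AE, rule eventually_mono[OF AE_excess_pos])
       (use H1_pos in \<open>simp add: nn_integral_H_shift[OF \<phi>(1)] ennreal_mult\<close>)
  also have "\<dots> = (\<integral>\<^sup>+z. ennreal z \<partial>excess) * ennreal H1"
    by (rule nn_integral_multc) measurable
  also have "\<dots> < \<infinity>"
    using nn_integral_excess_id by (simp add: ennreal_mult_less_top)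
  finally have fin: "(\<integral>\<^sup>+x. ennreal (H (\<phi> x) - H1 * \<phi> x) \<partial>lborel) < \<infinity>" .
  have gap0: "0 \<le> H (\<phi> x) - H1 * \<phi> x" and gapd: "2 * d * H1 * min (\<phi> x) (1 - \<phi> x) \<le> H (\<phi> x) - H1 * \<phi> x" for x
  proof -
    have "H1 * (2 * d * min (\<phi> x) (1 - \<phi> x)) \<le> H1 * (H (\<phi> x) / H1 - \<phi> x)"
      using H1_pos d(2) by (intro mult_left_mono) auto
    then show *: "2 * d * H1 * min (\<phi> x) (1 - \<phi> x) \<le> H (\<phi> x) - H1 * \<phi> x"
      using H1_pos by (simp add: algebra_simps)
    have "0 \<le> 2 * d * H1 * min (\<phi> x) (1 - \<phi> x)"
      using d(1) H1_pos D(2,3)[of x] by (intro mult_nonneg_nonneg) auto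
    with * show "0 \<le> H (\<phi> x) - H1 * \<phi> x" by simp
  qed
  have i1: "integrable lborel (\<lambda>x. H (\<phi> x) - H1 * \<phi> x)"
    using fin gap0 by (intro integrableI_nonneg) auto
  obtain a where a: "\<And>x. x \<le> a \<Longrightarrow> \<phi> x < 1/2"
    using order_tendstoD(2)[OF D(5), of "1/2"] by (auto simp: eventually_at_bot_linorder)
  obtain b where b: "\<And>x. b \<le> x \<Longrightarrow> 1/2 < \<phi> x"
    using order_tendstoD(1)[OF D(6), of "1/2"] by (auto simp: eventually_at_top_linorder)
  define B where "B = max \<bar>a\<bar> \<bar>b\<bar>"
  have "integrable lborel (\<lambda>x. indicator {0..} x - \<phi> x)"
  proof (rule Bochner_Integration.integrable_bound)
    show "integrable lborel (\<lambda>x. inverse (2 * d * H1) * (H (\<phi> x) - H1 * \<phi> x) + indicator {-B..B} x)"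
      using i1 by (intro Bochner_Integration.integrable_add integrable_mult_right) (auto simp: integrable_indicator_iff emeasure_lborel_Icc_eq)
    have "\<bar>indicator {0..} x - \<phi> x\<bar> \<le> inverse (2 * d * H1) * (H (\<phi> x) - H1 * \<phi> x) + indicator {-B..B} x" for x
    proof -
      have "min (\<phi> x) (1 - \<phi> x) = inverse (2 * d * H1) * (2 * d * H1 * min (\<phi> x) (1 - \<phi> x))"
        using d(1) H1_pos by (subst mult.assoc[symmetric], subst left_inverse) auto
      also have "\<dots> \<le> inverse (2 * d * H1) * (H (\<phi> x) - H1 * \<phi> x)"
        using d(1) H1_pos by (intro mult_left_mono gapd) auto
      finally have le: "min (\<phi> x) (1 - \<phi> x) \<le> inverse (2 * d * H1) * (H (\<phi> x) - H1 * \<phi> x)" .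
      have nn: "0 \<le> inverse (2 * d * H1) * (H (\<phi> x) - H1 * \<phi> x)"
        using d(1) H1_pos gap0[of x] by simp
      consider "x < - B" | "x > B" | "x \<in> {-B..B}" by force
      then show ?thesis
      proof cases
        case 1
        then have "x \<le> a" "x < 0" by (auto simp: B_def)
        then show ?thesis using a[of x] le D(2)[of x] 1 by (simp add: min_def split: if_splits)
      next
        case 2
        then have "b \<le> x" "x > 0" by (auto simp: B_def)
        then show ?thesis using b[of x] le D(3)[of x] 2 by (simp add: min_def split: if_splits)
      next
        case 3
        then show ?thesis using nn D(2,3)[of x] by (auto split: split_indicator)
      qed
    qed
    then show "AE x in lborel. norm (indicator {0..} x - \<phi> x)
        \<le> norm (inverse (2 * d * H1) * (H (\<phi> x) - H1 * \<phi> x) + indicator {-B..B} x)"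
      unfolding real_norm_def by (intro AE_I2) (rule order_trans[OF _ abs_ge_self])
  qed measurable
  then show ?thesis
    by (simp add: finite_mean_iff_integrable[OF \<phi>(1)])
qed

end

section \<open>Existence of a profile\<close>

lemma continuous_of_mono_lipschitz:
  fixes u :: "real \<Rightarrow> real"
  assumes m: "mono u" and lip: "\<And>x e. 0 \<le> e \<Longrightarrow> u (x + e) \<le> u x + e / c"
  shows "continuous_on UNIV u"
proof -
  have "\<bar>u x - u y\<bar> \<le> \<bar>1 / c\<bar> * \<bar>x - y\<bar>" if "x \<le> y" for x y
  proof -
    have "u y - u x \<le> (y - x) / c" using lip[of "y - x" x] that by simp
    also have "\<dots> \<le> \<bar>(y - x) / c\<bar>" by (rule abs_ge_self)
    finally show ?thesis using monoD[OF m that] by (simp add: abs_divide abs_minus_commute)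
  qed
  then have "\<bar>1 / c\<bar>-lipschitz_on UNIV u"
    by (intro lipschitz_onI) (metis abs_minus_commute dist_real_def linear, simp)
  then show ?thesis by (rule lipschitz_on_continuous_on)
qed

context mean_field
begin

text \<open>
  The density of the excess distribution is nonincreasing on the half line and bounded by \<open>1 / m1\<close>. Moving the
  point by \<open>e\<close> therefore gains at most the mass seen by the new window of length \<open>e\<close>.
\<close>
lemma excess_average_lipschitz:
  fixes g u :: "real \<Rightarrow> real"
  assumes g: "continuous_on {0..1} g" "\<And>y. 0 \<le> y \<Longrightarrow> y \<le> 1 \<Longrightarrow> 0 \<le> g y \<and> g y \<le> 1"
    and u: "\<And>x. 0 \<le> u x" "\<And>x. u x \<le> 1" "u \<in> borel_measurable borel"
    and e: "0 \<le> e"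
  shows "(\<integral>z. g (u (x + e - z)) \<partial>excess) \<le> (\<integral>z. g (u (x - z)) \<partial>excess) + e / m1"
proof -
  define k where "k z = indicator {0..} z * (1 - J z) / m1" for z :: real
  have J01: "0 \<le> J z" "J z \<le> 1" for z using distribution_functionD(2,3)[OF J] by auto
  have k: "0 \<le> k z" "k z \<le> 1 / m1" for z
    using J01[of z] m1_pos by (auto simp: k_def divide_right_mono split: split_indicator)
  have [measurable]: "k \<in> borel_measurable borel" unfolding k_def by measurable
  define G where "G y = g (u y)" for y
  have [measurable]: "G \<in> borel_measurable borel"
    unfolding G_def by (rule continuous_compose_unit_measurable[OF g(1) u])
  have G: "0 \<le> G y" "G y \<le> 1" for y using g(2) u by (auto simp: G_def)
  have nn: "(\<integral>\<^sup>+z. ennreal (G (x - z)) \<partial>excess) = ennreal (\<integral>z. G (x - z) \<partial>excess)" for x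
    using average_integrable[OF g(1) u, of x] G by (intro nn_integral_eq_integral) (auto simp: G_def)
  have rep: "(\<integral>\<^sup>+z. ennreal (G (x - z)) \<partial>excess) = (\<integral>\<^sup>+y. ennreal (k (x - y) * G y) \<partial>lborel)" for x
  proof -
    have "(\<integral>\<^sup>+z. ennreal (G (x - z)) \<partial>excess) = (\<integral>\<^sup>+z. ennreal (k z) * ennreal (G (x - z)) \<partial>lborel)"
      unfolding excess_def k_def[symmetric] by (subst nn_integral_density) auto
    also have "\<dots> = (\<integral>\<^sup>+z. ennreal (k z * G (x - z)) \<partial>lborel)"
      using k G by (intro nn_integral_cong) (simp add: ennreal_mult)
    also have "\<dots> = (\<integral>\<^sup>+y. ennreal (k (x - y) * G y) \<partial>lborel)"
      using nn_integral_real_affine[of "\<lambda>z. ennreal (k z * G (x - z))" "-1" x] by simp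
    finally show ?thesis .
  qed
  have "(\<integral>\<^sup>+y. ennreal (k (x + e - y) * G y) \<partial>lborel)
      \<le> (\<integral>\<^sup>+y. ennreal (k (x - y) * G y) + ennreal (1 / m1) * indicator {x<..x + e} y \<partial>lborel)"
  proof (rule nn_integral_mono)
    fix y
    consider "y \<le> x" | "x < y" "y \<le> x + e" | "x + e < y" by linarith
    then show "ennreal (k (x + e - y) * G y) \<le> ennreal (k (x - y) * G y) + ennreal (1 / m1) * indicator {x<..x + e} y"
    proof cases
      case 1
      then have "k (x + e - y) \<le> k (x - y)"
        using e m1_pos distribution_functionD(7)[OF J, of "x - y" "x + e - y"] by (auto simp: k_def divide_right_mono)
      then show ?thesis
        using 1 G by (auto intro!: ennreal_leI mult_right_mono)
    next
      case 2
      have "k (x + e - y) * G y \<le> 1 / m1 * 1"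
        using k G m1_pos by (intro mult_mono) auto
      then show ?thesis
        using 2 by (auto intro!: ennreal_leI add_increasing)
    next
      case 3
      then show ?thesis by (simp add: k_def)
    qed
  qed
  also have "\<dots> = (\<integral>\<^sup>+y. ennreal (k (x - y) * G y) \<partial>lborel) + ennreal (e / m1)"
    using e m1_pos by (subst nn_integral_add) (auto simp: nn_integral_cmult_indicator ennreal_mult[symmetric])
  finally have "ennreal (\<integral>z. G (x + e - z) \<partial>excess) \<le> ennreal (\<integral>z. G (x - z) \<partial>excess) + ennreal (e / m1)"
    by (simp only: rep[symmetric] nn)
  also have "\<dots> = ennreal ((\<integral>z. G (x - z) \<partial>excess) + e / m1)"
    using e m1_pos G by (intro ennreal_plus[symmetric] integral_nonneg_AE) auto
  finally show ?thesis
    using e m1_pos G by (subst (asm) ennreal_le_iff) (auto simp: G_def intro!: add_nonneg_nonneg integral_nonneg_AE)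
qed

lemma excess_average_mono:
  fixes g u w :: "real \<Rightarrow> real"
  assumes g: "continuous_on {0..1} g" and gm: "\<And>y y'. 0 \<le> y \<Longrightarrow> y \<le> y' \<Longrightarrow> y' \<le> 1 \<Longrightarrow> g y \<le> g y'"
    and u: "\<And>x. 0 \<le> u x" "\<And>x. u x \<le> 1" "u \<in> borel_measurable borel"
    and w: "\<And>x. 0 \<le> w x" "\<And>x. w x \<le> 1" "w \<in> borel_measurable borel"
    and le: "\<And>z. z > 0 \<Longrightarrow> u (x - z) \<le> w (y - z)"
  shows "(\<integral>z. g (u (x - z)) \<partial>excess) \<le> (\<integral>z. g (w (y - z)) \<partial>excess)"
proof (rule integral_mono_AE)
  show "AE z in excess. g (u (x - z)) \<le> g (w (y - z))"
    using AE_excess_pos by eventually_elim (auto intro!: gm u w le)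
qed (rule average_integrable[OF g u] average_integrable[OF g w])+

lemma excess_fixpoint_limits:
  fixes g \<phi> :: "real \<Rightarrow> real"
  assumes g: "continuous_on {0..1} g" and m: "mono \<phi>" and \<phi>: "\<And>x. 0 \<le> \<phi> x" "\<And>x. \<phi> x \<le> 1"
    and fp: "\<And>x. \<phi> x = (\<integral>z. g (\<phi> (x - z)) \<partial>excess)"
  obtains l L where "(\<phi> \<longlongrightarrow> l) at_bot" "(\<phi> \<longlongrightarrow> L) at_top" "\<And>x. l \<le> \<phi> x" "\<And>x. \<phi> x \<le> L" "0 \<le> l" "L \<le> 1"
    "g l = l" "g L = L"
proof -
  obtain l L where lL: "(\<phi> \<longlongrightarrow> l) at_bot" "(\<phi> \<longlongrightarrow> L) at_top" "\<And>x. l \<le> \<phi> x" "\<And>x. \<phi> x \<le> L" "0 \<le> l" "L \<le> 1"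
    using bounded_mono_tendsto[OF m \<phi>] by blast
  have meas: "\<phi> \<in> borel_measurable borel" using m by (rule borel_measurable_mono)
  have "(\<lambda>n. \<integral>z. g (\<phi> (real n - z)) \<partial>excess) \<longlonglongrightarrow> g L"
    by (rule average_limit[OF g \<phi> meas]) (rule filterlim_compose[OF lL(2) filterlim_real_minus_const])
  then have "(\<lambda>n. \<phi> (real n)) \<longlonglongrightarrow> g L" by (simp only: fp[symmetric])
  then have "g L = L"
    using filterlim_compose[OF lL(2) filterlim_real_sequentially] LIMSEQ_unique by blast
  note gL = this
  have "(\<lambda>n. \<integral>z. g (\<phi> (- real n - z)) \<partial>excess) \<longlonglongrightarrow> g l"
    by (rule average_limit[OF g \<phi> meas]) (rule filterlim_compose[OF lL(1) filterlim_minus_const_real])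
  then have "(\<lambda>n. \<phi> (- real n)) \<longlonglongrightarrow> g l" by (simp only: fp[symmetric])
  moreover have "(\<lambda>n. \<phi> (- real n)) \<longlonglongrightarrow> l"
    using filterlim_compose[OF lL(1) filterlim_minus_const_real[of 0]] by simp
  ultimately have "g l = l"
    using LIMSEQ_unique by blast
  with gL show thesis using that lL by blast
qed

text \<open>
  The Laplace transform of the excess distribution decreases continuously from 1 to 0, since the distribution has no
  atom at 0.
\<close>
lemma excess_exponential_root:
  assumes s: "s > 1"
  obtains l where "l > 0" "s * (\<integral>z. exp (- l * z) \<partial>excess) = 1" "integrable excess (\<lambda>z. exp (- l * z))"
proof -
  define K where "K l = (\<integral>z. exp (- l * z) \<partial>excess)" for l :: real
  have int: "integrable excess (\<lambda>z. exp (- l * z))" if "l \<ge> 0" for l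
  proof (rule excess.integrable_const_bound[where B=1])
    show "AE z in excess. norm (exp (- l * z)) \<le> 1"
      using AE_excess_pos by eventually_elim (use that in auto)
  qed auto
  have seq: "(\<lambda>n. K (X n)) \<longlonglongrightarrow> K a" if "\<And>n. 0 \<le> X n" "X \<longlonglongrightarrow> a" for X a
    unfolding K_def
  proof (rule integral_dominated_convergence[where w="\<lambda>_. 1"])
    show "AE z in excess. (\<lambda>n. exp (- X n * z)) \<longlonglongrightarrow> exp (- a * z)"
      by (intro AE_I2 tendsto_intros that)
    show "AE z in excess. norm (exp (- X n * z)) \<le> 1" for n
      using AE_excess_pos by eventually_elim (use that in auto)
  qed auto
  have cont: "continuous_on {0..} K"
    unfolding continuous_on_sequentially by (auto simp: comp_def intro: seq)
  have K0: "K 0 = 1" using excess.prob_space by (simp add: K_def)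
  have "(\<lambda>n. K (real n)) \<longlonglongrightarrow> (\<integral>z. 0 \<partial>excess)"
    unfolding K_def
  proof (rule integral_dominated_convergence[where w="\<lambda>_. 1"])
    show "AE z in excess. (\<lambda>n. exp (- real n * z)) \<longlonglongrightarrow> 0"
      using AE_excess_pos
    proof eventually_elim
      case (elim z)
      have "filterlim (\<lambda>n. z * real n) at_top sequentially"
        by (rule filterlim_tendsto_pos_mult_at_top[OF tendsto_const elim filterlim_real_sequentially])
      then have "filterlim (\<lambda>n. - (z * real n)) at_bot sequentially"
        by (rule filterlim_compose[OF filterlim_uminus_at_bot_at_top])
      from filterlim_compose[OF exp_at_bot this] show ?case by (simp add: mult.commute)
    qed
    show "AE z in excess. norm (exp (- real n * z)) \<le> 1" for n
      using AE_excess_pos by eventually_elim auto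
  qed auto
  then have "eventually (\<lambda>n. K (real n) < 1 / s) sequentially"
    using s by (intro order_tendstoD) auto
  then obtain n where n: "K (real n) < 1 / s"
    by (auto simp: eventually_sequentially)
  have "\<exists>l\<ge>0. l \<le> real n \<and> K l = 1 / s"
    by (rule IVT2') (use n s K0 in \<open>auto intro: continuous_on_subset[OF cont]\<close>)
  then obtain l where l: "0 \<le> l" "K l = 1 / s" by blast
  have "l \<noteq> 0" using l(2) K0 s by auto
  then show thesis
    using that[of l] l int[of l] s by (simp add: K_def)
qed

text \<open>
  Linearising at 0, \<open>s\<close> times the average of \<open>exp (l x)\<close> reproduces it for a suitable \<open>l\<close>. Hence \<open>min 1 (exp (l x))\<close> is
  a supersolution because \<open>g\<close> lies below its tangent at 0, and \<open>min a (exp (l x))\<close> is a subsolution because \<open>g\<close> is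
  linear up to \<open>a\<close>. The supremum of all monotone subsolutions below the supersolution is a fixed point, as in the
  Knaster-Tarski theorem. The barriers force its limits: it vanishes at \<open>-\<infinity>\<close>, and its limit at \<open>\<infinity>\<close> is a
  positive fixed point of \<open>g\<close>.
\<close>
lemma linearized_fixpoint:
  fixes g :: "real \<Rightarrow> real"
  assumes g: "continuous_on {0..1} g" and gm: "\<And>y y'. 0 \<le> y \<Longrightarrow> y \<le> y' \<Longrightarrow> y' \<le> 1 \<Longrightarrow> g y \<le> g y'"
    and s: "s > 1" and a: "0 < a" "a < 1"
    and lin: "\<And>y. 0 \<le> y \<Longrightarrow> y \<le> a \<Longrightarrow> g y = s * y" and sup: "\<And>y. 0 \<le> y \<Longrightarrow> y \<le> 1 \<Longrightarrow> g y \<le> s * y"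
    and g1: "g 1 = 1" and above: "\<And>y. 0 < y \<Longrightarrow> y < 1 \<Longrightarrow> y < g y"
  obtains \<phi> where "mono \<phi>" "\<And>x. 0 \<le> \<phi> x" "\<And>x. \<phi> x \<le> 1" "\<And>x. \<phi> x = (\<integral>z. g (\<phi> (x - z)) \<partial>excess)"
    "(\<phi> \<longlongrightarrow> 0) at_bot" "(\<phi> \<longlongrightarrow> 1) at_top"
proof -
  obtain l where l: "l > 0" "s * (\<integral>z. exp (- l * z) \<partial>excess) = 1" "integrable excess (\<lambda>z. exp (- l * z))"
    using excess_exponential_root[OF s] by blast
  have g01: "0 \<le> g y \<and> g y \<le> 1" if "0 \<le> y" "y \<le> 1" for y
    using gm[of 0 y] gm[of y 1] lin[of 0] a g1 that by auto
  define T where "T u x = (\<integral>z. g (u (x - z)) \<partial>excess)" for u x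
  define S where "S = {u :: real \<Rightarrow> real. mono u \<and> (\<forall>x. 0 \<le> u x \<and> u x \<le> 1 \<and> u x \<le> exp (l * x)) \<and> (\<forall>x. u x \<le> T u x)}"
  have exp_eq: "(\<integral>z. s * exp (l * (x - z)) \<partial>excess) = exp (l * x)" and exp_int: "integrable excess (\<lambda>z. s * exp (l * (x - z)))" for x
  proof -
    have *: "s * exp (l * (x - z)) = exp (l * x) * s * exp (- l * z)" for z
      by (simp add: exp_add[symmetric] algebra_simps)
    show "integrable excess (\<lambda>z. s * exp (l * (x - z)))"
      unfolding * using l(3) by (rule integrable_mult_right)
    have "(\<integral>z. s * exp (l * (x - z)) \<partial>excess) = exp (l * x) * (s * (\<integral>z. exp (- l * z) \<partial>excess))"
      unfolding * by simp
    then show "(\<integral>z. s * exp (l * (x - z)) \<partial>excess) = exp (l * x)" by (simp only: l(2) mult_1_right)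
  qed
  have Tmono: "T u x \<le> T w y"
    if "mono u" "\<And>x. 0 \<le> u x" "\<And>x. u x \<le> 1" "mono w" "\<And>x. 0 \<le> w x" "\<And>x. w x \<le> 1" "\<And>z. u z \<le> w z" "x \<le> y" for u w x y
    unfolding T_def
  proof (rule excess_average_mono[OF g gm])
    fix z
    show "u (x - z) \<le> w (y - z)"
      using that(7)[of "x - z"] monoD[OF that(4), of "x - z" "y - z"] that(8) by auto
  qed (use that in \<open>auto intro: borel_measurable_mono\<close>)
  define b where "b x = min a (exp (l * x))" for x
  have b01: "0 \<le> b x" "b x \<le> 1" "mono b" for x
    using a l by (auto simp: b_def mono_def min_le_iff_disj)
  have bS: "b \<in> S"
  proof -
    have "b x \<le> T b x" for x
    proof -
      define x0 where "x0 = ln a / l"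
      have x0: "exp (l * y) \<le> a \<longleftrightarrow> y \<le> x0" for y
      proof -
        have "exp (l * y) \<le> a \<longleftrightarrow> l * y \<le> ln a"
          using a by (metis exp_le_cancel_iff exp_ln)
        then show ?thesis using l by (simp add: x0_def field_simps)
      qed
      have below: "T b y = exp (l * y)" if "y \<le> x0" for y
      proof -
        have "T b y = (\<integral>z. s * exp (l * (y - z)) \<partial>excess)"
          unfolding T_def
        proof (rule integral_cong_AE)
          show "AE z in excess. g (b (y - z)) = s * exp (l * (y - z))"
            using AE_excess_pos
          proof eventually_elim
            case (elim z)
            have "exp (l * (y - z)) \<le> a" using elim that by (simp add: x0)
            then show ?case using lin[of "exp (l * (y - z))"] by (simp add: b_def min_def)
          qed
          show "(\<lambda>z. g (b (y - z))) \<in> borel_measurable excess"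
            by (rule borel_measurable_integrable[OF average_integrable[OF g b01(1,2) borel_measurable_mono[OF b01(3)]]])
        qed auto
        then show ?thesis by (simp only: exp_eq)
      qed
      show ?thesis
      proof (cases "x \<le> x0")
        case True
        then show ?thesis by (simp add: below b_def)
      next
        case False
        have "b x \<le> exp (l * x0)"
          using x0[of x0] a l by (simp add: b_def x0_def)
        also have "\<dots> = T b x0" by (simp add: below)
        also have "\<dots> \<le> T b x"
          using False b01 by (intro Tmono) auto
        finally show ?thesis .
      qed
    qed
    then show ?thesis using b01 by (auto simp: S_def b_def)
  qed
  define \<phi> where "\<phi> x = (SUP u\<in>S. u x)" for x
  have bdd: "bdd_above ((\<lambda>u. u x) ` S)" for x
    by (rule bdd_aboveI[of _ 1]) (auto simp: S_def)
  have upper: "u x \<le> \<phi> x" if "u \<in> S" for u x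
    unfolding \<phi>_def using that bdd by (intro cSUP_upper) auto
  have least: "\<phi> x \<le> c" if "\<And>u. u \<in> S \<Longrightarrow> u x \<le> c" for x c
    unfolding \<phi>_def using that bS by (intro cSUP_least) auto
  have \<phi>m: "mono \<phi>"
  proof (rule monoI)
    fix x y :: real assume "x \<le> y"
    show "\<phi> x \<le> \<phi> y"
    proof (rule least)
      fix u assume u: "u \<in> S"
      then have "u x \<le> u y" using \<open>x \<le> y\<close> by (auto simp: S_def mono_def)
      with upper[OF u, of y] show "u x \<le> \<phi> y" by simp
    qed
  qed
  have \<phi>0: "0 \<le> \<phi> x" for x using b01(1)[of x] upper[OF bS, of x] by simp
  have \<phi>1: "\<phi> x \<le> 1" for x by (rule least) (auto simp: S_def)
  have \<phi>e: "\<phi> x \<le> exp (l * x)" for x by (rule least) (auto simp: S_def)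
  have \<phi>T: "\<phi> x \<le> T \<phi> x" for x
  proof (rule least)
    fix u assume u: "u \<in> S"
    then have "u x \<le> T u x" by (auto simp: S_def)
    also have "\<dots> \<le> T \<phi> x"
      using u \<phi>m \<phi>0 \<phi>1 upper[OF u] by (intro Tmono) (auto simp: S_def)
    finally show "u x \<le> T \<phi> x" .
  qed
  have \<phi>int: "integrable excess (\<lambda>z. g (\<phi> (x - z)))" for x
    by (rule average_integrable[OF g \<phi>0 \<phi>1 borel_measurable_mono[OF \<phi>m]])
  have T01: "0 \<le> T \<phi> x" "T \<phi> x \<le> 1" for x
  proof -
    show "0 \<le> T \<phi> x" using \<phi>0[of x] \<phi>T[of x] by simp
    have "T \<phi> x \<le> (\<integral>z. 1 \<partial>excess)"
      unfolding T_def using g01 \<phi>0 \<phi>1 by (intro integral_mono \<phi>int) auto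
    then show "T \<phi> x \<le> 1" using excess.prob_space by simp
  qed
  have Te: "T \<phi> x \<le> exp (l * x)" for x
  proof -
    have "T \<phi> x \<le> (\<integral>z. s * exp (l * (x - z)) \<partial>excess)"
      unfolding T_def
    proof (rule integral_mono[OF \<phi>int exp_int])
      fix z
      have "g (\<phi> (x - z)) \<le> s * \<phi> (x - z)" using sup \<phi>0 \<phi>1 by auto
      also have "\<dots> \<le> s * exp (l * (x - z))" using s \<phi>e by (intro mult_left_mono) auto
      finally show "g (\<phi> (x - z)) \<le> s * exp (l * (x - z))" .
    qed
    then show ?thesis by (simp only: exp_eq)
  qed
  have Tm: "mono (T \<phi>)"
    by (rule monoI) (intro Tmono \<phi>m \<phi>0 \<phi>1 order_refl)
  have "T \<phi> \<in> S"
    unfolding S_def using Tm T01 Te \<phi>T by (auto intro!: Tmono \<phi>m \<phi>0 \<phi>1)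
  then have fp: "\<phi> x = T \<phi> x" for x
    using upper[of "T \<phi>" x] \<phi>T[of x] by simp
  obtain l' L where lL: "(\<phi> \<longlongrightarrow> l') at_bot" "(\<phi> \<longlongrightarrow> L) at_top" "\<And>x. l' \<le> \<phi> x" "\<And>x. \<phi> x \<le> L" "0 \<le> l'" "L \<le> 1" "g L = L"
    by (rule excess_fixpoint_limits[OF g \<phi>m \<phi>0 \<phi>1 fp[unfolded T_def]]) blast
  have "filterlim (\<lambda>x. l * x) at_bot at_bot"
    using l(1) by (rule filterlim_tendsto_pos_mult_at_bot[OF tendsto_const _ filterlim_ident])
  then have "((\<lambda>x. exp (l * x)) \<longlongrightarrow> 0) at_bot"
    by (rule filterlim_compose[OF exp_at_bot])
  then have bot: "(\<phi> \<longlongrightarrow> 0) at_bot"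
    by (rule tendsto_sandwich[OF _ _ tendsto_const, rotated 2]) (auto intro!: always_eventually \<phi>0 \<phi>e)
  have "b 0 \<le> \<phi> 0" by (rule upper[OF bS])
  then have "0 < L" using lL(4)[of 0] a by (simp add: b_def)
  then have "L = 1" using above[of L] lL(6,7) by force
  with lL(2) have top: "(\<phi> \<longlongrightarrow> 1) at_top" by simp
  show thesis
    by (rule that[OF \<phi>m \<phi>0 \<phi>1 fp[unfolded T_def] bot top])
qed

text \<open>
  Cut \<open>h = H / H(1)\<close> off by its chord from 0 to \<open>a n\<close>, so that the result \<open>g n\<close> is linear up to \<open>a n\<close>, and
  let \<open>a n\<close> tend to 0. The fixed points for \<open>g n\<close> are uniformly Lipschitz; shifted to have the value 1/2 at 0, they
  have a Helly limit that is a fixed point for \<open>h\<close>. Its limits at infinity are fixed points of \<open>h\<close>, that is, 0 or 1,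
  and the normalisation excludes that they coincide. The cut-off provides the explicit subsolution, which a
  merely continuous \<open>\<eta>\<close> does not.
\<close>
lemma exists_profile: obtains \<phi> where "profile \<phi>"
proof -
  define h where "h u = H u / H1" for u
  have h_cont: "continuous_on {0..1} h"
    unfolding h_def using H1_pos by (intro continuous_intros H_cont) auto
  have h_mono: "h y \<le> h y'" if "0 \<le> y" "y \<le> y'" "y' \<le> 1" for y y'
    unfolding h_def using H1_pos that by (intro divide_right_mono H_mono) auto
  have h0: "h 0 = 0" and h1: "h 1 = 1" using H1_pos by (auto simp: h_def H1_def)
  have h_above: "u < h u" if "0 < u" "u < 1" for u
  proof -
    have "0 < 2 * (H (1/2) / H1 - 1/2) * min u (1 - u)"
      using H_concave_gap(1) that by (intro mult_pos_pos) auto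
    then show ?thesis using H_concave_gap(2)[of u] that by (simp add: h_def)
  qed
  have h_slope: "h a * u \<le> a * h u" if "0 \<le> u" "u \<le> a" "a \<le> 1" for u a
  proof -
    have "u * (H a - H u) \<le> u * (\<eta> u * (a - u))"
      using that H_diff_bounds(2)[of u a] by (intro mult_left_mono) auto
    also have "\<dots> = (a - u) * (\<eta> u * u)" by (simp only: ac_simps)
    also have "\<dots> \<le> (a - u) * H u"
      using that H_diff_bounds(1)[of 0 u] by (intro mult_left_mono) auto
    finally have "H a * u \<le> a * H u" by (simp add: algebra_simps)
    then have "H a * u / H1 \<le> a * H u / H1"
      using H1_pos by (intro divide_right_mono) auto
    then show ?thesis by (simp add: h_def)
  qed
  \<comment> \<open>The offset 2 keeps \<open>a n\<close> strictly below 1 from the start.\<close>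
  define a where "a n = 1 / real (n + 2)" for n :: nat
  have a: "0 < a n" "a n < 1" for n by (auto simp: a_def)
  have a0: "a \<longlonglongrightarrow> 0"
    unfolding a_def using LIMSEQ_ignore_initial_segment[OF lim_1_over_n, of 2] by simp
  define s where "s n = h (a n) / a n" for n
  have s1: "s n > 1" for n using h_above[OF a] a[of n] by (simp add: s_def field_simps)
  define g where "g n u = min (h u) (s n * u)" for n u
  have g_cont: "continuous_on {0..1} (g n)" for n
    unfolding g_def by (intro continuous_intros h_cont)
  have g_mono: "g n y \<le> g n y'" if "0 \<le> y" "y \<le> y'" "y' \<le> 1" for n y y'
    unfolding g_def using h_mono[OF that] s1[of n] that
    by (intro min.mono mult_left_mono) auto
  have g_lin: "g n y = s n * y" if "0 \<le> y" "y \<le> a n" for n y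
    using h_slope[of y "a n"] that a[of n] by (simp add: g_def s_def min_def field_simps)
  have g_h: "g n y = h y" if "a n \<le> y" "y \<le> 1" for n y
    using h_slope[of "a n" y] that a[of n] by (simp add: g_def s_def min_def field_simps)
  have g_sup: "g n y \<le> s n * y" for n y by (simp add: g_def)
  have g1: "g n 1 = 1" for n using g_h[of n 1] a[of n] h1 by simp
  have g_above: "y < g n y" if "0 < y" "y < 1" for n y
    using h_above[OF that] s1[of n] that by (simp add: g_def)
  have g01: "0 \<le> g n y \<and> g n y \<le> 1" if "0 \<le> y" "y \<le> 1" for n y
    using g_mono[of 0 y n] g_mono[of y 1 n] that g_lin[of 0 n] a[of n] g1[of n] by auto
  have gh_err: "\<bar>g n y - h y\<bar> \<le> h (a n)" if "0 \<le> y" "y \<le> 1" for n y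
  proof (cases "y \<le> a n")
    case True
    have "0 \<le> g n y" "g n y \<le> h y" "0 \<le> h y" "h y \<le> h (a n)"
      using g01[OF that, of n] h_mono[of 0 y] h_mono[of y "a n"] that True a[of n] h0 by (auto simp: g_def)
    then show ?thesis by auto
  next
    case False
    then show ?thesis using g_h[of n y] that h_mono[of 0 "a n"] a[of n] h0 by auto
  qed
  have "\<exists>\<phi>. mono \<phi> \<and> (\<forall>x. 0 \<le> \<phi> x) \<and> (\<forall>x. \<phi> x \<le> 1) \<and> (\<forall>x. \<phi> x = (\<integral>z. g n (\<phi> (x - z)) \<partial>excess)) \<and> \<phi> 0 = 1/2" for n
  proof -
    obtain \<phi> where \<phi>: "mono \<phi>" "\<And>x. 0 \<le> \<phi> x" "\<And>x. \<phi> x \<le> 1" "\<And>x. \<phi> x = (\<integral>z. g n (\<phi> (x - z)) \<partial>excess)"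
      "(\<phi> \<longlongrightarrow> 0) at_bot" "(\<phi> \<longlongrightarrow> 1) at_top"
      by (rule linearized_fixpoint[OF g_cont[of n] g_mono s1[of n] a[of n] g_lin g_sup g1 g_above])
         ((assumption | rule that)+)
    have lip: "\<phi> (x + e) \<le> \<phi> x + e / m1" if "0 \<le> e" for x e
      using excess_average_lipschitz[OF g_cont g01 \<phi>(2,3) borel_measurable_mono[OF \<phi>(1)] that, of n x]
      by (simp only: \<phi>(4)[symmetric])
    have "continuous_on UNIV \<phi>"
      by (rule continuous_of_mono_lipschitz[OF \<phi>(1) lip])
    moreover obtain p where "\<phi> p < 1/2"
      using order_tendstoD(2)[OF \<phi>(5), of "1/2"] by (auto simp: eventually_at_bot_linorder)
    moreover obtain q where "\<phi> q > 1/2"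
      using order_tendstoD(1)[OF \<phi>(6), of "1/2"] by (auto simp: eventually_at_top_linorder)
    moreover have "p \<le> q"
      using monoD[OF \<phi>(1), of q p] calculation by (cases "p \<le> q") auto
    ultimately obtain c where c: "\<phi> c = 1/2"
      using IVT'[of \<phi> p "1/2" q] continuous_on_subset by (metis less_imp_le subset_UNIV)
    define \<psi> where "\<psi> x = \<phi> (x + c)" for x
    have "\<psi> x = (\<integral>z. g n (\<psi> (x - z)) \<partial>excess)" for x
      using \<phi>(4)[of "x + c"] by (simp add: \<psi>_def algebra_simps)
    moreover have "mono \<psi>" using \<phi>(1) by (auto simp: mono_def \<psi>_def)
    moreover have "0 \<le> \<psi> x" "\<psi> x \<le> 1" for x using \<phi>(2,3) by (auto simp: \<psi>_def)
    moreover have "\<psi> 0 = 1/2" using c by (simp add: \<psi>_def)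
    ultimately show ?thesis by blast
  qed
  then obtain P where P: "\<And>n. mono (P n)" "\<And>n x. 0 \<le> P n x" "\<And>n x. P n x \<le> 1"
    "\<And>n x. P n x = (\<integral>z. g n (P n (x - z)) \<partial>excess)" "\<And>n. P n 0 = 1/2"
    by metis
  have lip: "P n (x + e) \<le> P n x + e / m1" if "0 \<le> e" for n x e
    using excess_average_lipschitz[OF g_cont g01 P(2,3) borel_measurable_mono[OF P(1)] that, of n n x]
    by (simp only: P(4)[symmetric])
  have contP: "continuous_on UNIV (P n)" for n
    by (rule continuous_of_mono_lipschitz[OF P(1) lip])
  then have rc: "continuous (at_right x) (P n)" for n x
    by (simp add: continuous_on_eq_continuous_at continuous_at_imp_continuous_at_within)
  obtain r F where rF: "strict_mono r" "\<And>x. continuous (at_right x) F" "mono F"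
    "\<And>x. isCont F x \<Longrightarrow> (\<lambda>n. P (r n) x) \<longlonglongrightarrow> F x"
    using Helly_selection[of P 1, OF rc P(1)] P(2,3) by (auto simp: abs_le_iff)
  have dense: "\<exists>y. p < y \<and> y < q \<and> isCont F y" if "p < q" for p q
    using open_minus_countable[OF mono_ctble_discont[OF rF(3)], of "{p<..<q}"] that by auto
  have lipF: "F y \<le> F x + (y - x) / m1" if "isCont F x" "isCont F y" "x \<le> y" for x y
  proof (rule LIMSEQ_le)
    show "(\<lambda>n. P (r n) y) \<longlonglongrightarrow> F y" "(\<lambda>n. P (r n) x + (y - x) / m1) \<longlonglongrightarrow> F x + (y - x) / m1"
      using rF(4) that by (auto intro: tendsto_intros)
    show "\<exists>N. \<forall>n\<ge>N. P (r n) y \<le> P (r n) x + (y - x) / m1"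
      using lip[of "y - x" "r _" x] that by auto
  qed
  have isCont: "isCont F x" for x
    unfolding continuous_at_eps_delta
  proof (intro allI impI)
    fix e :: real assume e: "e > 0"
    define w where "w = e * m1 / 3"
    have w: "w > 0" using e m1_pos by (simp add: w_def)
    obtain p where p: "x - w < p" "p < x" "isCont F p" using dense[of "x - w" x] w by auto
    obtain q where q: "x < q" "q < x + w" "isCont F q" using dense[of x "x + w"] w by auto
    have "F q - F p \<le> (q - p) / m1" using lipF[OF p(3) q(3)] p q by auto
    also have "\<dots> < e" using p q m1_pos by (simp add: w_def divide_less_eq)
    finally have small: "F q - F p < e" .
    show "\<exists>d>0. \<forall>x'. dist x' x < d \<longrightarrow> dist (F x') (F x) < e"
    proof (intro exI[of _ "min (x - p) (q - x)"] conjI allI impI)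
      fix x' assume "dist x' x < min (x - p) (q - x)"
      then have "p \<le> x'" "x' \<le> q" by (auto simp: dist_real_def)
      then have "F p \<le> F x'" "F x' \<le> F q" "F p \<le> F x" "F x \<le> F q"
        using monoD[OF rF(3)] p q by auto
      then show "dist (F x') (F x) < e" using small by (auto simp: dist_real_def)
    qed (use p q in auto)
  qed
  have lim: "(\<lambda>n. P (r n) x) \<longlonglongrightarrow> F x" for x by (rule rF(4)[OF isCont])
  have F01: "0 \<le> F x" "F x \<le> 1" for x
    using LIMSEQ_le_const[OF lim] LIMSEQ_le_const2[OF lim] P(2,3) by auto
  have F0: "F 0 = 1/2" using lim[of 0] P(5) by (simp add: LIMSEQ_const_iff)
  have ar: "(\<lambda>n. h (a (r n))) \<longlonglongrightarrow> 0"
  proof -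
    have "(\<lambda>n. a (r n)) \<longlonglongrightarrow> 0"
      using LIMSEQ_subseq_LIMSEQ[OF a0 rF(1)] by (simp add: comp_def)
    then have "(\<lambda>n. h (a (r n))) \<longlonglongrightarrow> h 0"
      using a by (intro continuous_on_tendsto_compose[OF h_cont]) (auto intro!: always_eventually less_imp_le)
    then show ?thesis by (simp add: h0)
  qed
  have fp: "F x = (\<integral>z. h (F (x - z)) \<partial>excess)" for x
  proof -
    have "(\<lambda>n. \<integral>z. g (r n) (P (r n) (x - z)) \<partial>excess) \<longlonglongrightarrow> (\<integral>z. h (F (x - z)) \<partial>excess)"
    proof (rule integral_dominated_convergence[where w="\<lambda>_. 1"])
      show "AE z in excess. (\<lambda>n. g (r n) (P (r n) (x - z))) \<longlonglongrightarrow> h (F (x - z))"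
      proof (rule AE_I2)
        fix z
        have "(\<lambda>n. g (r n) (P (r n) (x - z)) - h (P (r n) (x - z))) \<longlonglongrightarrow> 0"
          by (rule Lim_null_comparison[OF _ ar]) (use gh_err P(2,3) in \<open>auto intro!: always_eventually\<close>)
        moreover have "(\<lambda>n. h (P (r n) (x - z))) \<longlonglongrightarrow> h (F (x - z))"
          using F01 P(2,3) by (intro continuous_on_tendsto_compose[OF h_cont lim]) (auto intro!: always_eventually)
        ultimately show "(\<lambda>n. g (r n) (P (r n) (x - z))) \<longlonglongrightarrow> h (F (x - z))"
          using tendsto_add by fastforce
      qed
      show "AE z in excess. norm (g (r n) (P (r n) (x - z))) \<le> 1" for n
        using g01[OF P(2,3)] by auto
      show "(\<lambda>z. g (r n) (P (r n) (x - z))) \<in> borel_measurable excess" for n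
        by (rule borel_measurable_integrable[OF average_integrable[OF g_cont P(2,3) borel_measurable_mono[OF P(1)]]])
      show "(\<lambda>z. h (F (x - z))) \<in> borel_measurable excess"
        by (rule borel_measurable_integrable[OF average_integrable[OF h_cont F01 borel_measurable_mono[OF rF(3)]]])
    qed simp
    then have "(\<lambda>n. P (r n) x) \<longlonglongrightarrow> (\<integral>z. h (F (x - z)) \<partial>excess)"
      by (simp only: P(4)[symmetric])
    then show ?thesis using lim LIMSEQ_unique by blast
  qed
  obtain l L where lL: "(F \<longlongrightarrow> l) at_bot" "(F \<longlongrightarrow> L) at_top" "\<And>x. l \<le> F x" "\<And>x. F x \<le> L" "0 \<le> l" "L \<le> 1"
      "h l = l" "h L = L"
    by (rule excess_fixpoint_limits[OF h_cont rF(3) F01 fp]) blast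
  have "l = 0" using lL(3)[of 0] F0 h_above[of l] lL(5,7) by force
  moreover have "L = 1" using lL(4)[of 0] F0 h_above[of L] lL(6,8) by force
  moreover have "\<exists>l. (F \<longlongrightarrow> l) (at_left x)" for x
    using isCont[of x] by (auto simp: continuous_within filterlim_at_split)
  ultimately have "distribution_function F"
    unfolding distribution_function_def using rF(2,3) F01 lL(1,2) by auto
  moreover have "continuous_on UNIV F"
    using isCont by (auto simp: continuous_on_eq_continuous_at)
  moreover have "F x = (\<integral>z. H (F (x - z)) \<partial>excess) / H1" for x
    using fp[of x] by (simp add: h_def)
  ultimately show thesis using that profile_of_fixpoint by blast
qed

end

section \<open>Compactness in \<open>L\<^sub>1\<close> and uniform convergence\<close>

lemma nn_integral_shift_real:
  fixes h :: "real \<Rightarrow> ennreal"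
  assumes "h \<in> borel_measurable borel"
  shows "(\<integral>\<^sup>+x. h (x + c) \<partial>lborel) = (\<integral>\<^sup>+x. h x \<partial>lborel)"
  using nn_integral_real_affine[OF assms, of 1 c] by (simp add: add.commute)

lemma tendsto_0_if_le_eps:
  fixes X :: "'a \<Rightarrow> ennreal"
  assumes "\<And>\<epsilon>::real. \<epsilon> > 0 \<Longrightarrow> eventually (\<lambda>n. X n \<le> ennreal \<epsilon>) F"
  shows "(X \<longlongrightarrow> 0) F"
proof (rule order_tendstoI)
  fix a :: ennreal assume "0 < a"
  then obtain b where b: "0 < b" "b < a" using dense by blast
  then obtain e where "b = ennreal e" "0 \<le> e" by (cases b) (auto simp: top_unique)
  with b have e: "0 < e" "ennreal e < a" by auto
  show "eventually (\<lambda>n. X n < a) F"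
    using assms[OF e(1)] by eventually_elim (use e in auto)
qed auto

text \<open>
  A form of the Vitali convergence theorem: above an integrable envelope \<open>K\<close> the functions carry little mass, and by
  Fatou so does the limit; below the envelope dominated convergence applies.
\<close>
lemma L1_convergence_of_tight:
  fixes w :: "nat \<Rightarrow> real \<Rightarrow> real" and u :: "real \<Rightarrow> real"
  assumes [measurable]: "\<And>n. w n \<in> borel_measurable borel" "u \<in> borel_measurable borel"
    and lim: "AE x in lborel. (\<lambda>n. w n x) \<longlonglongrightarrow> u x"
    and tight: "\<And>\<epsilon>. \<epsilon> > 0 \<Longrightarrow> \<exists>K. integrable lborel K \<and> (\<forall>x. 0 \<le> K x) \<and>
                  (\<forall>n. (\<integral>\<^sup>+x. ennreal (\<bar>w n x\<bar> - K x) \<partial>lborel) \<le> ennreal \<epsilon>)"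
  shows "integrable lborel u" and "(\<lambda>n. \<integral>\<^sup>+x. ennreal \<bar>w n x - u x\<bar> \<partial>lborel) \<longlonglongrightarrow> 0"
proof -
  have tail: "(\<integral>\<^sup>+x. ennreal (\<bar>u x\<bar> - K x) \<partial>lborel) \<le> ennreal \<epsilon>"
    if K: "K \<in> borel_measurable lborel" and le: "\<And>n. (\<integral>\<^sup>+x. ennreal (\<bar>w n x\<bar> - K x) \<partial>lborel) \<le> ennreal \<epsilon>" for K \<epsilon>
  proof -
    have [measurable]: "K \<in> borel_measurable borel" using K by simp
    have "(\<integral>\<^sup>+x. ennreal (\<bar>u x\<bar> - K x) \<partial>lborel) = (\<integral>\<^sup>+x. liminf (\<lambda>n. ennreal (\<bar>w n x\<bar> - K x)) \<partial>lborel)"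
    proof (rule nn_integral_cong_AE)
      show "AE x in lborel. ennreal (\<bar>u x\<bar> - K x) = liminf (\<lambda>n. ennreal (\<bar>w n x\<bar> - K x))"
        using lim
      proof eventually_elim
        case (elim x)
        have "(\<lambda>n. ennreal (\<bar>w n x\<bar> - K x)) \<longlonglongrightarrow> ennreal (\<bar>u x\<bar> - K x)"
          by (intro tendsto_ennrealI tendsto_intros elim)
        then show ?case using lim_imp_Liminf[OF trivial_limit_sequentially] by metis
      qed
    qed
    also have "\<dots> \<le> liminf (\<lambda>n. \<integral>\<^sup>+x. ennreal (\<bar>w n x\<bar> - K x) \<partial>lborel)"
      by (rule nn_integral_liminf) measurable
    also have "\<dots> \<le> ennreal \<epsilon>"
      by (rule Liminf_le) (auto simp: le)
    finally show ?thesis .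
  qed
  show "integrable lborel u"
  proof -
    obtain K where K: "integrable lborel K" "\<And>x. 0 \<le> K x" "\<And>n. (\<integral>\<^sup>+x. ennreal (\<bar>w n x\<bar> - K x) \<partial>lborel) \<le> ennreal 1"
      using tight[of 1] by auto
    have [measurable]: "K \<in> borel_measurable borel" using borel_measurable_integrable[OF K(1)] by simp
    have "(\<integral>\<^sup>+x. ennreal (norm (u x)) \<partial>lborel) \<le> (\<integral>\<^sup>+x. ennreal (K x) + ennreal (\<bar>u x\<bar> - K x) \<partial>lborel)"
    proof (rule nn_integral_mono)
      fix x
      show "ennreal (norm (u x)) \<le> ennreal (K x) + ennreal (\<bar>u x\<bar> - K x)"
        using K(2)[of x] by (cases "K x \<le> \<bar>u x\<bar>") (auto simp: ennreal_plus[symmetric] ennreal_neg intro: ennreal_leI simp del: ennreal_plus)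
    qed
    also have "\<dots> = (\<integral>\<^sup>+x. ennreal (K x) \<partial>lborel) + (\<integral>\<^sup>+x. ennreal (\<bar>u x\<bar> - K x) \<partial>lborel)"
      by (rule nn_integral_add) measurable
    also have "\<dots> \<le> (\<integral>\<^sup>+x. ennreal (K x) \<partial>lborel) + ennreal 1"
      by (intro add_left_mono tail[OF _ K(3)]) measurable
    also have "\<dots> < \<infinity>"
      using K(1,2) by (subst nn_integral_eq_integral) auto
    finally show ?thesis by (intro integrableI_bounded) auto
  qed
  show "(\<lambda>n. \<integral>\<^sup>+x. ennreal \<bar>w n x - u x\<bar> \<partial>lborel) \<longlonglongrightarrow> 0"
  proof (rule tendsto_0_if_le_eps)
    fix \<epsilon> :: real assume \<epsilon>: "\<epsilon> > 0"
    obtain K where K: "integrable lborel K" "\<And>x. 0 \<le> K x" "\<And>n. (\<integral>\<^sup>+x. ennreal (\<bar>w n x\<bar> - K x) \<partial>lborel) \<le> ennreal (\<epsilon> / 3)"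
      using tight[of "\<epsilon> / 3"] \<epsilon> by auto
    have [measurable]: "K \<in> borel_measurable borel" using borel_measurable_integrable[OF K(1)] by simp
    have "(\<lambda>n. \<integral>\<^sup>+x. ennreal (min \<bar>w n x - u x\<bar> (2 * K x)) \<partial>lborel) \<longlonglongrightarrow> (\<integral>\<^sup>+x. 0 \<partial>(lborel :: real measure))"
    proof (rule nn_integral_dominated_convergence[where w="\<lambda>x. ennreal (2 * K x)"])
      show "(\<integral>\<^sup>+x. ennreal (2 * K x) \<partial>lborel) < \<infinity>"
        using K(1,2) by (subst nn_integral_eq_integral) auto
      show "AE x in lborel. (\<lambda>n. ennreal (min \<bar>w n x - u x\<bar> (2 * K x))) \<longlonglongrightarrow> 0"
        using lim
      proof eventually_elim
        case (elim x)
        have "(\<lambda>n. ennreal (min \<bar>w n x - u x\<bar> (2 * K x))) \<longlonglongrightarrow> ennreal (min \<bar>u x - u x\<bar> (2 * K x))"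
          by (intro tendsto_ennrealI tendsto_intros tendsto_min elim)
        then show ?case using K(2)[of x] by simp
      qed
      show "AE x in lborel. ennreal (min \<bar>w n x - u x\<bar> (2 * K x)) \<le> ennreal (2 * K x)" for n
        by (auto intro!: ennreal_leI)
    qed measurable
    then have "eventually (\<lambda>n. (\<integral>\<^sup>+x. ennreal (min \<bar>w n x - u x\<bar> (2 * K x)) \<partial>lborel) < ennreal (\<epsilon> / 3)) sequentially"
      using \<epsilon> by (intro order_tendstoD(2)) auto
    then show "eventually (\<lambda>n. (\<integral>\<^sup>+x. ennreal \<bar>w n x - u x\<bar> \<partial>lborel) \<le> ennreal \<epsilon>) sequentially"
    proof eventually_elim
      case (elim n)
      have "(\<integral>\<^sup>+x. ennreal \<bar>w n x - u x\<bar> \<partial>lborel) \<le> (\<integral>\<^sup>+x. ennreal (min \<bar>w n x - u x\<bar> (2 * K x))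
          + ennreal (\<bar>w n x\<bar> - K x) + ennreal (\<bar>u x\<bar> - K x) \<partial>lborel)"
      proof (rule nn_integral_mono)
        fix x
        have m0: "ennreal (max 0 a) = ennreal a" for a by (cases "a \<ge> 0") (auto simp: ennreal_neg)
        have "\<bar>w n x - u x\<bar> \<le> min \<bar>w n x - u x\<bar> (2 * K x) + max 0 (\<bar>w n x\<bar> - K x) + max 0 (\<bar>u x\<bar> - K x)"
          using K(2)[of x] by (simp add: min_def max_def abs_if split: if_splits)
        then have "ennreal \<bar>w n x - u x\<bar> \<le> ennreal (min \<bar>w n x - u x\<bar> (2 * K x) + max 0 (\<bar>w n x\<bar> - K x) + max 0 (\<bar>u x\<bar> - K x))"
          by (rule ennreal_leI)
        also have "\<dots> = ennreal (min \<bar>w n x - u x\<bar> (2 * K x)) + ennreal (max 0 (\<bar>w n x\<bar> - K x)) + ennreal (max 0 (\<bar>u x\<bar> - K x))"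
          using K(2)[of x] by (simp add: ennreal_plus)
        finally show "ennreal \<bar>w n x - u x\<bar> \<le> ennreal (min \<bar>w n x - u x\<bar> (2 * K x)) + ennreal (\<bar>w n x\<bar> - K x) + ennreal (\<bar>u x\<bar> - K x)"
          unfolding m0 .
      qed
      also have "\<dots> = (\<integral>\<^sup>+x. ennreal (min \<bar>w n x - u x\<bar> (2 * K x)) \<partial>lborel)
          + (\<integral>\<^sup>+x. ennreal (\<bar>w n x\<bar> - K x) \<partial>lborel) + (\<integral>\<^sup>+x. ennreal (\<bar>u x\<bar> - K x) \<partial>lborel)"
        by (subst nn_integral_add; (subst nn_integral_add)?) measurable
      also have "\<dots> \<le> ennreal (\<epsilon> / 3) + ennreal (\<epsilon> / 3) + ennreal (\<epsilon> / 3)"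
        using elim by (intro add_mono K(3) tail[OF _ K(3)]) auto
      also have "\<dots> = ennreal \<epsilon>"
        using \<epsilon> by (simp add: ennreal_plus[symmetric] del: ennreal_plus)
      finally show ?case .
    qed
  qed
qed

text \<open>
  If a monotone function exceeds \<open>\<phi>\<close> by \<open>e\<close> at a point, it still exceeds it by \<open>e / 2\<close> on an interval of length
  \<open>e / (2 C)\<close> to the right, and similarly to the left when it falls short.
\<close>
lemma uniform_of_L1_mono:
  fixes g :: "real \<Rightarrow> real \<Rightarrow> real" and \<phi> :: "real \<Rightarrow> real"
  assumes mono: "eventually (\<lambda>t. mono (g t)) F" and C: "C > 0"
    and lip: "\<And>x y. x \<le> y \<Longrightarrow> \<phi> y \<le> \<phi> x + C * (y - x)"
    and L1: "((\<lambda>t. \<integral>\<^sup>+x. ennreal \<bar>g t x - \<phi> x\<bar> \<partial>lborel) \<longlongrightarrow> 0) F"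
  shows "uniform_limit UNIV g \<phi> F"
  unfolding uniform_limit_iff
proof (intro allI impI)
  fix e :: real assume e: "e > 0"
  define d where "d = e / (2 * C)"
  have d: "d > 0" "C * d = e / 2" using e C by (auto simp: d_def)
  have "eventually (\<lambda>t. (\<integral>\<^sup>+x. ennreal \<bar>g t x - \<phi> x\<bar> \<partial>lborel) < ennreal (e / 2 * d)) F"
    using e d by (intro order_tendstoD(2)[OF L1]) auto
  then show "eventually (\<lambda>t. \<forall>x\<in>UNIV. dist (g t x) (\<phi> x) < e) F"
    using mono
  proof eventually_elim
    case (elim t)
    have bound: False if le: "\<And>y. y \<in> {a..a + d} \<Longrightarrow> e / 2 \<le> \<bar>g t y - \<phi> y\<bar>" for a
    proof -
      have "(\<integral>\<^sup>+y. ennreal (e / 2) * indicator {a..a + d} y \<partial>lborel) \<le> (\<integral>\<^sup>+x. ennreal \<bar>g t x - \<phi> x\<bar> \<partial>lborel)"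
        using le by (intro nn_integral_mono) (auto split: split_indicator intro: ennreal_leI)
      moreover have "(\<integral>\<^sup>+y. ennreal (e / 2) * indicator {a..a + d} y \<partial>lborel) = ennreal (e / 2 * d)"
        using d e by (simp add: nn_integral_cmult_indicator ennreal_mult[symmetric])
      ultimately show False using elim(1) by simp
    qed
    show ?case
    proof
      fix x
      show "dist (g t x) (\<phi> x) < e"
      proof (rule ccontr)
        assume "\<not> dist (g t x) (\<phi> x) < e"
        then consider "g t x \<ge> \<phi> x + e" | "g t x \<le> \<phi> x - e"
          by (auto simp: dist_real_def abs_if split: if_splits)
        then show False
        proof cases
          case 1
          show False
          proof (rule bound[of x])
            fix y assume y: "y \<in> {x..x + d}"
            have "C * (y - x) \<le> C * d" using y C by (intro mult_left_mono) auto
            then have "\<phi> y \<le> \<phi> x + e / 2" using lip[of x y] y d by auto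
            moreover have "g t x \<le> g t y" using monoD[OF elim(2)] y by auto
            ultimately show "e / 2 \<le> \<bar>g t y - \<phi> y\<bar>" using 1 by linarith
          qed
        next
          case 2
          show False
          proof (rule bound[of "x - d"])
            fix y assume y: "y \<in> {x - d..x - d + d}"
            have "C * (x - y) \<le> C * d" using y C by (intro mult_left_mono) auto
            then have "\<phi> x \<le> \<phi> y + e / 2" using lip[of y x] y d by auto
            moreover have "g t y \<le> g t x" using monoD[OF elim(2)] y by auto
            ultimately show "e / 2 \<le> \<bar>g t y - \<phi> y\<bar>" using 2 by linarith
          qed
        qed
      qed
    qed
  qed
qed


context mean_field
begin

lemma AE_continuity_point:
  fixes F :: "real \<Rightarrow> real"
  assumes "mono F" shows "AE x in lborel. isCont F x"
proof -
  have "{x. \<not> isCont F x} \<in> null_sets lborel"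
    by (rule countable_imp_null_set_lborel[OF mono_ctble_discont[OF assms]])
  then show ?thesis
    by (auto intro: AE_I'[of "{x. \<not> isCont F x}"])
qed

lemma AE_MJ_of_AE_lborel:
  assumes "AE z in lborel. Q z" shows "AE z in MJ. Q z"
  unfolding MJ_def J'_density by (subst AE_density) (use assms in \<open>auto elim: eventually_mono\<close>)

lemma AE_lborel_of_AE_MJ:
  assumes "AE z in MJ. Q z" shows "AE z in lborel. 0 \<le> z \<longrightarrow> Q z"
proof -
  have "AE z in lborel. 0 < ennreal (indicator {0..} z * J' z) \<longrightarrow> Q z"
    using assms unfolding MJ_def J'_density by (subst (asm) AE_density) auto
  then show ?thesis
    by eventually_elim (auto simp: J'_pos)
qed

text \<open>
  The positive part is half the sum of the absolute value and the function itself; the integral of the former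
  does not increase, that of the latter is conserved.
\<close>
lemma one_sided_contraction:
  assumes f: "solution f" and g: "solution g" and t: "0 \<le> t"
    and int: "integrable lborel (\<lambda>x. f x 0 - g x 0)"
  shows "(\<integral>x. max 0 (f x t - g x t) \<partial>lborel) \<le> (\<integral>x. max 0 (f x 0 - g x 0) \<partial>lborel)"
    "(\<integral>x. max 0 (g x t - f x t) \<partial>lborel) \<le> (\<integral>x. max 0 (g x 0 - f x 0) \<partial>lborel)"
proof -
  have i: "integrable lborel (\<lambda>x. f x t - g x t)"
    by (rule solution_difference_integral(1)[OF f g t int])
  have eq: "(\<integral>x. f x t - g x t \<partial>lborel) = (\<integral>x. f x 0 - g x 0 \<partial>lborel)"
    by (rule solution_difference_integral(2)[OF f g t int])
  have "(\<integral>\<^sup>+x. ennreal \<bar>f x t - g x t\<bar> \<partial>lborel) \<le> (\<integral>\<^sup>+x. ennreal \<bar>f x 0 - g x 0\<bar> \<partial>lborel)"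
    unfolding dissipation[OF f g order_refl t int, symmetric] by (rule add_increasing2) auto
  then have le: "(\<integral>x. \<bar>f x t - g x t\<bar> \<partial>lborel) \<le> (\<integral>x. \<bar>f x 0 - g x 0\<bar> \<partial>lborel)"
    using i int by (simp add: nn_integral_eq_integral integrable_abs)
  have *: "(\<integral>x. max 0 (w x) \<partial>lborel) = ((\<integral>x. \<bar>w x\<bar> \<partial>lborel) + (\<integral>x. w x \<partial>lborel)) / 2"
    "(\<integral>x. max 0 (- w x) \<partial>lborel) = ((\<integral>x. \<bar>w x\<bar> \<partial>lborel) - (\<integral>x. w x \<partial>lborel)) / 2"
    if "integrable lborel w" for w :: "real \<Rightarrow> real"
  proof -
    have "(\<integral>x. max 0 (w x) \<partial>lborel) = (\<integral>x. (\<bar>w x\<bar> + w x) / 2 \<partial>lborel)"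
      "(\<integral>x. max 0 (- w x) \<partial>lborel) = (\<integral>x. (\<bar>w x\<bar> - w x) / 2 \<partial>lborel)"
      by (intro Bochner_Integration.integral_cong; auto simp: max_def)+
    then show "(\<integral>x. max 0 (w x) \<partial>lborel) = ((\<integral>x. \<bar>w x\<bar> \<partial>lborel) + (\<integral>x. w x \<partial>lborel)) / 2"
      "(\<integral>x. max 0 (- w x) \<partial>lborel) = ((\<integral>x. \<bar>w x\<bar> \<partial>lborel) - (\<integral>x. w x \<partial>lborel)) / 2"
      using that by simp_all
  qed
  show "(\<integral>x. max 0 (f x t - g x t) \<partial>lborel) \<le> (\<integral>x. max 0 (f x 0 - g x 0) \<partial>lborel)"
    using *(1)[OF i] *(1)[OF int] le eq by simp
  show "(\<integral>x. max 0 (g x t - f x t) \<partial>lborel) \<le> (\<integral>x. max 0 (g x 0 - f x 0) \<partial>lborel)"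
    using *(2)[OF i] *(2)[OF int] le eq by simp
qed

lemma profile_shift_integrable:
  assumes "profile \<phi>" shows "integrable lborel (\<lambda>x. \<phi> x - \<phi> (x - c))"
proof -
  note d = profileD(1)[OF assms] profileD(1)[OF profile_shift[OF assms, of c]]
  have "integrable lborel (\<lambda>x. (indicator {0..} x - \<phi> (x - c)) - (indicator {0..} x - \<phi> x))"
    using profile_finite_mean[OF assms] profile_finite_mean[OF profile_shift[OF assms, of c]]
    unfolding finite_mean_iff_integrable[OF d(1)] finite_mean_iff_integrable[OF d(2)]
    by (rule Bochner_Integration.integrable_diff[rotated])
  then show ?thesis by simp
qed

text \<open>
  Apply the one-sided contraction to \<open>f\<close> and the profiles shifted far to the left and to the right. Initially the part of
  \<open>f\<close> outside these barriers has a small integral, so this remains true forever, and the width of the region between the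
  barriers is the integrable envelope \<open>K\<close>.
\<close>
lemma tail_between_barriers:
  assumes f: "solution f" and p: "profile \<phi>"
    and int: "integrable lborel (\<lambda>x. f x 0 - \<phi> x)" and e: "\<epsilon> > 0"
  obtains K where "integrable lborel K" "\<And>x. 0 \<le> K x"
    "\<And>t. 0 \<le> t \<Longrightarrow> (\<integral>\<^sup>+x. ennreal (\<bar>f (x + v * t) t - \<phi> x\<bar> - K x) \<partial>lborel) \<le> ennreal \<epsilon>"
proof -
  note D = distribution_functionD[OF profileD(1)[OF p]]
  note D0 = distribution_functionD[OF solutionD(1)[OF f order_refl]]
  have [measurable]: "\<phi> \<in> borel_measurable borel"
    by (rule distribution_function_measurable[OF profileD(1)[OF p]])
  have [measurable]: "(\<lambda>x. f x t) \<in> borel_measurable borel" if "t \<ge> 0" for t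
    by (rule distribution_function_measurable[OF solutionD(1)[OF f that]])
  have sh: "solution (\<lambda>x t. \<phi> (x - v * t - c))" for c
    using profile_solution[OF profile_shift[OF p, of c]] by simp
  have int_c: "integrable lborel (\<lambda>x. f x 0 - \<phi> (x - c))" for c
    using Bochner_Integration.integrable_add[OF int profile_shift_integrable[OF p, of c]] by simp
  have lim1: "(\<lambda>n. \<integral>x. max 0 (f x 0 - \<phi> (x - (- real n))) \<partial>lborel) \<longlonglongrightarrow> (\<integral>x. 0 \<partial>(lborel :: real measure))"
  proof (rule integral_dominated_convergence[where w="\<lambda>x. \<bar>f x 0 - \<phi> x\<bar>"])
    show "AE x in lborel. (\<lambda>n. max 0 (f x 0 - \<phi> (x - (- real n)))) \<longlonglongrightarrow> 0"
    proof (rule AE_I2)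
      fix x
      have "(\<lambda>n. \<phi> (real n - (- x))) \<longlonglongrightarrow> 1"
        by (rule filterlim_compose[OF D(6) filterlim_real_minus_const])
      then have "(\<lambda>n. max 0 (f x 0 - \<phi> (real n - (- x)))) \<longlonglongrightarrow> max 0 (f x 0 - 1)"
        by (intro tendsto_intros tendsto_max)
      moreover have "max 0 (f x 0 - 1) = 0" "real n - (- x) = x - (- real n)" for n
        using D0(3)[of x] by auto
      ultimately show "(\<lambda>n. max 0 (f x 0 - \<phi> (x - (- real n)))) \<longlonglongrightarrow> 0"
        by (simp only:)
    qed
    show "AE x in lborel. norm (max 0 (f x 0 - \<phi> (x - (- real n)))) \<le> \<bar>f x 0 - \<phi> x\<bar>" for n
    proof (rule AE_I2)
      fix x
      show "norm (max 0 (f x 0 - \<phi> (x - (- real n)))) \<le> \<bar>f x 0 - \<phi> x\<bar>"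
        using D(7)[of x "x - (- real n)"] by (auto simp: max_def)
    qed
  qed (use int in auto)
  have lim2: "(\<lambda>n. \<integral>x. max 0 (\<phi> (x - real n) - f x 0) \<partial>lborel) \<longlonglongrightarrow> (\<integral>x. 0 \<partial>(lborel :: real measure))"
  proof (rule integral_dominated_convergence[where w="\<lambda>x. \<bar>f x 0 - \<phi> x\<bar>"])
    show "AE x in lborel. (\<lambda>n. max 0 (\<phi> (x - real n) - f x 0)) \<longlonglongrightarrow> 0"
    proof (rule AE_I2)
      fix x
      have "(\<lambda>n. \<phi> (- real n - (- x))) \<longlonglongrightarrow> 0"
        by (rule filterlim_compose[OF D(5) filterlim_minus_const_real])
      then have "(\<lambda>n. max 0 (\<phi> (- real n - (- x)) - f x 0)) \<longlonglongrightarrow> max 0 (0 - f x 0)"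
        by (intro tendsto_intros tendsto_max)
      moreover have "max 0 (0 - f x 0) = 0" "- real n - (- x) = x - real n" for n
        using D0(2)[of x] by auto
      ultimately show "(\<lambda>n. max 0 (\<phi> (x - real n) - f x 0)) \<longlonglongrightarrow> 0"
        by (simp only:)
    qed
    show "AE x in lborel. norm (max 0 (\<phi> (x - real n) - f x 0)) \<le> \<bar>f x 0 - \<phi> x\<bar>" for n
    proof (rule AE_I2)
      fix x
      show "norm (max 0 (\<phi> (x - real n) - f x 0)) \<le> \<bar>f x 0 - \<phi> x\<bar>"
        using D(7)[of "x - real n" x] by (auto simp: max_def)
    qed
  qed (use int in auto)
  have "eventually (\<lambda>n. (\<integral>x. max 0 (f x 0 - \<phi> (x - (- real n))) \<partial>lborel) < \<epsilon> / 2
      \<and> (\<integral>x. max 0 (\<phi> (x - real n) - f x 0) \<partial>lborel) < \<epsilon> / 2) sequentially"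
    using lim1 lim2 e by (intro eventually_conj order_tendstoD(2)) auto
  then obtain n where n: "(\<integral>x. max 0 (f x 0 - \<phi> (x - (- real n))) \<partial>lborel) < \<epsilon> / 2"
      "(\<integral>x. max 0 (\<phi> (x - real n) - f x 0) \<partial>lborel) < \<epsilon> / 2"
    by (auto simp: eventually_sequentially)
  define K where "K x = \<phi> (x + real n) - \<phi> (x - real n)" for x
  show thesis
  proof (rule that)
    show "integrable lborel K"
      unfolding K_def
      using Bochner_Integration.integrable_diff[OF profile_shift_integrable[OF p, of "real n"] profile_shift_integrable[OF p, of "- real n"]]
      by simp
    show "0 \<le> K x" for x using D(7)[of "x - real n" "x + real n"] by (simp add: K_def)
    fix t :: real assume t: "0 \<le> t"
    let ?P = "\<lambda>x. max 0 (f x t - \<phi> (x - v * t - (- real n)))"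
    let ?Q = "\<lambda>x. max 0 (\<phi> (x - v * t - real n) - f x t)"
    have "(\<integral>x. ?P x \<partial>lborel) \<le> (\<integral>x. max 0 (f x 0 - \<phi> (x - (- real n))) \<partial>lborel)"
      using one_sided_contraction(1)[OF f sh t, of "- real n"] int_c[of "- real n"] by simp
    then have P: "(\<integral>x. ?P x \<partial>lborel) \<le> \<epsilon> / 2" using n by simp
    have "(\<integral>x. ?Q x \<partial>lborel) \<le> (\<integral>x. max 0 (\<phi> (x - real n) - f x 0) \<partial>lborel)"
      using one_sided_contraction(2)[OF f sh t, of "real n"] int_c[of "real n"] by simp
    then have Q: "(\<integral>x. ?Q x \<partial>lborel) \<le> \<epsilon> / 2" using n by simp
    have iP: "integrable lborel ?P" and iQ: "integrable lborel ?Q"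
    proof -
      have 1: "integrable lborel (\<lambda>x. f x t - \<phi> (x - v * t - c))" for c
        using solution_difference_integral(1)[OF f sh t, of c] int_c[of c] by simp
      show "integrable lborel ?P"
        by (rule Bochner_Integration.integrable_bound[OF 1[of "- real n"]]) (use t in \<open>auto simp: max_def\<close>)
      show "integrable lborel ?Q"
        by (rule Bochner_Integration.integrable_bound[OF 1[of "real n"]]) (use t in \<open>auto simp: max_def\<close>)
    qed
    have "(\<integral>\<^sup>+x. ennreal (\<bar>f (x + v * t) t - \<phi> x\<bar> - K x) \<partial>lborel) \<le> (\<integral>\<^sup>+x. ennreal (?P (x + v * t)) + ennreal (?Q (x + v * t)) \<partial>lborel)"
    proof (rule nn_integral_mono)
      fix x
      have "\<bar>f (x + v * t) t - \<phi> x\<bar> - K x \<le> ?P (x + v * t) + ?Q (x + v * t)"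
        using D(7)[of "x - real n" x] D(7)[of x "x + real n"] by (auto simp: K_def max_def abs_if)
      then have "ennreal (\<bar>f (x + v * t) t - \<phi> x\<bar> - K x) \<le> ennreal (?P (x + v * t) + ?Q (x + v * t))"
        by (rule ennreal_leI)
      also have "\<dots> = ennreal (?P (x + v * t)) + ennreal (?Q (x + v * t))"
        by (rule ennreal_plus) auto
      finally show "ennreal (\<bar>f (x + v * t) t - \<phi> x\<bar> - K x) \<le> ennreal (?P (x + v * t)) + ennreal (?Q (x + v * t))" .
    qed
    also have "\<dots> = (\<integral>\<^sup>+x. ennreal (?P x) + ennreal (?Q x) \<partial>lborel)"
      by (rule nn_integral_shift_real) (use t in measurable)
    also have "\<dots> = (\<integral>\<^sup>+x. ennreal (?P x) \<partial>lborel) + (\<integral>\<^sup>+x. ennreal (?Q x) \<partial>lborel)"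
      by (rule nn_integral_add) (use t in measurable)
    also have "\<dots> = ennreal (\<integral>x. ?P x \<partial>lborel) + ennreal (\<integral>x. ?Q x \<partial>lborel)"
      using iP iQ by (simp add: nn_integral_eq_integral)
    also have "\<dots> \<le> ennreal (\<epsilon> / 2) + ennreal (\<epsilon> / 2)"
      using P Q by (intro add_mono ennreal_leI)
    also have "\<dots> = ennreal \<epsilon>" using e by (simp add: ennreal_plus[symmetric] del: ennreal_plus)
    finally show "(\<integral>\<^sup>+x. ennreal (\<bar>f (x + v * t) t - \<phi> x\<bar> - K x) \<partial>lborel) \<le> ennreal \<epsilon>" .
  qed
qed

end

section \<open>Long-time convergence\<close>

lemma AE_lborel_in_interval:
  assumes "AE x in lborel. Q x" "a < (b::real)"
  obtains x where "a \<le> x" "x < b" "Q x"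
proof (rule ccontr)
  assume "\<not> thesis"
  then have "\<not> Q x" if "x \<in> {a..<b}" for x
    using that \<open>\<And>x. a \<le> x \<Longrightarrow> x < b \<Longrightarrow> Q x \<Longrightarrow> thesis\<close> by auto
  then have "AE x in lborel. x \<notin> {a..<b}"
    using assms(1) by (auto elim: eventually_mono)
  then have "{a..<b} \<in> null_sets lborel"
    by (subst AE_iff_null_sets) auto
  then show False
    using assms(2) by (auto simp: null_sets_def)
qed

text \<open>
  By right-continuity, \<open>w\<close> is positive on an interval starting at \<open>p\<close> and negative on one starting at \<open>q\<close>. Almost
  every point of the second interval has almost no point of positivity to its left, although the first interval lies
  there.
\<close>
lemma no_sign_change:
  fixes w :: "real \<Rightarrow> real"
  assumes rc: "\<And>x. continuous (at_right x) w" and pq: "p < q" "w p > 0" "w q < 0"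
    and good: "AE x in lborel. w x < 0 \<longrightarrow> (AE z in lborel. 0 \<le> z \<longrightarrow> w (x - z) \<le> 0)"
  shows False
proof -
  have "(w \<longlongrightarrow> w p) (at_right p)" "(w \<longlongrightarrow> w q) (at_right q)"
    using rc by (auto simp: continuous_within)
  then have "eventually (\<lambda>y. w y > 0) (at_right p)" "eventually (\<lambda>y. w y < 0) (at_right q)"
    using pq by (auto intro: order_tendstoD)
  then obtain p' q' where p': "p < p'" "\<And>y. p < y \<Longrightarrow> y < p' \<Longrightarrow> w y > 0"
    and q': "q < q'" "\<And>y. q < y \<Longrightarrow> y < q' \<Longrightarrow> w y < 0"
    by (auto simp: eventually_at_right_field)
  obtain x where x: "q \<le> x" "x < q'" "w x < 0 \<longrightarrow> (AE z in lborel. 0 \<le> z \<longrightarrow> w (x - z) \<le> 0)"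
    using AE_lborel_in_interval[OF good q'(1)] by blast
  have "w x < 0" using x q'(2)[of x] pq by (cases "x = q") auto
  then have "AE z in lborel. 0 \<le> z \<longrightarrow> w (x - z) \<le> 0" using x by simp
  moreover define r where "r = min p' q"
  have "x - (p + r) / 2 < x - p" using p' pq by (auto simp: r_def)
  ultimately obtain z where z: "x - (p + r) / 2 \<le> z" "z < x - p" "0 \<le> z \<longrightarrow> w (x - z) \<le> 0"
    using AE_lborel_in_interval by blast
  have "r \<le> q" by (simp add: r_def)
  then have "0 \<le> z" using z(1) x(1) pq by (simp add: field_simps)
  moreover have "w (x - z) > 0"
  proof (rule p'(2))
    have "r \<le> p'" by (simp add: r_def)
    then show "x - z < p'" using z(1) p'(1) by (simp add: field_simps)
  qed (use z in simp)
  ultimately show False using z(3) by simp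
qed

context mean_field
begin

lemma sign_defect_integral_measurable:
  fixes D :: "real \<Rightarrow> real"
  assumes D [measurable]: "D \<in> borel_measurable borel"
  shows "(\<lambda>x. \<integral>z. \<bar>D (x - z)\<bar> - sgn (D x) * D (x - z) \<partial>MJ) \<in> borel_measurable borel"
proof (rule MJ.borel_measurable_lebesgue_integral)
  have [measurable]: "(sgn :: real \<Rightarrow> real) \<in> borel_measurable borel"
    by (rule borel_measurable_sgn)
  show "(\<lambda>(x, z). \<bar>D (x - z)\<bar> - sgn (D x) * D (x - z)) \<in> borel_measurable (borel \<Otimes>\<^sub>M MJ)"
    by measurable
qed

lemma sign_defect_shift: "sign_defect (\<lambda>y. f (y + c)) (\<lambda>y. g (y + c)) x = sign_defect f g (x + c)"
  by (simp add: sign_defect_def flux_diff_def algebra_simps)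

text \<open>
  Otherwise the dissipation up to a large time would exceed the initial distance.
\<close>
lemma small_dissipation_time:
  assumes f: "solution f" and g: "solution g"
    and int: "integrable lborel (\<lambda>x. f x 0 - g x 0)" and e: "\<epsilon> > 0" and T: "0 \<le> T"
  shows "\<exists>t\<ge>T. (\<integral>\<^sup>+x. ennreal (\<mu> * sign_defect (\<lambda>y. f y t) (\<lambda>y. g y t) x) \<partial>lborel) \<le> ennreal \<epsilon>"
proof (rule ccontr)
  assume neg: "\<not> ?thesis"
  have big: "ennreal \<epsilon> \<le> (\<integral>\<^sup>+x. ennreal (\<mu> * sign_defect (\<lambda>y. extended f y t) (\<lambda>y. extended g y t) x) \<partial>lborel)" if "t \<ge> T" for t
  proof -
    have "\<not> (\<integral>\<^sup>+x. ennreal (\<mu> * sign_defect (\<lambda>y. f y t) (\<lambda>y. g y t) x) \<partial>lborel) \<le> ennreal \<epsilon>"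
      using neg that by blast
    then have "ennreal \<epsilon> \<le> (\<integral>\<^sup>+x. ennreal (\<mu> * sign_defect (\<lambda>y. f y t) (\<lambda>y. g y t) x) \<partial>lborel)"
      by (simp only: not_le less_imp_le)
    moreover have "0 \<le> t" using that T by simp
    ultimately show ?thesis by (simp add: extended_eq)
  qed
  define C where "C = (\<integral>x. \<bar>f x T - g x T\<bar> \<partial>lborel)"
  have C: "(\<integral>\<^sup>+x. ennreal \<bar>f x T - g x T\<bar> \<partial>lborel) = ennreal C" "0 \<le> C"
    unfolding C_def using solution_difference_integral(1)[OF f g T int]
    by (auto intro!: nn_integral_eq_integral integrable_abs)
  define S where "S = T + (C + 1) / \<epsilon>"
  have S: "T \<le> S" using C e by (simp add: S_def)
  have "ennreal (C + 1) = (\<integral>\<^sup>+r. ennreal \<epsilon> * indicator {T..S} r \<partial>lborel)"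
    using e C S by (simp add: nn_integral_cmult_indicator ennreal_mult[symmetric] S_def)
  also have "\<dots> \<le> (\<integral>\<^sup>+r. indicator {T..S} r * (\<integral>\<^sup>+x. ennreal (\<mu> * sign_defect (\<lambda>y. extended f y r) (\<lambda>y. extended g y r) x) \<partial>lborel) \<partial>lborel)"
    using big by (intro nn_integral_mono) (auto split: split_indicator)
  also have "\<dots> \<le> ennreal C"
    unfolding C(1)[symmetric] dissipation[OF f g T S int, symmetric] by (rule add_increasing) auto
  finally show False using C(2) by (simp add: ennreal_le_iff)
qed

text \<open>
  By Fatou, the limit has zero defect at almost every point where it differs from \<open>\<phi>\<close>. At the other
  points the defects need not converge, since the sign function jumps at 0. The law \<open>J\<close> and Lebesgue measure on the half
  line have the same null sets, which turns the vanishing of the defect into a statement on almost all \<open>z \<ge> 0\<close>.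
\<close>
lemma sign_agreement_of_zero_defect:
  assumes F: "mono F" "\<And>x. 0 \<le> F x" "\<And>x. F x \<le> 1" and \<phi>: "distribution_function \<phi>"
    and G: "\<And>n. distribution_function (G n)"
    and lim: "\<And>x. isCont F x \<Longrightarrow> (\<lambda>n. G n x) \<longlonglongrightarrow> F x"
    and diss0: "(\<lambda>n. \<integral>\<^sup>+x. ennreal (sign_defect (G n) \<phi> x) \<partial>lborel) \<longlonglongrightarrow> 0"
  shows "AE x in lborel. F x \<noteq> \<phi> x \<longrightarrow> (AE z in lborel. 0 \<le> z \<longrightarrow> 0 \<le> sgn (F x - \<phi> x) * (F (x - z) - \<phi> (x - z)))"
proof -
  note P = distribution_functionD[OF \<phi>] and Gd = distribution_functionD[OF G]
  have sgnF: "sgn (flux_diff F \<phi> y) = sgn (F y - \<phi> y)" for y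
    unfolding flux_diff_def using F(2,3)[of y] P(2,3)[of y] H_strict[of "F y" "\<phi> y"] H_strict[of "\<phi> y" "F y"]
    by (cases "F y" "\<phi> y" rule: linorder_cases) auto
  have F_meas: "F \<in> borel_measurable borel" using F(1) by (rule borel_measurable_mono)
  have [measurable]: "flux_diff F \<phi> \<in> borel_measurable borel"
    unfolding flux_diff_def[abs_def]
    using continuous_compose_unit_measurable[OF H_cont F(2,3) F_meas] H_compose_measurable[OF \<phi>] by auto
  have D_le: "\<bar>flux_diff F \<phi> y\<bar> \<le> 1" for y
    unfolding flux_diff_def using H_bounds[OF F(2,3)[of y]] H_range[OF \<phi>, of y] F(3)[of y] by (auto simp: abs_le_iff)
  have D_int: "integrable MJ (\<lambda>z. flux_diff F \<phi> (x - z))" for x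
    using D_le by (intro MJ.integrable_const_bound[where B=1]) auto
  have diss_meas: "sign_defect (G n) \<phi> \<in> borel_measurable borel" for n
    unfolding sign_defect_def[abs_def] by (rule sign_defect_integral_measurable[OF flux_diff_measurable[OF G \<phi>]])
  have D_lim: "(\<lambda>n. flux_diff (G n) \<phi> y) \<longlonglongrightarrow> flux_diff F \<phi> y" if "isCont F y" for y
    unfolding flux_diff_def
    using F Gd by (intro tendsto_intros continuous_on_tendsto_compose[OF H_cont lim[OF that]]) auto
  have AEc: "AE y in lborel. isCont F y" by (rule AE_continuity_point[OF F(1)])
  have AEs: "AE z in lborel. isCont F (x - z)" for x
  proof -
    have "{y. \<not> isCont F y} \<in> sets borel"
      by (rule sets.countable[OF _ mono_ctble_discont[OF F(1)]]) simp
    then have "UNIV - {y. \<not> isCont F y} \<in> sets borel"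
      by auto
    also have "UNIV - {y. \<not> isCont F y} = {y. isCont F y}"
      by auto
    finally have "Measurable.pred borel (isCont F)"
      by (simp add: pred_def)
    then show ?thesis
      using AE_borel_affine[of "-1" "isCont F" x] AEc by simp
  qed
  have diss_lim: "(\<lambda>n. sign_defect (G n) \<phi> x) \<longlonglongrightarrow> sign_defect F \<phi> x" if x: "isCont F x" "flux_diff F \<phi> x \<noteq> 0" for x
    unfolding sign_defect_def
  proof (rule integral_dominated_convergence[where w="\<lambda>_. 2"])
    show "AE z in MJ. (\<lambda>n. \<bar>flux_diff (G n) \<phi> (x - z)\<bar> - sgn (flux_diff (G n) \<phi> x) * flux_diff (G n) \<phi> (x - z))
        \<longlonglongrightarrow> \<bar>flux_diff F \<phi> (x - z)\<bar> - sgn (flux_diff F \<phi> x) * flux_diff F \<phi> (x - z)"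
      using AE_MJ_of_AE_lborel[OF AEs[of x]]
    proof eventually_elim
      case (elim z)
      show ?case by (intro tendsto_intros tendsto_sgn D_lim elim x)
    qed
    show "AE z in MJ. norm (\<bar>flux_diff (G n) \<phi> (x - z)\<bar> - sgn (flux_diff (G n) \<phi> x) * flux_diff (G n) \<phi> (x - z)) \<le> 2" for n
    proof (rule AE_I2)
      fix z
      show "norm (\<bar>flux_diff (G n) \<phi> (x - z)\<bar> - sgn (flux_diff (G n) \<phi> x) * flux_diff (G n) \<phi> (x - z)) \<le> 2"
        using flux_diff_le_1[OF G \<phi>, of n "x - z"] by (auto simp: sgn_real_def)
    qed
    show "(\<lambda>z. \<bar>flux_diff (G n) \<phi> (x - z)\<bar> - sgn (flux_diff (G n) \<phi> x) * flux_diff (G n) \<phi> (x - z)) \<in> borel_measurable MJ" for n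
      using flux_diff_shift_integrable[OF G \<phi>, of n x] by auto
    show "(\<lambda>z. \<bar>flux_diff F \<phi> (x - z)\<bar> - sgn (flux_diff F \<phi> x) * flux_diff F \<phi> (x - z)) \<in> borel_measurable MJ"
      using D_int[of x] by auto
  qed simp
  have dm [measurable]: "sign_defect F \<phi> \<in> borel_measurable borel"
    unfolding sign_defect_def[abs_def] by (rule sign_defect_integral_measurable) measurable
  have "(\<integral>\<^sup>+x. indicator {x. flux_diff F \<phi> x \<noteq> 0} x * ennreal (sign_defect F \<phi> x) \<partial>lborel) \<le> (\<integral>\<^sup>+x. liminf (\<lambda>n. ennreal (sign_defect (G n) \<phi> x)) \<partial>lborel)"
  proof (rule nn_integral_mono_AE)
    show "AE x in lborel. indicator {x. flux_diff F \<phi> x \<noteq> 0} x * ennreal (sign_defect F \<phi> x) \<le> liminf (\<lambda>n. ennreal (sign_defect (G n) \<phi> x))"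
      using AEc
    proof eventually_elim
      case (elim x)
      show ?case
      proof (cases "flux_diff F \<phi> x = 0")
        case False
        have "(\<lambda>n. ennreal (sign_defect (G n) \<phi> x)) \<longlonglongrightarrow> ennreal (sign_defect F \<phi> x)"
          by (intro tendsto_ennrealI diss_lim elim False)
        then have "liminf (\<lambda>n. ennreal (sign_defect (G n) \<phi> x)) = ennreal (sign_defect F \<phi> x)"
          by (rule lim_imp_Liminf[OF trivial_limit_sequentially])
        then show ?thesis using False by simp
      qed simp
    qed
  qed
  also have "\<dots> \<le> liminf (\<lambda>n. \<integral>\<^sup>+x. ennreal (sign_defect (G n) \<phi> x) \<partial>lborel)"
    using diss_meas by (intro nn_integral_liminf) auto
  also have "\<dots> = 0"
    by (rule lim_imp_Liminf[OF trivial_limit_sequentially diss0])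
  finally have "(\<integral>\<^sup>+x. indicator {x. flux_diff F \<phi> x \<noteq> 0} x * ennreal (sign_defect F \<phi> x) \<partial>lborel) = 0"
    by simp
  then have "AE x in lborel. indicator {x. flux_diff F \<phi> x \<noteq> 0} x * ennreal (sign_defect F \<phi> x) = 0"
    by (subst (asm) nn_integral_0_iff_AE) measurable
  then show ?thesis
  proof eventually_elim
    case (elim x)
    show ?case
    proof
      assume "F x \<noteq> \<phi> x"
      then have "flux_diff F \<phi> x \<noteq> 0" using sgnF[of x] by (metis sgn_zero_iff right_minus_eq)
      then have le: "sign_defect F \<phi> x \<le> 0" using elim by (simp add: ennreal_eq_0_iff)
      have i: "integrable MJ (\<lambda>z. \<bar>flux_diff F \<phi> (x - z)\<bar> - sgn (flux_diff F \<phi> x) * flux_diff F \<phi> (x - z))"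
        using D_int[of x] by auto
      have nn: "AE z in MJ. 0 \<le> \<bar>flux_diff F \<phi> (x - z)\<bar> - sgn (flux_diff F \<phi> x) * flux_diff F \<phi> (x - z)"
        by (rule AE_I2) (auto simp: sgn_real_def)
      have "sign_defect F \<phi> x = 0"
        using le integral_nonneg_AE[OF nn] by (simp add: sign_defect_def)
      then have "AE z in MJ. \<bar>flux_diff F \<phi> (x - z)\<bar> - sgn (flux_diff F \<phi> x) * flux_diff F \<phi> (x - z) = 0"
        using integral_nonneg_eq_0_iff_AE[OF i nn] by (simp add: sign_defect_def)
      from AE_lborel_of_AE_MJ[OF this]
      show "AE z in lborel. 0 \<le> z \<longrightarrow> 0 \<le> sgn (F x - \<phi> x) * (F (x - z) - \<phi> (x - z))"
      proof eventually_elim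
        case (elim z)
        show ?case
        proof
          assume "0 \<le> z"
          then have "\<bar>flux_diff F \<phi> (x - z)\<bar> = sgn (flux_diff F \<phi> x) * flux_diff F \<phi> (x - z)" using elim by simp
          then have "0 \<le> sgn (F x - \<phi> x) * flux_diff F \<phi> (x - z)" by (metis abs_ge_zero sgnF)
          then show "0 \<le> sgn (F x - \<phi> x) * (F (x - z) - \<phi> (x - z))"
            using sgnF[of "x - z"] by (auto simp: sgn_real_def split: if_splits)
        qed
      qed
    qed
  qed
qed

text \<open>
  Choose times along which the dissipation rate tends to 0, and let \<open>F\<close> be a Helly limit of the solution in the
  moving frame along these times. By tightness the convergence to \<open>F\<close> holds in \<open>L\<^sub>1\<close>, so \<open>F - \<phi>\<close> inherits the zero
  integral. It has constant sign and hence vanishes almost everywhere. The distance \<open>W\<close> is nonincreasing, so its limit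
  along the chosen times is its limit.
\<close>
theorem convergence_to_profile:
  assumes f: "solution f" and p: "profile \<phi>"
    and int: "integrable lborel (\<lambda>x. f x 0 - \<phi> x)"
    and zero: "(\<integral>x. f x 0 - \<phi> x \<partial>lborel) = 0"
  shows "((\<lambda>t. \<integral>\<^sup>+x. ennreal \<bar>f (x + v * t) t - \<phi> x\<bar> \<partial>lborel) \<longlongrightarrow> 0) at_top"
proof -
  have [measurable]: "\<phi> \<in> borel_measurable borel"
    by (rule distribution_function_measurable[OF profileD(1)[OF p]])
  define g where "g x t = \<phi> (x - v * t)" for x t
  have g: "solution g"
    using profile_solution[OF p] by (simp add: g_def[abs_def])
  have int': "integrable lborel (\<lambda>x. f x 0 - g x 0)" and zero': "(\<integral>x. f x 0 - g x 0 \<partial>lborel) = 0"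
    using int zero by (auto simp: g_def)
  define W where "W t = (\<integral>\<^sup>+x. ennreal \<bar>f (x + v * t) t - \<phi> x\<bar> \<partial>lborel)" for t
  have W: "W t = (\<integral>\<^sup>+x. ennreal \<bar>f x t - g x t\<bar> \<partial>lborel)" if t: "0 \<le> t" for t
  proof -
    have [measurable]: "(\<lambda>x. f x t) \<in> borel_measurable borel"
      by (rule distribution_function_measurable[OF solutionD(1)[OF f t]])
    have "(\<lambda>x. ennreal \<bar>f x t - g x t\<bar>) \<in> borel_measurable borel"
      unfolding g_def by measurable
    from nn_integral_shift_real[OF this, of "v * t"] show ?thesis
      by (simp add: W_def g_def)
  qed
  have anti: "W t \<le> W s" if "0 \<le> s" "s \<le> t" for s t
    unfolding W[OF that(1)] W[OF order_trans[OF that]] dissipation[OF f g that int', symmetric]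
    by (rule add_increasing2) auto
  have "\<forall>n. \<exists>t\<ge>real n. (\<integral>\<^sup>+x. ennreal (\<mu> * sign_defect (\<lambda>y. f y t) (\<lambda>y. g y t) x) \<partial>lborel) \<le> ennreal (\<mu> / real (Suc n))"
    using mu by (intro allI small_dissipation_time[OF f g int']) auto
  then obtain T where T: "\<And>n. real n \<le> T n"
    "\<And>n. (\<integral>\<^sup>+x. ennreal (\<mu> * sign_defect (\<lambda>y. f y (T n)) (\<lambda>y. g y (T n)) x) \<partial>lborel) \<le> ennreal (\<mu> / real (Suc n))"
    by metis
  have T0: "0 \<le> T n" for n using T(1)[of n] order_trans[of 0 "real n"] by simp
  define G where "G n x = f (x + v * T n) (T n)" for n x
  have Gd: "distribution_function (G n)" for n
    using distribution_function_shift[OF solutionD(1)[OF f T0[of n]], of "- (v * T n)"] by (simp add: G_def[abs_def])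
  note GD = distribution_functionD[OF Gd]
  \<comment> \<open>The limit may be defective as a distribution function; this is excluded only at the end, when it equals \<open>\<phi>\<close>.\<close>
  obtain r F where r: "strict_mono r" and F: "\<And>x. continuous (at_right x) F" "mono F"
    and lim: "\<And>x. isCont F x \<Longrightarrow> (\<lambda>n. G (r n) x) \<longlonglongrightarrow> F x"
    using Helly_selection[of G 1, OF GD(4) GD(1)] GD(2,3) by (auto simp: abs_le_iff)
  have dense: "\<exists>y. a < y \<and> y < b \<and> isCont F y" if "a < b" for a b
    using open_minus_countable[OF mono_ctble_discont[OF F(2)], of "{a<..<b}"] that by auto
  have F01: "0 \<le> F x" "F x \<le> 1" for x
  proof -
    obtain y where y: "x - 1 < y" "y < x" "isCont F y" using dense[of "x - 1" x] by auto
    have "0 \<le> F y" using GD(2) by (intro LIMSEQ_le_const[OF lim[OF y(3)]]) auto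
    then show "0 \<le> F x" using monoD[OF F(2), of y x] y by auto
    obtain y where y: "x < y" "y < x + 1" "isCont F y" using dense[of x "x + 1"] by auto
    have "F y \<le> 1" using GD(3) by (intro LIMSEQ_le_const2[OF lim[OF y(3)]]) auto
    then show "F x \<le> 1" using monoD[OF F(2), of x y] y by auto
  qed
  have [measurable]: "F \<in> borel_measurable borel" "G n \<in> borel_measurable borel" for n
    using borel_measurable_mono[OF F(2)] borel_measurable_mono[OF GD(1)] by auto
  have diss_le: "(\<integral>\<^sup>+x. ennreal (sign_defect (G n) \<phi> x) \<partial>lborel) \<le> ennreal (1 / real (Suc n))" for n
  proof -
    let ?f = "\<lambda>y. f y (T n)" and ?g = "\<lambda>y. g y (T n)"
    have dm: "sign_defect ?f ?g \<in> borel_measurable borel"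
      unfolding sign_defect_def[abs_def]
      by (rule sign_defect_integral_measurable[OF flux_diff_measurable[OF solutionD(1)[OF f T0] solutionD(1)[OF g T0]]])
    have "sign_defect (G n) \<phi> x = sign_defect ?f ?g (x + v * T n)" for x
      using sign_defect_shift[of ?f "v * T n" ?g x] by (simp add: G_def[abs_def] g_def)
    then have "(\<integral>\<^sup>+x. ennreal (sign_defect (G n) \<phi> x) \<partial>lborel) = (\<integral>\<^sup>+x. ennreal (sign_defect ?f ?g x) \<partial>lborel)"
      using nn_integral_shift_real[of "\<lambda>x. ennreal (sign_defect ?f ?g x)" "v * T n"] dm by simp
    moreover have "ennreal \<mu> * (\<integral>\<^sup>+x. ennreal (sign_defect ?f ?g x) \<partial>lborel) = (\<integral>\<^sup>+x. ennreal (\<mu> * sign_defect ?f ?g x) \<partial>lborel)"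
      using dm mu sign_defect_nonneg[OF solutionD(1)[OF f T0] solutionD(1)[OF g T0]]
      by (simp add: ennreal_mult nn_integral_cmult)
    ultimately have "ennreal \<mu> * (\<integral>\<^sup>+x. ennreal (sign_defect (G n) \<phi> x) \<partial>lborel) \<le> ennreal (\<mu> * (1 / real (Suc n)))"
      using T(2)[of n] by (simp only:) simp
    also have "\<dots> = ennreal \<mu> * ennreal (1 / real (Suc n))"
      using mu by (intro ennreal_mult) auto
    finally show ?thesis
      using mu by (subst (asm) ennreal_mult_le_mult_iff) auto
  qed
  have "(\<lambda>n. \<integral>\<^sup>+x. ennreal (sign_defect (G (r n)) \<phi> x) \<partial>lborel) \<longlonglongrightarrow> 0"
  proof (rule tendsto_sandwich[of "\<lambda>_. 0" _ _ "\<lambda>n. ennreal (1 / real (Suc (r n)))"])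
    have "(\<lambda>n. 1 / real (Suc (r n))) \<longlonglongrightarrow> 0"
      using LIMSEQ_subseq_LIMSEQ[OF LIMSEQ_inverse_real_of_nat r] by (simp add: comp_def inverse_eq_divide)
    then show "(\<lambda>n. ennreal (1 / real (Suc (r n)))) \<longlonglongrightarrow> 0"
      using tendsto_ennrealI by fastforce
  qed (auto intro!: always_eventually diss_le simp del: of_nat_Suc)
  note diss_lim = this
  have sign: "AE x in lborel. F x \<noteq> \<phi> x \<longrightarrow>
      (AE z in lborel. 0 \<le> z \<longrightarrow> 0 \<le> sgn (F x - \<phi> x) * (F (x - z) - \<phi> (x - z)))"
  proof (rule sign_agreement_of_zero_defect[where G="\<lambda>n. G (r n)"])
    show "(\<lambda>n. G (r n) x) \<longlonglongrightarrow> F x" if "isCont F x" for x by (rule lim[OF that])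
  qed (rule F(2) F01 profileD(1)[OF p] Gd diss_lim)+
  define u where "u x = F x - \<phi> x" for x
  define w where "w n x = G (r n) x - \<phi> x" for n x
  have [measurable]: "u \<in> borel_measurable borel" "w n \<in> borel_measurable borel" for n
    unfolding u_def w_def by measurable
  have wlim: "AE x in lborel. (\<lambda>n. w n x) \<longlonglongrightarrow> u x"
    using AE_continuity_point[OF F(2)]
    by eventually_elim (auto simp: w_def u_def intro!: tendsto_intros lim)
  have tight: "\<exists>K. integrable lborel K \<and> (\<forall>x. 0 \<le> K x) \<and>
      (\<forall>n. (\<integral>\<^sup>+x. ennreal (\<bar>w n x\<bar> - K x) \<partial>lborel) \<le> ennreal \<epsilon>)" if \<epsilon>: "\<epsilon> > 0" for \<epsilon>
  proof -
    obtain K where "integrable lborel K" "\<And>x. 0 \<le> K x"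
      "\<And>t. 0 \<le> t \<Longrightarrow> (\<integral>\<^sup>+x. ennreal (\<bar>f (x + v * t) t - \<phi> x\<bar> - K x) \<partial>lborel) \<le> ennreal \<epsilon>"
      using tail_between_barriers[OF f p int \<epsilon>] by blast
    then show ?thesis
      using T0 by (intro exI[of _ K]) (auto simp: w_def G_def)
  qed
  note u_int = L1_convergence_of_tight(1)[OF _ _ wlim tight, simplified]
  note u_lim = L1_convergence_of_tight(2)[OF _ _ wlim tight, simplified]
  have w_int: "integrable lborel (w n)" "(\<integral>x. w n x \<partial>lborel) = 0" for n
  proof -
    note I = solution_difference_integral[OF f g T0 int', of "r n"]
    have "w n x = f (v * T (r n) + 1 * x) (T (r n)) - g (v * T (r n) + 1 * x) (T (r n))" for x
      by (simp add: w_def G_def g_def add.commute)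
    then have eq: "w n = (\<lambda>x. f (v * T (r n) + 1 * x) (T (r n)) - g (v * T (r n) + 1 * x) (T (r n)))"
      by (rule ext)
    show "integrable lborel (w n)"
      unfolding eq using lborel_integrable_real_affine[OF I(1), of 1 "v * T (r n)"] by simp
    have "(\<integral>x. w n x \<partial>lborel) = (\<integral>x. f x (T (r n)) - g x (T (r n)) \<partial>lborel)"
      unfolding eq using lborel_integral_real_affine[of 1 "\<lambda>x. f x (T (r n)) - g x (T (r n))" "v * T (r n)"] by simp
    then show "(\<integral>x. w n x \<partial>lborel) = 0"
      using I(2) zero' by simp
  qed
  have u0: "(\<integral>x. u x \<partial>lborel) = 0"
  proof -
    have "ennreal \<bar>\<integral>x. u x \<partial>lborel\<bar> \<le> (\<integral>\<^sup>+x. ennreal \<bar>w n x - u x\<bar> \<partial>lborel)" for n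
    proof -
      have "(\<integral>x. w n x - u x \<partial>lborel) = - (\<integral>x. u x \<partial>lborel)"
        using w_int[of n] u_int by simp
      then show ?thesis
        using integral_norm_bound_ennreal[of lborel "\<lambda>x. w n x - u x"] w_int(1)[of n] u_int by simp
    qed
    then have "ennreal \<bar>\<integral>x. u x \<partial>lborel\<bar> \<le> 0"
      by (intro LIMSEQ_le_const[OF u_lim]) auto
    then show ?thesis by simp
  qed
  have u_rc: "continuous (at_right x) u" "continuous (at_right x) (\<lambda>x. - u x)" for x
  proof -
    have "isCont \<phi> x" using profileD(3)[OF p] by (simp add: continuous_on_eq_continuous_at)
    then show "continuous (at_right x) u"
      unfolding u_def[abs_def] by (rule continuous_diff[OF F(1) continuous_at_imp_continuous_at_within])
    then show "continuous (at_right x) (\<lambda>x. - u x)" by (rule continuous_minus)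
  qed
  have neg: "AE x in lborel. u x < 0 \<longrightarrow> (AE z in lborel. 0 \<le> z \<longrightarrow> u (x - z) \<le> 0)"
    using sign by eventually_elim (auto simp: u_def elim: eventually_mono)
  have pos: "AE x in lborel. - u x < 0 \<longrightarrow> (AE z in lborel. 0 \<le> z \<longrightarrow> - u (x - z) \<le> 0)"
    using sign by eventually_elim (auto simp: u_def elim: eventually_mono)
  \<comment> \<open>A sign change in either order is excluded by the same lemma, applied to \<open>u\<close> or to \<open>- u\<close>.\<close>
  have "(\<forall>x. 0 \<le> u x) \<or> (\<forall>x. u x \<le> 0)"
  proof (rule ccontr)
    assume "\<not> ?thesis"
    then obtain a b where ab: "u a > 0" "u b < 0" by (auto simp: not_le)
    then consider "a < b" | "b < a" by (cases a b rule: linorder_cases) auto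
    then show False
    proof cases
      case 1
      show False by (rule no_sign_change[OF u_rc(1) 1 ab neg])
    next
      case 2
      show False by (rule no_sign_change[OF u_rc(2) 2 _ _ pos]) (use ab in auto)
    qed
  qed
  then have "(\<integral>x. \<bar>u x\<bar> \<partial>lborel) = 0"
    using u0 by (auto simp: abs_of_nonneg abs_of_nonpos)
  then have u_null: "(\<integral>\<^sup>+x. ennreal \<bar>u x\<bar> \<partial>lborel) = 0"
    using u_int by (subst nn_integral_eq_integral) auto
  have "W (T (r n)) \<le> (\<integral>\<^sup>+x. ennreal \<bar>w n x - u x\<bar> \<partial>lborel)" for n
  proof -
    have "W (T (r n)) \<le> (\<integral>\<^sup>+x. ennreal \<bar>w n x - u x\<bar> + ennreal \<bar>u x\<bar> \<partial>lborel)"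
      unfolding W_def
    proof (rule nn_integral_mono)
      fix x
      have "\<bar>w n x\<bar> \<le> \<bar>w n x - u x\<bar> + \<bar>u x\<bar>" by simp
      then have "ennreal \<bar>w n x\<bar> \<le> ennreal (\<bar>w n x - u x\<bar> + \<bar>u x\<bar>)" by (rule ennreal_leI)
      then show "ennreal \<bar>f (x + v * T (r n)) (T (r n)) - \<phi> x\<bar> \<le> ennreal \<bar>w n x - u x\<bar> + ennreal \<bar>u x\<bar>"
        by (simp add: w_def G_def)
    qed
    also have "\<dots> = (\<integral>\<^sup>+x. ennreal \<bar>w n x - u x\<bar> \<partial>lborel) + (\<integral>\<^sup>+x. ennreal \<bar>u x\<bar> \<partial>lborel)"
      by (rule nn_integral_add) measurable
    finally show ?thesis by (simp add: u_null)
  qed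
  note W_sub = this
  show ?thesis
    unfolding W_def[symmetric]
  proof (rule tendsto_0_if_le_eps)
    fix \<epsilon> :: real assume "\<epsilon> > 0"
    then have "eventually (\<lambda>n. (\<integral>\<^sup>+x. ennreal \<bar>w n x - u x\<bar> \<partial>lborel) < ennreal \<epsilon>) sequentially"
      by (intro order_tendstoD(2)[OF u_lim]) auto
    then obtain n where "(\<integral>\<^sup>+x. ennreal \<bar>w n x - u x\<bar> \<partial>lborel) < ennreal \<epsilon>"
      by (auto simp: eventually_sequentially)
    then have "W (T (r n)) \<le> ennreal \<epsilon>"
      using order_trans[OF W_sub[of n]] by (meson less_imp_le)
    then have "W t \<le> ennreal \<epsilon>" if "T (r n) \<le> t" for t
      using anti[OF T0 that] by (meson order_trans)
    then show "eventually (\<lambda>t. W t \<le> ennreal \<epsilon>) at_top"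
      by (auto simp: eventually_at_top_linorder)
  qed
qed

lemma profile_lipschitz:
  assumes p: "profile \<phi>" and xy: "x \<le> y"
  shows "\<phi> y \<le> \<phi> x + 1 / (m1 * H1) * (y - x)"
proof (cases "x = y")
  case False
  then have "x < y" using xy by simp
  then have "\<exists>z>x. z < y \<and> \<phi> y - \<phi> x = (y - x) * (N \<phi> z / (m1 * H1))"
    by (rule MVT2) (rule profileD(2)[OF p])
  then obtain z where z: "\<phi> y - \<phi> x = (y - x) * (N \<phi> z / (m1 * H1))" by blast
  have "(y - x) * (N \<phi> z / (m1 * H1)) \<le> (y - x) * (1 / (m1 * H1))"
    using xy N_bounds(2)[OF profileD(1)[OF p], of z] m1_pos H1_pos
    by (intro mult_left_mono divide_right_mono) auto
  then show ?thesis using z by (simp add: mult.commute)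
qed simp

lemma mean_difference:
  assumes "distribution_function a" "distribution_function b" "finite_mean a" "finite_mean b"
  shows "integrable lborel (\<lambda>x. a x - b x)" "(\<integral>x. a x - b x \<partial>lborel) = mean b - mean a"
proof -
  have i: "integrable lborel (\<lambda>x. indicator {0..} x - a x)" "integrable lborel (\<lambda>x. indicator {0..} x - b x)"
    using assms finite_mean_iff_integrable by auto
  have eq: "(\<lambda>x. a x - b x) = (\<lambda>x. (indicator {0..} x - b x) - (indicator {0..} x - a x))"
    by auto
  show "integrable lborel (\<lambda>x. a x - b x)"
    unfolding eq by (rule Bochner_Integration.integrable_diff[OF i(2,1)])
  show "(\<integral>x. a x - b x \<partial>lborel) = mean b - mean a"
    unfolding eq Bochner_Integration.integral_diff[OF i(2,1)]
    using mean_eq_integral assms by simp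
qed

lemma solution_converges:
  assumes f: "solution f" and p: "profile \<phi>" and fm: "finite_mean (\<lambda>x. f x 0)"
    and eq: "mean \<phi> = mean (\<lambda>x. f x 0)"
  shows "((\<lambda>t. \<integral>\<^sup>+x. ennreal \<bar>f (x + v * t) t - \<phi> x\<bar> \<partial>lborel) \<longlongrightarrow> 0) at_top"
    "uniform_limit UNIV (\<lambda>t x. f (x + v * t) t) \<phi> at_top"
proof -
  note M = mean_difference[OF solutionD(1)[OF f order_refl] profileD(1)[OF p] fm profile_finite_mean[OF p]]
  show L1: "((\<lambda>t. \<integral>\<^sup>+x. ennreal \<bar>f (x + v * t) t - \<phi> x\<bar> \<partial>lborel) \<longlongrightarrow> 0) at_top"
    using M eq by (intro convergence_to_profile[OF f p]) auto
  show "uniform_limit UNIV (\<lambda>t x. f (x + v * t) t) \<phi> at_top"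
  proof (rule uniform_of_L1_mono[OF _ _ profile_lipschitz[OF p] L1])
    show "eventually (\<lambda>t. mono (\<lambda>x. f (x + v * t) t)) at_top"
      using eventually_ge_at_top[of 0]
    proof eventually_elim
      case (elim t)
      show ?case using distribution_functionD(1)[OF solutionD(1)[OF f elim]] by (auto simp: mono_def)
    qed
  qed (use m1_pos H1_pos in auto)
qed

text \<open>
  The second profile, travelling at speed \<open>v\<close>, is a solution that is constant in the moving frame and converges to the
  first.
\<close>
lemma profile_unique:
  assumes p: "profile \<phi>" and q: "profile \<psi>" and eq: "mean \<phi> = mean \<psi>"
  shows "\<phi> = \<psi>"
proof -
  have "uniform_limit UNIV (\<lambda>t x. \<psi> (x + v * t - v * t)) \<phi> at_top"
    using profile_finite_mean[OF q] eq by (intro solution_converges(2)[OF profile_solution[OF q] p]) auto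
  from tendsto_uniform_limitI[OF this UNIV_I]
  have "((\<lambda>t. \<psi> x) \<longlongrightarrow> \<phi> x) (at_top :: real filter)" for x
    by simp
  then show ?thesis
    using tendsto_unique[OF _ tendsto_const] by (metis ext trivial_limit_at_top_linorder)
qed

lemma profile_iff_shift:
  assumes p: "profile \<phi>"
  shows "profile \<psi> \<longleftrightarrow> (\<exists>c. \<psi> = (\<lambda>y. \<phi> (y - c)))"
proof
  assume q: "profile \<psi>"
  define c where "c = mean \<psi> - mean \<phi>"
  have "mean (\<lambda>y. \<phi> (y - c)) = mean \<psi>"
    using mean_shift[OF profileD(1)[OF p] profile_finite_mean[OF p], of c] by (simp add: c_def)
  then have "(\<lambda>y. \<phi> (y - c)) = \<psi>"
    by (rule profile_unique[OF profile_shift[OF p] q])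
  then show "\<exists>c. \<psi> = (\<lambda>y. \<phi> (y - c))" by metis
qed (auto intro: profile_shift[OF p])

lemma exists_unique_centered_profile: "\<exists>!\<phi>. profile \<phi> \<and> finite_mean \<phi> \<and> mean \<phi> = m"
proof -
  obtain \<phi> where p: "profile \<phi>" using exists_profile by blast
  define \<psi> where "\<psi> y = \<phi> (y - (m - mean \<phi>))" for y
  have q: "profile \<psi>" unfolding \<psi>_def[abs_def] by (rule profile_shift[OF p])
  moreover have "mean \<psi> = m"
    unfolding \<psi>_def[abs_def] using mean_shift[OF profileD(1)[OF p] profile_finite_mean[OF p]] by simp
  ultimately show ?thesis
    using profile_unique profile_finite_mean[OF q] by (intro ex1I[of _ \<psi>]) auto
qed

end

theorem theorem3p2:
  fixes \<mu> :: real and \<eta> J J' :: "real \<Rightarrow> real" and l :: nat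
  assumes mu: "\<mu> > 0"
    and eta_range: "\<eta> ` {0..1} \<subseteq> {0..1}"
    and eta_cont: "continuous_on {0..1} \<eta>"
    and eta_strict: "strict_antimono_on {0..1} \<eta>"
    and eta_0: "\<eta> 0 = 1" and eta_1: "\<eta> 1 = 0"
    and J_cdf: "distribution_function J"
    and J_nonneg: "\<forall>y<0. J y = 0"
    and l: "l \<ge> 2"
    and moments: "\<forall>k\<in>{1..l}. set_integrable (interval_measure J) {0..} (\<lambda>y. y ^ k)"
    and J'_meas: "J' \<in> borel_measurable borel"
    and J'_density: "interval_measure J = density lborel (\<lambda>y. ennreal (indicator {0..} y * J' y))"
    and J'_pos: "\<forall>y\<ge>0. J' y > 0"
    and J'_bdd: "\<forall>K. compact K \<and> K \<subseteq> {0..} \<longrightarrow> (\<exists>\<epsilon>>0. \<forall>y\<in>K. J' y \<ge> \<epsilon>)"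
  shows
    "(\<exists>\<phi>. traveling_wave_shape \<mu> \<eta> J \<phi> \<and>
        (\<forall>\<psi>. traveling_wave_shape \<mu> \<eta> J \<psi> \<longleftrightarrow> (\<exists>c. \<psi> = (\<lambda>y. \<phi> (y - c)))))
     \<and>
     (\<forall>f. mean_field_model \<mu> \<eta> J f \<and> finite_mean (\<lambda>x. f x 0) \<longrightarrow>
        (\<exists>!\<phi>. traveling_wave_shape \<mu> \<eta> J \<phi> \<and> finite_mean \<phi> \<and> mean \<phi> = mean (\<lambda>x. f x 0)) \<and>
        (\<forall>\<phi>. traveling_wave_shape \<mu> \<eta> J \<phi> \<and> finite_mean \<phi> \<and> mean \<phi> = mean (\<lambda>x. f x 0) \<longrightarrow>
           ((\<lambda>t. \<integral>\<^sup>+x. ennreal \<bar>f (x + speed \<mu> \<eta> J * t) t - \<phi> x\<bar> \<partial>lborel) \<longlongrightarrow> 0) at_top \<and>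
           uniform_limit UNIV (\<lambda>t x. f (x + speed \<mu> \<eta> J * t) t) \<phi> at_top))"
proof -
  have nonneg: "AE y in interval_measure J. 0 \<le> y"
    unfolding J'_density using J'_meas by (subst AE_density) (auto split: split_indicator)
  have moment: "integrable (interval_measure J) (\<lambda>y. y ^ k)" if "k \<in> {1..l}" for k
  proof -
    have "integrable (interval_measure J) (\<lambda>y. indicator {0..} y *\<^sub>R y ^ k)"
      using moments that by (simp add: set_integrable_def)
    then show ?thesis
      by (rule integrable_cong_AE_imp) (use nonneg in \<open>auto elim: eventually_mono\<close>)
  qed
  have anti: "\<eta> y < \<eta> x" if "0 \<le> x" "x < y" "y \<le> 1" for x y
    using eta_strict that by (auto simp: monotone_on_def)
  interpret mean_field \<eta> \<mu> J J'
  proof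
    show "\<eta> y \<le> \<eta> x" if "0 \<le> x" "x \<le> y" "y \<le> 1" for x y
      using anti[of x y] that by (cases "x = y") auto
    show "integrable (interval_measure J) (\<lambda>z. z)"
      using moment[of 1] l by simp
    show "integrable (interval_measure J) (\<lambda>z. z\<^sup>2)"
      using moment[of 2] l by simp
  qed (use assms anti in auto)
  obtain \<phi> where \<phi>: "profile \<phi>" using exists_profile by blast
  have existence: "\<exists>\<phi>. traveling_wave_shape \<mu> \<eta> J \<phi> \<and>
        (\<forall>\<psi>. traveling_wave_shape \<mu> \<eta> J \<psi> \<longleftrightarrow> (\<exists>c. \<psi> = (\<lambda>y. \<phi> (y - c))))"
    unfolding traveling_wave_shape_iff_profile using \<phi> profile_iff_shift[OF \<phi>] by blast
  show ?thesis
    using existence exists_unique_centered_profile solution_converges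
    unfolding traveling_wave_shape_iff_profile speed_eq mean_field_model_iff_solution
    by simp
qed


end
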